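(* Let $\Psi$ be the function on $[0,\infty)$ defined in the context. Then: (1) For every $z\in\mathbb{C}$ with $\Im(z)>1/2$, \[\int_0^\infty \Psi(t)\,e^{izt}\,dt=-\frac{1}{z^2}\,\frac{\xi'}{\xi}\Big(\frac12-iz\Big).\] (2) For every $t\ge 0$, \[\Psi(t)=\sum_{\gamma}\frac{1-\cos(\gamma t)}{\gamma^2}=\sum_{\gamma}\frac{1-e^{i\gamma t}}{\gamma^2},\] where both sums range over all zeros $\gamma$ of the entire function $z\mapsto \xi(1/2-iz)$, counted with multiplicity. (3) There is a constant $c>0$ such that $\Psi(t)\ll \exp(t/2-c\sqrt{t})$ for $t\ge 0$.
   Context: $\xi(s)=\frac12 s(s-1)\pi^{-s/2}\Gamma(s/2)\zeta(s)$ is the Riemann xi-function. $\Lambda$ is the von Mangoldt function ($\Lambda(n)=\log p$ if $n=p^k$, $k\ge1$, $p$ prime; $\Lambda(n)=0$ otherwise). $G=\sum_{n\ge0}(-1)^n(2n+1)^{-2}$ is Catalan's constant, $C=\pi^2+8G$, and $\Phi(z,s,a)=\sum_{n=0}^\infty (n+a)^{-s}z^n$ is the Hurwitz–Lerch zeta function. For $t\ge0$, \[\Psi(t):=4(e^{t/2}+e^{-t/2}-2)-\sum_{n\le e^t}\frac{\Lambda(n)}{\sqrt n}(t-\log n)+\frac t2\Big[\frac{\Gamma'}{\Gamma}\Big(\frac14\Big)-\log\pi\Big]+\frac14\Big(C-e^{-t/2}\Phi(e^{-2t},2,1/4)\Big).\] The notation $f\ll g$ means $|f|\le Mg$ for some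 constant $M>0$. *)

theory Defs
  imports
    "HOL-Complex_Analysis.Complex_Analysis"
    "HOL-Number_Theory.Prime_Powers"
begin

text \<open>
  The Riemann zeta function is the analytic continuation of the Dirichlet series to the plane
  punctured at 1; such a continuation is unique by the identity theorem. Its value at the pole is
  set to 0 by convention.
\<close>

definition zeta :: "complex \<Rightarrow> complex" where
  "zeta = (THE f. f holomorphic_on (- {1}) \<and> f 1 = 0 \<and>
                  (\<forall>s. Re s > 1 \<longrightarrow> f s = (\<Sum>n. 1 / of_nat (Suc n) powr s)))"

text \<open>
  The defining product of the xi-function has removable singularities at 1 (pole of zeta) and at
  0, -2, -4, ... (poles of the Gamma factor), where HOL's total functions return junk values.
  Removing them yields the entire function.
\<close>

definition xi :: "complex \<Rightarrow> complex" where
  "xi = remove_sings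
          (\<lambda>s. 1 / 2 * s * (s - 1) * of_real pi powr (- s / 2) * Gamma (s / 2) * zeta s)"

definition catalan_const :: real where
  "catalan_const = (\<Sum>n. (-1) ^ n / (2 * real n + 1) ^ 2)"

definition lerch_phi :: "'a::{ln, real_normed_field} \<Rightarrow> 'a \<Rightarrow> 'a \<Rightarrow> 'a" where
  "lerch_phi z s a = (\<Sum>n. (of_nat n + a) powr (- s) * z ^ n)"

definition Psi :: "real \<Rightarrow> real" where
  "Psi t =
     4 * (exp (t / 2) + exp (- t / 2) - 2)
     - (\<Sum>n | n \<ge> 1 \<and> real n \<le> exp t. mangoldt n / sqrt (real n) * (t - ln (real n)))
     + t / 2 * (Digamma (1 / 4) - ln pi)
     + 1 / 4 * ((pi ^ 2 + 8 * catalan_const) - exp (- t / 2) * lerch_phi (exp (- 2 * t)) 2 (1 / 4))"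

definition xi_line :: "complex \<Rightarrow> complex" where
  "xi_line z = xi (1 / 2 - \<i> * z)"

end

theory Submission
  imports Defs "HOL-Probability.Characteristic_Functions" "HOL-Real_Asymp.Real_Asymp"
begin

text \<open>
  Riemann's theta-function representation continues xi to an entire function of order one that is
  symmetric under s -> 1 - s, so that f(z) = xi(1/2 - iz) is even. Dividing f by its zeros in a disc of
  radius R and applying the maximum principle on the circle of radius 4R bounds the number of zeros;
  Borel-Caratheodory applied to the logarithm of the quotient, whose derivative vanishes at 0 by
  evenness, shows that f'/f(z) is the limit of the sums of 1/(z - gamma) over |gamma| <= R.

  Both the explicit formula for Psi and the sum over the zeros are continuous in t, and both have the
  Laplace transform w^{-2} (xi'/xi)(1/2 + w): for the former this is a termwise computation, for the
  latter it is the partial fraction expansion. Hence they agree. The bound on Psi follows by inserting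
  the classical zero-free region into the sum over the zeros:
  exp(-ct / log|gamma|) |gamma|^{-1/4} is at most about exp(-sqrt(ct)), and the sum of
  |gamma|^{-7/4} converges.
\<close>

section \<open>Even entire functions of order one\<close>

text \<open>The integral for xi is bounded by a factorial n! with n close to |z|, that is by exp(C R
  log R), and R log R is rounded up to R^(5/4). This exponent leaves room on both sides: at most K
  R^(5/4) zeros have absolute value up to R, so the weight |gamma|^(-7/4) is summable, and 7/4 = 2 -
  1/4 means that a factor |gamma|^(1/4) can be spent against the denominator gamma^2 in the final
  bound. No product expansion of xi is needed, only f'/f. The definite description of zeta provides
  no continuation by itself; the continuation is built first, through \<open>xi_entire\<close>, and
  zeta and xi are identified with expressions in it afterwards. The two Laplace transforms are
  compared at integer points only, which reduces their uniqueness to polynomial approximation on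
  [0,1].\<close>

lemma Borel_Caratheodory_half:
  assumes hol: "L holomorphic_on ball 0 R" and R: "R > 0" and L0: "L 0 = 0"
    and Re_less: "\<And>z. norm z < R \<Longrightarrow> Re (L z) < A" and z: "norm z \<le> R / 2"
  shows "norm (L z) \<le> 2 * A"
proof -
  have A: "A > 0" using Re_less[of 0] L0 R by simp
  \<comment> \<open>The Moebius map u -> u / (2A - u) sends the half-plane Re u < A into the unit
    disc and fixes 0, so after rescaling the disc to radius 1 the Schwarz lemma applies.\<close>
  define h where "h w = L (of_real R * w) / (2 * of_real A - L (of_real R * w))" for w
  have in_ball: "norm (of_real R * w) < R" if "norm w < 1" for w :: complex
    using that R by (simp add: norm_mult)
  have ne: "2 * of_real A - L (of_real R * w) \<noteq> 0" if "norm w < 1" for w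
    using Re_less[OF in_ball[OF that]] A by (auto simp: complex_eq_iff)
  have norm_less: "norm (L u) < norm (2 * of_real A - L u)" if "norm u < R" for u
  proof -
    have "(norm (2 * of_real A - L u))^2 - (norm (L u))^2 = 4 * A * (A - Re (L u))"
      unfolding cmod_power2 by (simp add: power2_eq_square algebra_simps)
    moreover have "\<dots> > 0" using A Re_less[OF that] by simp
    ultimately have "(norm (L u))^2 < (norm (2 * of_real A - L u))^2" by linarith
    thus ?thesis by (rule power2_less_imp_less) simp
  qed
  have holR: "(\<lambda>w. L (of_real R * w)) holomorphic_on ball 0 1"
    by (rule holomorphic_on_compose_gen[OF _ hol, unfolded o_def])
       (use in_ball in \<open>auto intro!: holomorphic_intros\<close>)
  have "h holomorphic_on ball 0 1"
    unfolding h_def using holR ne by (intro holomorphic_intros) auto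
  moreover have "norm (h w) < 1" if "norm w < 1" for w
    using norm_less[OF in_ball[OF that]] ne[OF that] by (simp add: h_def norm_divide)
  moreover have "h 0 = 0" by (simp add: h_def L0)
  moreover define w where "w = z / of_real R"
  have w: "norm w \<le> 1 / 2" "of_real R * w = z"
    using z R by (auto simp: w_def norm_divide field_simps)
  ultimately have "norm (h w) \<le> norm w"
    by (intro Schwarz_Lemma(1)) auto
  hence "norm (h w) \<le> 1 / 2" using w by simp
  hence "norm (L z) \<le> 1 / 2 * norm (2 * of_real A - L z)"
    using ne[of w] w by (simp add: h_def norm_divide divide_simps)
  also have "norm (2 * of_real A - L z) \<le> 2 * A + norm (L z)"
    using norm_triangle_ineq4[of "2 * of_real A" "L z"] A by simp
  finally show ?thesis by simp
qed

text \<open>One point is split off at a time. \<open>zor_poly\<close> is only controlled near a, so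
  it is glued to the quotient g(w) / (w - a)^n on the complement of a. The exponent may be read off
  from f instead of g because the factors already removed do not vanish at a. The point
  \<open>w0\<close> excludes f = 0; points of S need not be zeros.\<close>

lemma holomorphic_factor_out_zeros:
  fixes f :: "complex \<Rightarrow> complex"
  assumes "finite S" and hol: "f holomorphic_on UNIV" and nz: "f w0 \<noteq> 0"
  shows "\<exists>g. g holomorphic_on UNIV \<and> (\<forall>z. f z = (\<Prod>a\<in>S. (z - a) ^ nat (zorder f a)) * g z)
           \<and> (\<forall>a\<in>S. g a \<noteq> 0)"
  using \<open>finite S\<close>
proof (induction S rule: finite_induct)
  case empty
  then show ?case using hol by auto
next
  case (insert a S)
  then obtain g where g: "g holomorphic_on UNIV"
      "\<And>z. f z = (\<Prod>a\<in>S. (z - a) ^ nat (zorder f a)) * g z" "\<And>a. a \<in> S \<Longrightarrow> g a \<noteq> 0"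
    by blast
  define P where "P z = (\<Prod>a\<in>S. (z - a) ^ nat (zorder f a))" for z
  have "g w0 \<noteq> 0" using g(2)[of w0] nz by auto
  hence ex: "\<exists>w\<in>UNIV. g w \<noteq> 0" by blast
  define n where "n = nat (zorder g a)"
  obtain r where r: "r > 0" "zor_poly g a holomorphic_on cball a r"
      "\<And>w. w \<in> cball a r \<Longrightarrow> g w = zor_poly g a w * (w - a) ^ n \<and> zor_poly g a w \<noteq> 0"
    using zorder_exist_zero[OF g(1) open_UNIV connected_UNIV UNIV_I ex, of a]
    unfolding n_def by blast
  define h0 where "h0 = zor_poly g a"
  define h where "h w = (if w = a then h0 a else g w / (w - a) ^ n)" for w
  have h_eq: "h w = h0 w" if "w \<in> ball a r" for w
    using r(3)[of w] that by (auto simp: h_def h0_def)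
  have "h holomorphic_on (ball a r \<union> (- {a}))"
  proof (rule holomorphic_on_Un)
    have "h0 holomorphic_on ball a r" using r(2) holomorphic_on_subset h0_def ball_subset_cball by blast
    thus "h holomorphic_on ball a r" using h_eq holomorphic_transform by metis
    have "(\<lambda>w. g w / (w - a) ^ n) holomorphic_on (- {a})"
      using holomorphic_on_subset[OF g(1)] by (intro holomorphic_intros) auto
    thus "h holomorphic_on (- {a})" by (rule holomorphic_transform) (auto simp: h_def)
  qed auto
  moreover have "ball a r \<union> (- {a}) = UNIV" using r(1) by auto
  ultimately have h_hol: "h holomorphic_on UNIV" by simp
  have g_h: "g w = (w - a) ^ n * h w" for w
    using r(3)[of a] r(1) by (auto simp: h_def h0_def)
  have Pa: "P a \<noteq> 0" using insert by (auto simp: P_def)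
  have "zorder f a = int n"
  proof (rule zorder_eqI[of UNIV _ "\<lambda>w. P w * h w"])
    show "(\<lambda>w. P w * h w) holomorphic_on UNIV" using h_hol unfolding P_def by (intro holomorphic_intros)
    show "P a * h a \<noteq> 0" using Pa r(3)[of a] r(1) by (auto simp: h_def h0_def)
    show "f w = P w * h w * (w - a) powi int n" for w
      using g(2)[of w] g_h[of w] by (simp add: P_def power_int_of_nat mult_ac)
  qed auto
  hence "\<forall>z. f z = (\<Prod>a\<in>insert a S. (z - a) ^ nat (zorder f a)) * h z"
    using g(2) g_h insert by (auto simp: mult_ac)
  moreover have "\<forall>b\<in>insert a S. h b \<noteq> 0"
  proof
    fix b assume "b \<in> insert a S"
    thus "h b \<noteq> 0" using g(3)[of b] g_h[of b] r(3)[of a] r(1) by (auto simp: h_def h0_def)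
  qed
  ultimately show ?case using h_hol by blast
qed

lemma zorder_even:
  fixes f :: "complex \<Rightarrow> complex"
  assumes hol: "f holomorphic_on UNIV" and nz: "f w0 \<noteq> 0" and ev: "\<And>z. f (- z) = f z"
  shows "zorder f (- a) = zorder f a"
proof -
  define n where "n = nat (zorder f a)"
  obtain g where g: "g holomorphic_on UNIV" "\<And>z. f z = (z - a) ^ n * g z" "g a \<noteq> 0"
    using holomorphic_factor_out_zeros[of "{a}", OF _ hol nz] by (auto simp: n_def)
  have "zorder f a = int n"
    by (rule zorder_eqI[of UNIV _ g]) (use g in \<open>auto simp: power_int_of_nat\<close>)
  moreover have "zorder f (- a) = int n"
  proof (rule zorder_eqI[of UNIV _ "\<lambda>w. (-1) ^ n * g (- w)"])
    have "(g \<circ> uminus) holomorphic_on UNIV"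
      by (rule holomorphic_on_compose) (use g in \<open>auto intro: holomorphic_on_subset holomorphic_intros\<close>)
    thus "(\<lambda>w. (-1) ^ n * g (- w)) holomorphic_on UNIV"
      by (intro holomorphic_intros) (simp add: o_def)
    show "f w = (-1) ^ n * g (- w) * (w - - a) powi int n" for w
    proof -
      have "f w = (- w - a) ^ n * g (- w)" using g(2)[of "-w"] ev[of w] by simp
      also have "- w - a = (-1) * (w - - a)" by simp
      finally show ?thesis by (simp only: power_mult_distrib power_int_of_nat mult_ac)
    qed
  qed (use g in auto)
  ultimately show ?thesis by simp
qed

section \<open>Zero counting and the partial fractions of f'/f\<close>

locale even_entire =
  fixes f :: "complex \<Rightarrow> complex" and C :: real
  assumes holo: "f holomorphic_on UNIV" and f0: "f 0 \<noteq> 0" and ev: "\<And>z. f (- z) = f z"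
    and C: "C > 0"
    and growth: "\<And>R z. R \<ge> 1 \<Longrightarrow> norm z \<le> R \<Longrightarrow> norm (f z) \<le> exp (C * R powr (5/4))"
begin

definition zeros_upto :: "real \<Rightarrow> complex set" where
  "zeros_upto R = {z. f z = 0 \<and> norm z \<le> R}"

definition mult :: "complex \<Rightarrow> nat" where
  "mult a = nat (zorder f a)"

lemma finite_zeros_upto: "finite (zeros_upto R)"
proof -
  have eq: "zeros_upto R = {z \<in> cball 0 R. f z = 0}" by (auto simp: zeros_upto_def)
  show ?thesis
  proof (cases "f constant_on UNIV")
    case True
    then obtain c where "\<And>z. f z = c" by (auto simp: constant_on_def)
    hence "f z \<noteq> 0" for z using f0 by metis
    thus ?thesis by (simp add: zeros_upto_def)
  next
    case False
    show ?thesis unfolding eq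
      by (rule holomorphic_compact_finite_zeros[OF holo]) (use False in auto)
  qed
qed

lemma zeros_upto_uminus: "uminus ` zeros_upto R = zeros_upto R"
proof
  show "uminus ` zeros_upto R \<subseteq> zeros_upto R" using ev by (auto simp: zeros_upto_def)
  show "zeros_upto R \<subseteq> uminus ` zeros_upto R"
  proof
    fix z assume "z \<in> zeros_upto R"
    hence "- z \<in> zeros_upto R" using ev by (auto simp: zeros_upto_def)
    thus "z \<in> uminus ` zeros_upto R" by (metis image_eqI minus_minus)
  qed
qed

lemma mult_uminus [simp]: "mult (- a) = mult a"
  unfolding mult_def using zorder_even[OF holo f0 ev] by simp

lemma zeros_upto_nz: "a \<in> zeros_upto R \<Longrightarrow> a \<noteq> 0"
  using f0 by (auto simp: zeros_upto_def)

lemma sum_zeros_odd: "(\<Sum>a\<in>zeros_upto R. of_nat (mult a) / a) = 0"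
proof -
  have "(\<Sum>a\<in>zeros_upto R. of_nat (mult a) / a) = (\<Sum>a\<in>uminus ` zeros_upto R. of_nat (mult a) / a)"
    by (simp add: zeros_upto_uminus)
  also have "\<dots> = (\<Sum>a\<in>zeros_upto R. - (of_nat (mult a) / a))"
    by (subst sum.reindex) (auto simp: inj_on_def)
  finally show ?thesis by (simp add: sum_negf)
qed

text \<open>On the circle |z| = 4R every factor 1 - z/a with |a| <= R has absolute value at least 4
  - 1 = 3, so g is smaller than f there by 3 to the number of zeros; the maximum principle carries
  this inside. Writing the factors as 1 - z/a keeps g 0 = f 0, so that the bound can be evaluated at
  0.\<close>

lemma obtain_factor:
  assumes R: "R \<ge> 1"
  obtains g where "g holomorphic_on UNIV" "g 0 = f 0"
    "\<And>z. f z = (\<Prod>a\<in>zeros_upto R. (1 - z / a) ^ mult a) * g z"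
    "\<And>z. norm z \<le> R \<Longrightarrow> g z \<noteq> 0"
    "\<And>z. norm z \<le> 4 * R \<Longrightarrow> norm (g z) * 3 ^ (\<Sum>a\<in>zeros_upto R. mult a) \<le> exp (C * (4 * R) powr (5/4))"
proof -
  let ?Z = "zeros_upto R"
  obtain g0 where g0: "g0 holomorphic_on UNIV" "\<And>z. f z = (\<Prod>a\<in>?Z. (z - a) ^ mult a) * g0 z"
      "\<And>a. a \<in> ?Z \<Longrightarrow> g0 a \<noteq> 0"
    using holomorphic_factor_out_zeros[OF finite_zeros_upto holo f0] unfolding mult_def by blast
  define c where "c = (\<Prod>a\<in>?Z. (- a) ^ mult a)"
  have c: "c \<noteq> 0" using zeros_upto_nz finite_zeros_upto by (auto simp: c_def)
  define g where "g z = c * g0 z" for z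
  define P where "P z = (\<Prod>a\<in>?Z. (1 - z / a) ^ mult a)" for z
  have P: "(\<Prod>a\<in>?Z. (z - a) ^ mult a) = c * P z" for z
    unfolding c_def P_def prod.distrib[symmetric]
  proof (rule prod.cong)
    fix a assume "a \<in> ?Z"
    hence "z - a = - a * (1 - z / a)" using zeros_upto_nz by (auto simp: field_simps)
    thus "(z - a) ^ mult a = (- a) ^ mult a * (1 - z / a) ^ mult a"
      by (metis power_mult_distrib)
  qed auto
  have fg: "f z = P z * g z" for z
    using g0(2)[of z] P[of z] by (simp add: g_def)
  have g_hol: "g holomorphic_on UNIV" unfolding g_def using g0 by (intro holomorphic_intros)
  have "g 0 = f 0" using fg[of 0] by (simp add: P_def)
  have g_nz: "g z \<noteq> 0" if "norm z \<le> R" for z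
  proof (cases "z \<in> ?Z")
    case True thus ?thesis using g0(3) c by (simp add: g_def)
  next
    case False
    hence "f z \<noteq> 0" using that by (auto simp: zeros_upto_def)
    thus ?thesis using fg[of z] by auto
  qed
  have bound: "norm (g z) * 3 ^ (\<Sum>a\<in>?Z. mult a) \<le> exp (C * (4 * R) powr (5/4))" if "norm z \<le> 4 * R" for z
  proof -
    have "norm (g z) \<le> exp (C * (4 * R) powr (5/4)) / 3 ^ (\<Sum>a\<in>?Z. mult a)"
    proof (rule maximum_modulus_frontier[of g "cball 0 (4 * R)"])
      fix w :: complex assume "w \<in> frontier (cball 0 (4 * R))"
      hence w: "norm w = 4 * R" using R by simp
      have "3 ^ (\<Sum>a\<in>?Z. mult a) = (\<Prod>a\<in>?Z. 3 ^ mult a :: real)" by (simp add: power_sum)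
      also have "\<dots> \<le> (\<Prod>a\<in>?Z. norm ((1 - w / a) ^ mult a))"
      proof (rule prod_mono, safe)
        fix a assume a: "a \<in> ?Z"
        have "norm (w / a) \<ge> 4"
          using a w R zeros_upto_nz[OF a] by (auto simp: zeros_upto_def norm_divide field_simps)
        hence "norm (1 - w / a) \<ge> 3"
          using norm_triangle_ineq2[of "w / a" 1] by (simp add: norm_minus_commute)
        thus "3 ^ mult a \<le> norm ((1 - w / a) ^ mult a)" by (simp add: norm_power power_mono)
      qed auto
      also have "\<dots> = norm (P w)" by (simp add: P_def prod_norm)
      finally have "norm (g w) * 3 ^ (\<Sum>a\<in>?Z. mult a) \<le> norm (g w) * norm (P w)"
        by (intro mult_left_mono) auto
      also have "\<dots> = norm (f w)" by (simp add: fg norm_mult)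
      also have "\<dots> \<le> exp (C * (4 * R) powr (5/4))" using growth[of "4 * R" w] R w by simp
      finally show "norm (g w) \<le> exp (C * (4 * R) powr (5/4)) / 3 ^ (\<Sum>a\<in>?Z. mult a)"
        by (simp add: field_simps)
    qed (use g_hol that in \<open>auto intro: holomorphic_on_subset holomorphic_on_imp_continuous_on\<close>)
    thus ?thesis by (simp add: field_simps)
  qed
  show ?thesis
    by (rule that[OF g_hol \<open>g 0 = f 0\<close> _ g_nz bound]) (use fg P_def in auto)
qed

text \<open>A substitute for Jensen's formula: the last bound of \<open>obtain_factor\<close> at z =
  0 reads |f 0| 3^n <= exp(C (4R)^(5/4)), and logarithms are taken.\<close>

lemma zero_count_bound:
  obtains K where "K > 0" "\<And>R. R \<ge> 1 \<Longrightarrow> real (\<Sum>a\<in>zeros_upto R. mult a) \<le> K * R powr (5/4)"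
proof
  define K where "K = C * 4 powr (5/4) + \<bar>ln (norm (f 0))\<bar>"
  show "K > 0" using C by (auto simp: K_def intro!: add_pos_nonneg)
  fix R :: real assume R: "R \<ge> 1"
  define n where "n = (\<Sum>a\<in>zeros_upto R. mult a)"
  obtain g where "g holomorphic_on UNIV" and g0: "g 0 = f 0"
    and "\<And>z. f z = (\<Prod>a\<in>zeros_upto R. (1 - z / a) ^ mult a) * g z"
    and "\<And>z. norm z \<le> R \<Longrightarrow> g z \<noteq> 0"
    and "\<And>z. norm z \<le> 4 * R \<Longrightarrow> norm (g z) * 3 ^ (\<Sum>a\<in>zeros_upto R. mult a) \<le> exp (C * (4 * R) powr (5/4))"
    by (rule obtain_factor[OF R]) blast
  hence g: "g 0 = f 0" "\<And>z. norm z \<le> 4 * R \<Longrightarrow> norm (g z) * 3 ^ n \<le> exp (C * (4 * R) powr (5/4))"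
    by (auto simp: n_def)
  have "norm (f 0) * 3 ^ n \<le> exp (C * (4 * R) powr (5/4))" using g(2)[of 0] g(1) R by simp
  hence "ln (norm (f 0) * 3 ^ n) \<le> C * (4 * R) powr (5/4)"
    using f0 by (subst ln_exp[symmetric]) (simp add: del: ln_exp)
  also have "ln (norm (f 0) * 3 ^ n) = ln (norm (f 0)) + n * ln 3"
    using f0 by (simp add: ln_mult ln_realpow)
  finally have *: "n * ln 3 \<le> C * 4 powr (5/4) * R powr (5/4) + \<bar>ln (norm (f 0))\<bar> * 1"
    using R by (simp add: powr_mult algebra_simps)
  also have "\<dots> \<le> K * R powr (5/4)"
    unfolding K_def distrib_right using R C by (intro add_mono mult_left_mono ge_one_powr_ge_zero) auto
  finally have "n * ln 3 \<le> K * R powr (5/4)" .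
  \<comment> \<open>\<open>exp_le\<close> states e <= 3, hence ln 3 >= 1.\<close>
  moreover have "real n * 1 \<le> real n * ln 3"
    using exp_le by (intro mult_left_mono) (auto simp: ln_ge_iff)
  ultimately show "real (\<Sum>a\<in>zeros_upto R. mult a) \<le> K * R powr (5/4)" by (simp add: n_def)
qed

text \<open>Dyadic shells: the zeros with 2^N < |a| <= 2^(N+1) number at most K 2^((N+1) 5/4) and
  each weighs at most 2^(-7N/4), so a shell contributes D q^N with q = 2^(5/4 - 7/4) = 2^(-1/2) <
  1.\<close>

lemma summable_zeros: "(\<lambda>a. mult a * (1 + norm a) powr (-7/4)) summable_on {a. f a = 0}"
proof -
  obtain K where K: "K > 0" "\<And>R. R \<ge> 1 \<Longrightarrow> real (\<Sum>a\<in>zeros_upto R. mult a) \<le> K * R powr (5/4)"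
    using zero_count_bound by blast
  define w where "w a = mult a * (1 + norm a) powr (-7/4)" for a :: complex
  have w_nonneg: "w a \<ge> 0" for a by (simp add: w_def)
  define q :: real where "q = 2 powr (-1/2)"
  have q: "0 < q" "q < 1" by (auto simp: q_def powr_less_one)
  define D where "D = K * 2 powr (5/4)"
  have mono: "zeros_upto R \<subseteq> zeros_upto R'" if "R \<le> R'" for R R'
    using that by (auto simp: zeros_upto_def)
  have step: "sum w (zeros_upto (2 ^ N)) \<le> K + D * (\<Sum>k<N. q ^ k)" for N
  proof (induction N)
    case 0
    have "sum w (zeros_upto 1) \<le> (\<Sum>a\<in>zeros_upto 1. real (mult a) * 1)"
      unfolding w_def using powr_mono2'[of "7/4" 1]
      by (intro sum_mono mult_left_mono) (auto simp: powr_mono2'[of _ 1, simplified])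
    also have "\<dots> \<le> K" using K(2)[of 1] by simp
    finally show ?case by simp
  next
    case (Suc N)
    let ?A = "zeros_upto (2 ^ Suc N) - zeros_upto (2 ^ N)"
    have "sum w (zeros_upto (2 ^ Suc N)) = sum w (zeros_upto (2 ^ N)) + sum w ?A"
      by (subst sum.subset_diff[OF mono[of "2 ^ N" "2 ^ Suc N"] finite_zeros_upto]) auto
    moreover have "sum w ?A \<le> (\<Sum>a\<in>?A. real (mult a) * (2 ^ N) powr (-7/4))"
      unfolding w_def
    proof (intro sum_mono mult_left_mono)
      fix a assume "a \<in> ?A"
      hence "2 ^ N \<le> 1 + norm a" by (auto simp: zeros_upto_def)
      thus "(1 + norm a) powr (-7/4) \<le> (2 ^ N) powr (-7/4)" by (intro powr_mono2') auto
    qed auto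
    moreover have "\<dots> \<le> (\<Sum>a\<in>zeros_upto (2 ^ Suc N). real (mult a)) * (2 ^ N) powr (-7/4)"
      unfolding sum_distrib_right[symmetric]
      by (intro mult_right_mono sum_mono2 finite_zeros_upto) auto
    moreover have "\<dots> \<le> (K * (2 ^ Suc N) powr (5/4)) * (2 ^ N) powr (-7/4)"
      using K(2)[of "2 ^ Suc N"] by (intro mult_right_mono) (simp_all del: power_Suc)
    moreover have "(K * (2 ^ Suc N) powr (5/4)) * (2 ^ N) powr (-7/4) = D * q ^ N"
    proof -
      have "q ^ N = 2 powr (-1/2 * N)" by (simp add: q_def powr_realpow[symmetric] powr_powr)
      moreover have "(2 ^ Suc N :: real) powr (5/4) = 2 powr ((N + 1) * (5/4))"
        "(2 ^ N :: real) powr (-7/4) = 2 powr (N * (-7/4))"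
        by (simp_all add: powr_realpow[symmetric] powr_powr del: power_Suc)
      moreover have "2 powr ((N + 1) * (5/4)) * 2 powr (N * (-7/4)) = (2::real) powr (5/4) * 2 powr (-1/2 * N)"
      proof -
        have "real (N + 1) * (5/4) + real N * (-7/4) = 5/4 + -1/2 * real N" by (simp add: field_simps)
        thus ?thesis unfolding powr_add[symmetric] by simp
      qed
      ultimately show ?thesis by (simp add: D_def mult.assoc)
    qed
    ultimately show ?case using Suc.IH unfolding sum.lessThan_Suc distrib_left by linarith
  qed
  have geo: "(\<Sum>k<N. q ^ k) \<le> 1 / (1 - q)" for N
    using q by (simp add: sum_gp_strict divide_right_mono)
  show ?thesis unfolding w_def[symmetric]
  proof (rule nonneg_bdd_above_summable_on)
    show "bdd_above (sum w ` {F. F \<subseteq> {a. f a = 0} \<and> finite F})"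
    proof (rule bdd_aboveI2)
      fix F assume F: "F \<in> {F. F \<subseteq> {a. f a = 0} \<and> finite F}"
      define M where "M = Max (insert 0 (norm ` F))"
      have M: "norm a \<le> M" if "a \<in> F" for a using F that by (auto simp: M_def)
      obtain N where N: "M < 2 ^ N" using real_arch_pow[of 2 M] by auto
      have "sum w F \<le> sum w (zeros_upto (2 ^ N))"
        using F M N w_nonneg finite_zeros_upto
        by (intro sum_mono2) (force simp: zeros_upto_def)+
      also have "\<dots> \<le> K + D * (1 / (1 - q))"
        using step[of N] geo[of N] K(1) by (smt (verit) D_def mult_left_mono mult_pos_pos powr_gt_zero)
      finally show "sum w F \<le> K + D * (1 / (1 - q))" .
    qed
  qed (use w_nonneg in auto)
qed

text \<open>Let L = log(g / f 0) for the zero-free factor g. Borel-Caratheodory bounds L by 2A on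
  the disc of radius R/2, Cauchy's inequality on discs of radius R/4 bounds L'' by 2! 2A / (R/4)^2 =
  64 A / R^2, and integrating from L'(0) = 0 gives the claim for L'. Passing through the second
  derivative is what gains the factor 1/R^2.\<close>

lemma log_deriv_partial:
  assumes R: "R \<ge> 1" and z: "norm z \<le> R / 4" and fz: "f z \<noteq> 0"
  shows "norm (deriv f z / f z - (\<Sum>a\<in>zeros_upto R. mult a / (z - a)))
           \<le> 64 * (C * (4 * R) powr (5/4) + \<bar>ln (norm (f 0))\<bar> + 1) / R ^ 2 * norm z"
proof -
  let ?Z = "zeros_upto R"
  \<comment> \<open>The logarithm of |f 0| pays for the normalisation L 0 = 0; the extra 1 makes Re
    L < A strict.\<close>
  define A where "A = C * (4 * R) powr (5/4) + \<bar>ln (norm (f 0))\<bar> + 1"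
  define P where "P z = (\<Prod>a\<in>?Z. (1 - z / a) ^ mult a)" for z
  obtain g where g: "g holomorphic_on UNIV" "g 0 = f 0"
    "\<And>z. f z = P z * g z" "\<And>z. norm z \<le> R \<Longrightarrow> g z \<noteq> 0"
    and gb: "\<And>z. norm z \<le> 4 * R \<Longrightarrow> norm (g z) * 3 ^ (\<Sum>a\<in>zeros_upto R. mult a) \<le> exp (C * (4 * R) powr (5/4))"
    unfolding P_def by (rule obtain_factor[OF R]) blast
  have g_bound: "norm (g z) \<le> exp (C * (4 * R) powr (5/4))" if "norm z \<le> R" for z
  proof -
    have "norm (g z) * 1 \<le> norm (g z) * 3 ^ (\<Sum>a\<in>zeros_upto R. mult a)"
      by (intro mult_left_mono) auto
    thus ?thesis using gb[of z] that R by simp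
  qed
  obtain L0 where L0: "L0 holomorphic_on ball 0 R" "\<And>x. x \<in> ball 0 R \<Longrightarrow> exp (L0 x) = g x"
    by (rule holomorphic_logarithm_exists[of "ball 0 R" g 0])
       (use g R in \<open>auto intro: holomorphic_on_subset\<close>)
  define L where "L x = L0 x - L0 0" for x
  have L_hol: "L holomorphic_on ball 0 R" unfolding L_def by (intro holomorphic_intros L0)
  have expL: "exp (L x) = g x / f 0" if "norm x < R" for x
    using L0(2)[of x] L0(2)[of 0] that R g(2) by (simp add: L_def exp_diff)
  have dlogf: "deriv f x / f x = (\<Sum>a\<in>?Z. mult a / (x - a)) + deriv L x" if x: "norm x < R" "f x \<noteq> 0" for x
  proof -
    have xa: "x \<noteq> a" if "a \<in> ?Z" for a using x that by (auto simp: zeros_upto_def)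
    have DL: "(L has_field_derivative deriv L x) (at x)"
      using L_hol x by (intro holomorphic_derivI) auto
    have DexpL: "((\<lambda>x. exp (L x) * f 0) has_field_derivative g x * deriv L x) (at x)"
      using expL[OF x(1)] f0 by (auto intro!: derivative_eq_intros DL)
    have Dg: "(g has_field_derivative g x * deriv L x) (at x)"
    proof (rule has_field_derivative_transform_within_open[OF DexpL, of "ball 0 R"])
      fix y :: complex assume "y \<in> ball 0 R"
      thus "exp (L y) * f 0 = g y" using expL[of y] f0 by simp
    qed (use x in auto)
    have DP: "(P has_field_derivative P x * (\<Sum>a\<in>?Z. mult a / (x - a))) (at x)"
    proof -
      have one: "((\<lambda>x. (1 - x / a) ^ mult a) has_field_derivative
              (1 - x / a) ^ mult a * (mult a / (x - a))) (at x)" if a: "a \<in> ?Z" for a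
      proof -
        have nz: "a \<noteq> 0" "x \<noteq> a" using xa[OF a] zeros_upto_nz[OF a] by auto
        hence nz1: "1 - x / a \<noteq> 0" by (simp add: field_simps)
        have "((\<lambda>x. (1 - x / a) ^ mult a) has_field_derivative
                mult a * (1 - x / a) ^ (mult a - 1) * (- 1 / a)) (at x)"
          by (auto intro!: derivative_eq_intros simp: nz)
        also have "mult a * (1 - x / a) ^ (mult a - 1) * (- 1 / a) = (1 - x / a) ^ mult a * (mult a / (x - a))"
        proof (cases "mult a")
          case (Suc k)
          have "- 1 / a = (1 - x / a) / (x - a)" using nz by (simp add: field_simps)
          thus ?thesis using Suc by simp
        qed auto
        finally show ?thesis .
      qed
      have fin: "finite ?Z" by (rule finite_zeros_upto)
      have "((\<lambda>x. \<Prod>a\<in>S. (1 - x / a) ^ mult a) has_field_derivative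
             (\<Prod>a\<in>S. (1 - x / a) ^ mult a) * (\<Sum>a\<in>S. mult a / (x - a))) (at x)" if "S \<subseteq> ?Z" for S
        using finite_subset[OF that fin] that
      proof (induction S rule: finite_induct)
        case (insert b S)
        have "((\<lambda>x. (1 - x / b) ^ mult b * (\<Prod>a\<in>S. (1 - x / a) ^ mult a)) has_field_derivative
           (1 - x / b) ^ mult b * ((\<Prod>a\<in>S. (1 - x / a) ^ mult a) * (\<Sum>a\<in>S. mult a / (x - a)))
           + (1 - x / b) ^ mult b * (mult b / (x - b)) * (\<Prod>a\<in>S. (1 - x / a) ^ mult a)) (at x)"
          by (rule DERIV_mult'[OF one insert.IH]) (use insert in auto)
        also have "(1 - x / b) ^ mult b * ((\<Prod>a\<in>S. (1 - x / a) ^ mult a) * (\<Sum>a\<in>S. mult a / (x - a)))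
           + (1 - x / b) ^ mult b * (mult b / (x - b)) * (\<Prod>a\<in>S. (1 - x / a) ^ mult a)
           = (1 - x / b) ^ mult b * (\<Prod>a\<in>S. (1 - x / a) ^ mult a) * (mult b / (x - b) + (\<Sum>a\<in>S. mult a / (x - a)))"
          by (simp only: distrib_left mult_ac add_ac)
        finally show ?case using insert.hyps by simp
      qed auto
      from this[OF order_refl] show ?thesis by (simp add: P_def[abs_def])
    qed
    have "((\<lambda>x. P x * g x) has_field_derivative
        P x * (g x * deriv L x) + P x * (\<Sum>a\<in>?Z. mult a / (x - a)) * g x) (at x)"
      by (rule DERIV_mult'[OF DP Dg])
    hence "deriv f x = P x * (g x * deriv L x) + P x * (\<Sum>a\<in>?Z. mult a / (x - a)) * g x"
      unfolding g(3)[THEN ext, symmetric] by (rule DERIV_imp_deriv)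
    also have "\<dots> = f x * ((\<Sum>a\<in>?Z. mult a / (x - a)) + deriv L x)"
      by (simp add: g(3) algebra_simps)
    finally show ?thesis using x(2) by simp
  qed
  \<comment> \<open>Evenness enters twice: f'(0) = 0, and the sum of 1/a over the symmetric disc
    cancels in pairs. Hence L'(0) = 0, which rules out an additive constant in the expansion of
    f'/f.\<close>
  have "deriv f 0 = 0"
  proof -
    have Df: "(f has_field_derivative deriv f 0) (at 0)"
      using holo by (intro holomorphic_derivI) auto
    have "((\<lambda>z. f (- z)) has_field_derivative deriv f 0 * (- 1)) (at 0)"
      by (rule DERIV_chain2[of f _ uminus]) (auto intro!: derivative_eq_intros simp: Df)
    hence "(f has_field_derivative - deriv f 0) (at 0)" using ev by simp
    from DERIV_unique[OF Df this] show ?thesis by simp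
  qed
  moreover have "(\<Sum>a\<in>?Z. mult a / (0 - a)) = 0"
    using sum_zeros_odd[of R] by (simp add: sum_negf)
  ultimately have L'0: "deriv L 0 = 0" using dlogf[of 0] R f0 by simp
  have "norm (L x) \<le> 2 * A" if "norm x \<le> R / 2" for x
  proof (rule Borel_Caratheodory_half[OF L_hol])
    fix x :: complex assume x: "norm x < R"
    have "exp (Re (L x)) = norm (g x) / norm (f 0)"
      using expL[OF x] by (metis norm_exp_eq_Re norm_divide)
    also have "\<dots> \<le> exp (C * (4 * R) powr (5/4)) / exp (ln (norm (f 0)))"
      using g_bound[of x] x f0 by (simp add: divide_right_mono)
    also have "\<dots> < exp A" unfolding exp_diff[symmetric] A_def by simp
    finally show "Re (L x) < A" by simp
  qed (use R that in \<open>auto simp: L_def\<close>)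
  note L_bound = this
  have L''_bound: "norm (deriv (deriv L) x) \<le> 64 * A / R ^ 2" if "norm x \<le> R / 4" for x
  proof -
    have sub: "cball x (R / 4) \<subseteq> cball 0 (R / 2)"
    proof
      fix y assume "y \<in> cball x (R / 4)"
      hence "norm (y - x) \<le> R / 4" by (simp add: dist_norm norm_minus_commute)
      thus "y \<in> cball 0 (R / 2)" using norm_triangle_ineq[of "y - x" x] that by simp
    qed
    have "norm ((deriv ^^ 2) L x) \<le> fact 2 * (2 * A) / (R / 4) ^ 2"
    proof (rule Cauchy_inequality)
      have sub': "cball x (R / 4) \<subseteq> ball 0 R" using sub R by auto
      show "L holomorphic_on ball x (R / 4)" "continuous_on (cball x (R / 4)) L"
        using sub' L_hol by (auto intro!: holomorphic_on_subset[OF L_hol] holomorphic_on_imp_continuous_on)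
      show "norm (L y) \<le> 2 * A" if "norm (x - y) = R / 4" for y
        using sub that by (intro L_bound) (auto simp: dist_norm subset_iff)
    qed (use R in auto)
    thus ?thesis by (simp add: eval_nat_numeral field_simps)
  qed
  have "norm (deriv L z - deriv L 0) \<le> 64 * A / R ^ 2 * norm (z - 0)"
  proof (rule field_differentiable_bound[of "cball 0 (R / 4)"])
    fix x :: complex assume x: "x \<in> cball 0 (R / 4)"
    have "deriv L holomorphic_on ball 0 R" by (intro holomorphic_deriv L_hol) auto
    hence "(deriv L has_field_derivative deriv (deriv L) x) (at x)"
      using x R by (intro holomorphic_derivI[of _ "ball 0 R"]) auto
    thus "(deriv L has_field_derivative deriv (deriv L) x) (at x within cball 0 (R / 4))"
      by (rule has_field_derivative_at_within)
  qed (use z R L''_bound in auto)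
  moreover have "deriv f z / f z - (\<Sum>a\<in>?Z. mult a / (z - a)) = deriv L z"
    using dlogf[of z] z R fz by simp
  ultimately show ?thesis using L'0 by (simp add: A_def)
qed

text \<open>The error is of size R^(5/4) / R^2 and tends to 0. The limit along growing discs is
  essential: the zero count does not make the sum of 1/|a| finite.\<close>

theorem log_deriv_limit:
  assumes fz: "f z \<noteq> 0"
  shows "(\<lambda>n. \<Sum>a\<in>zeros_upto (real n). mult a / (z - a)) \<longlonglongrightarrow> deriv f z / f z"
proof (rule Lim_transform2[OF tendsto_const], rule tendsto_norm_zero_cancel, rule tendsto_sandwich[OF _ _ tendsto_const])
  define B where "B = \<bar>ln (norm (f 0))\<bar> + 1"
  let ?u = "\<lambda>n. 64 * (C * (4 * real n) powr (5/4) + B) / real n ^ 2 * norm z"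
  show "\<forall>\<^sub>F n in sequentially. norm (deriv f z / f z - (\<Sum>a\<in>zeros_upto (real n). mult a / (z - a))) \<le> ?u n"
  proof -
    have "\<forall>\<^sub>F n in sequentially. real n \<ge> max 1 (4 * norm z)"
      by (rule eventually_compose_filterlim[OF eventually_ge_at_top filterlim_real_sequentially])
    thus ?thesis
    proof eventually_elim
      case (elim n)
      thus ?case using log_deriv_partial[of "real n" z] fz by (simp add: B_def add.assoc)
    qed
  qed
  show "?u \<longlonglongrightarrow> 0" by real_asymp
qed (auto intro!: always_eventually)

end

section \<open>The theta function\<close>

lemma entire_divide_root:
  fixes f :: "complex \<Rightarrow> complex"
  assumes "f holomorphic_on UNIV" "f a = 0"
  obtains k where "k holomorphic_on UNIV" "\<And>z. f z = (z - a) * k z"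
proof -
  have "(\<lambda>z. if z = a then deriv f a else f z / (z - a)) holomorphic_on UNIV"
    using pole_lemma_open[OF assms(1) open_UNIV, of a] unfolding assms(2) diff_zero .
  thus ?thesis using assms(2) that[of "\<lambda>z. if z = a then deriv f a else f z / (z - a)"] by simp
qed

text \<open>One integration by parts against exp(-2 pi i k y), whose primitive carries a factor 1/k;
  the boundary terms and the integral of q' are bounded independently of k.\<close>

lemma Riemann_Lebesgue_holomorphic:
  fixes q q' :: "complex \<Rightarrow> complex"
  assumes q: "\<And>y. y \<in> {0..1} \<Longrightarrow> (q has_field_derivative q' (of_real y)) (at (of_real y))"
    and cont: "continuous_on {0..1::real} (\<lambda>y. q' (of_real y))"
  obtains B where "\<And>k::int. k \<noteq> 0 \<Longrightarrow>
    norm (integral {0..1} (\<lambda>y. q (of_real y) * exp (- 2 * pi * \<i> * k * of_real y))) \<le> B / \<bar>k\<bar>"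
proof -
  obtain B0 where B0: "\<And>y. y \<in> {0..1} \<Longrightarrow> norm (q' (of_real y)) \<le> B0"
    using compact_imp_bounded[OF compact_continuous_image[OF cont]] by (force simp: bounded_iff)
  define B where "B = norm (q 0) + norm (q 1) + B0"
  have contq: "continuous_on {0..1::real} (\<lambda>y. q (of_real y))"
  proof (intro continuous_at_imp_continuous_on ballI)
    fix y :: real assume "y \<in> {0..1}"
    hence "isCont q (of_real y)" by (rule DERIV_isCont[OF q])
    thus "isCont (\<lambda>y. q (of_real y)) y" by (rule isCont_o2[rotated]) (intro continuous_intros)
  qed
  show ?thesis
  proof (rule that[of B])
    fix k :: int assume k: "k \<noteq> 0"
    define c where "c = - 2 * pi * \<i> * k"
    have c: "c \<noteq> 0" "norm c \<ge> \<bar>k\<bar>"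
    proof -
      show "c \<noteq> 0" using k by (simp add: c_def)
      have "1 * \<bar>real_of_int k\<bar> \<le> 2 * pi * \<bar>real_of_int k\<bar>"
        using pi_ge_two by (intro mult_right_mono) auto
      thus "norm c \<ge> \<bar>k\<bar>" by (simp add: c_def norm_mult)
    qed
    have norm_exp: "norm (exp (c * of_real y)) = 1" for y :: real by (simp add: c_def)
    let ?f = "\<lambda>y. q (of_real y) * exp (c * of_real y)"
    let ?g = "\<lambda>y. q' (of_real y) * exp (c * of_real y) / c"
    have "((\<lambda>y. ?g y + ?f y) has_integral
       (q (of_real 1) * exp (c * of_real 1) / c - q (of_real 0) * exp (c * of_real 0) / c)) {0..1}"
    proof (rule fundamental_theorem_of_calculus)
      fix y :: real assume y: "y \<in> {0..1}"
      have "((\<lambda>z. q z * exp (c * z) / c) has_field_derivative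
              q' (of_real y) * exp (c * of_real y) / c + q (of_real y) * exp (c * of_real y)) (at (of_real y))"
        using c by (auto intro!: derivative_eq_intros q y simp: field_simps)
      hence "((\<lambda>z. q z * exp (c * z) / c) \<circ> of_real has_vector_derivative
              q' (of_real y) * exp (c * of_real y) / c + q (of_real y) * exp (c * of_real y)) (at y)"
        by (intro has_vector_derivative_real_field[unfolded o_def[symmetric]])
      thus "((\<lambda>y. q (of_real y) * exp (c * of_real y) / c) has_vector_derivative ?g y + ?f y) (at y within {0..1})"
        unfolding o_def by (rule has_vector_derivative_at_within)
    qed auto
    moreover have gint: "?g integrable_on {0..1}" and fint: "?f integrable_on {0..1}"
      using c by (auto intro!: integrable_continuous_interval continuous_intros cont contq)
    ultimately have "integral {0..1} ?g + integral {0..1} ?f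
        = q (of_real 1) * exp (c * of_real 1) / c - q (of_real 0) * exp (c * of_real 0) / c"
      using has_integral_unique[OF has_integral_add[OF integrable_integral[OF gint] integrable_integral[OF fint]]]
      by blast
    hence "integral {0..1} ?f = q 1 * exp c / c - q 0 / c - integral {0..1} ?g"
      by (simp add: algebra_simps)
    also have "norm \<dots> \<le> norm (q 1 * exp c / c) + norm (q 0 / c) + norm (integral {0..1} ?g)"
      by (intro order_trans[OF norm_triangle_ineq4] add_mono order_refl)
    also have "norm (integral {0..1} ?g) \<le> B0 / norm c * (1 - 0)"
    proof (rule integral_bound)
      show "continuous_on {0..1} ?g" using c by (intro continuous_intros cont) auto
      show "norm (?g y) \<le> B0 / norm c" if "y \<in> {0..1}" for y
        unfolding norm_divide norm_mult norm_exp using B0[OF that] by (simp add: divide_right_mono)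
    qed simp
    also have "norm (q 1 * exp c / c) + norm (q 0 / c) + B0 / norm c * (1 - 0) = B / norm c"
      using norm_exp[of 1] by (simp add: B_def norm_mult norm_divide add_divide_distrib)
    also have "\<dots> \<le> B / \<bar>k\<bar>"
      using c k B0[of 0] by (intro divide_left_mono) (auto simp: B_def intro!: mult_pos_pos add_nonneg_nonneg order_trans[OF norm_ge_zero B0[of 0]])
    finally show "norm (integral {0..1} (\<lambda>y. q (of_real y) * exp (- 2 * pi * \<i> * k * of_real y))) \<le> B / \<bar>k\<bar>"
      by (simp add: c_def)
  qed
qed

text \<open>Chernoff's telescoping argument: dividing by exp(2 pi i z) - 1 turns the Fourier coefficients
  of h - h(0) into differences of those of the quotient.\<close>

lemma Fourier_series_at_0:
  fixes h :: "complex \<Rightarrow> complex"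
  assumes hol: "h holomorphic_on UNIV" and h01: "h 1 = h 0"
  defines "c \<equiv> \<lambda>k::int. integral {0..1} (\<lambda>y::real. h (of_real y) * exp (- 2 * pi * \<i> * k * of_real y))"
  shows "(\<lambda>N. c 0 + (\<Sum>k<N. c (int (Suc k)) + c (- int (Suc k)))) \<longlonglongrightarrow> h 0"
proof -
  define e where "e k y = exp (- 2 * pi * \<i> * of_int k * y)" for k :: int and y :: complex
  \<comment> \<open>Both h - h(0) and E(z) = exp(2 pi i z) - 1 vanish at 0 and at 1. Dividing both
    zeros out of each leaves a quotient k2 / l2 with no singularity on [0,1].\<close>
  obtain k1 where k1: "k1 holomorphic_on UNIV" "\<And>z. h z - h 0 = (z - 0) * k1 z"
    by (rule entire_divide_root[of "\<lambda>z. h z - h 0" 0]) (use hol in \<open>auto intro: holomorphic_intros\<close>)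
  obtain k2 where k2: "k2 holomorphic_on UNIV" "\<And>z. k1 z = (z - 1) * k2 z"
  proof (rule entire_divide_root[OF k1(1), of 1])
    show "k1 1 = 0" using k1(2)[of 1] h01 by simp
  qed blast
  define E where "E z = exp (2 * pi * \<i> * z) - 1" for z :: complex
  have E_hol: "E holomorphic_on UNIV" unfolding E_def by (intro holomorphic_intros)
  have E1: "E 1 = 0" by (simp add: E_def exp_eq_1)
  obtain l1 where l1: "l1 holomorphic_on UNIV" "\<And>z. E z = (z - 0) * l1 z"
    by (rule entire_divide_root[OF E_hol, of 0]) (auto simp: E_def)
  obtain l2 where l2: "l2 holomorphic_on UNIV" "\<And>z. l1 z = (z - 1) * l2 z"
  proof (rule entire_divide_root[OF l1(1), of 1])
    show "l1 1 = 0" using l1(2)[of 1] E1 by simp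
  qed blast
  have E_eq: "E z = z * (z - 1) * l2 z" for z using l1(2) l2(2) by simp
  have dE: "(E has_field_derivative 2 * pi * \<i> * exp (2 * pi * \<i> * z)) (at z)" for z
    unfolding E_def by (auto intro!: derivative_eq_intros)
  have dE': "(E has_field_derivative (2 * z - 1) * l2 z + z * (z - 1) * deriv l2 z) (at z)" for z
  proof -
    have "(l2 has_field_derivative deriv l2 z) (at z)" using l2 by (intro holomorphic_derivI) auto
    hence "((\<lambda>z. z * (z - 1) * l2 z) has_field_derivative (2 * z - 1) * l2 z + z * (z - 1) * deriv l2 z) (at z)"
      by (auto intro!: derivative_eq_intros simp: algebra_simps)
    thus ?thesis unfolding E_eq[THEN ext, symmetric] .
  qed
  have l2_nz: "l2 (of_real y) \<noteq> 0" if y: "y \<in> {0..1}" for y :: real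
  proof (cases "y = 0 \<or> y = 1")
    case True
    \<comment> \<open>At the endpoints the zero of E is simple: E' = 2 pi i there, while the product
      rule gives a multiple of l2.\<close>
    thus ?thesis using DERIV_unique[OF dE[of 0] dE'[of 0]] DERIV_unique[OF dE[of 1] dE'[of 1]]
      by auto
  next
    case False
    have "E (of_real y) \<noteq> 0"
    proof
      assume "E (of_real y) = 0"
      then obtain n :: int where "2 * pi * y = of_int (2 * n) * pi"
        by (auto simp: E_def exp_eq_1)
      hence "y = of_int n" by simp
      thus False using False y by auto
    qed
    thus ?thesis using E_eq[of "of_real y"] by auto
  qed
  define q where "q z = k2 z / l2 z" for z
  define q' where "q' z = (deriv k2 z * l2 z - k2 z * deriv l2 z) / (l2 z * l2 z)" for z
  have dq: "(q has_field_derivative q' (of_real y)) (at (of_real y))" if "y \<in> {0..1}" for y :: real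
  proof -
    have "(l2 has_field_derivative deriv l2 (of_real y)) (at (of_real y))"
         "(k2 has_field_derivative deriv k2 (of_real y)) (at (of_real y))"
      using l2 k2 by (auto intro!: holomorphic_derivI[of _ UNIV])
    thus ?thesis unfolding q_def q'_def using l2_nz[OF that] by (intro DERIV_divide)
  qed
  have cont_of_real: "continuous_on {0..1::real} (\<lambda>y. g (of_real y))" if "g holomorphic_on UNIV" for g :: "complex \<Rightarrow> complex"
    using that by (intro continuous_on_compose2[OF holomorphic_on_imp_continuous_on[OF that]] continuous_intros) auto
  have cont_q': "continuous_on {0..1::real} (\<lambda>y. q' (of_real y))"
    unfolding q'_def using l2_nz
    by (intro continuous_intros cont_of_real holomorphic_deriv l2 k2) auto
  have cont_q: "continuous_on {0..1::real} (\<lambda>y. q (of_real y))"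
    unfolding q_def using l2_nz by (intro continuous_intros cont_of_real l2 k2) auto
  define Q where "Q k = integral {0..1::real} (\<lambda>y. q (of_real y) * e k (of_real y))" for k
  obtain B where "\<And>k::int. k \<noteq> 0 \<Longrightarrow>
      norm (integral {0..1} (\<lambda>y. q (of_real y) * exp (- 2 * pi * \<i> * k * of_real y))) \<le> B / \<bar>k\<bar>"
    by (rule Riemann_Lebesgue_holomorphic[OF dq cont_q']) blast+
  hence B: "norm (Q k) \<le> B / \<bar>k\<bar>" if "k \<noteq> 0" for k
    using that by (simp add: Q_def e_def)
  have e_int: "integral {0..1::real} (\<lambda>y. e k (of_real y)) = (if k = 0 then 1 else 0)" for k
  proof (cases "k = 0")
    case False
    define b where "b = - 2 * pi * \<i> * of_int k"
    have b: "b \<noteq> 0" "exp b = 1" using False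
      by (auto simp: b_def exp_eq_1 intro!: exI[of _ "-k"])
    have "((\<lambda>y::real. e k (of_real y)) has_integral (exp (b * of_real 1) / b - exp (b * of_real 0) / b)) {0..1}"
    proof (rule fundamental_theorem_of_calculus)
      fix y :: real
      have "((\<lambda>z. exp (b * z) / b) has_field_derivative e k (of_real y)) (at (of_real y))"
        using b by (auto intro!: derivative_eq_intros simp: e_def b_def)
      from has_vector_derivative_real_field[OF this]
      show "((\<lambda>y. exp (b * of_real y) / b) has_vector_derivative e k (of_real y)) (at y within {0..1})"
        by (rule has_vector_derivative_at_within)
    qed auto
    thus ?thesis using b False by (simp add: integral_unique)
  qed (simp add: e_def)
  have tel: "c k = (if k = 0 then h 0 else 0) + (Q (k - 1) - Q k)" for k
  proof -
    have eq: "h z * e k z = h 0 * e k z + (q z * e (k - 1) z - q z * e k z)" if z: "z \<in> of_real ` {0..1}" for z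
    proof -
      have "h z = h 0 + q z * E z"
      proof -
        have "l2 z \<noteq> 0" using l2_nz z by auto
        hence "q z * E z = z * ((z - 1) * k2 z)" unfolding q_def E_eq by (simp add: field_simps)
        also have "\<dots> = h z - h 0" using k1(2)[of z] k2(2)[of z] by simp
        finally show ?thesis by simp
      qed
      hence "h z * e k z = h 0 * e k z + q z * (E z * e k z)" by (simp add: distrib_right)
      also have "E z * e k z = e (k - 1) z - e k z"
        by (simp add: E_def e_def algebra_simps flip: exp_add)
      finally show ?thesis by (simp only: right_diff_distrib)
    qed
    have "c k = integral {0..1} (\<lambda>y::real. h 0 * e k (of_real y) + (q (of_real y) * e (k - 1) (of_real y) - q (of_real y) * e k (of_real y)))"
      unfolding c_def using eq by (intro integral_cong) (auto simp: e_def)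
    also have "\<dots> = h 0 * integral {0..1} (\<lambda>y::real. e k (of_real y)) + (Q (k - 1) - Q k)"
    proof -
      have i1: "(\<lambda>y::real. q (of_real y) * e m (of_real y)) integrable_on {0..1}" for m
        unfolding e_def by (intro integrable_continuous_interval continuous_intros cont_q)
      have i2: "(\<lambda>y::real. h 0 * e k (of_real y)) integrable_on {0..1}"
        unfolding e_def by (intro integrable_continuous_interval continuous_intros)
      show ?thesis unfolding Q_def
        by (simp add: integral_add[OF i2 integrable_diff[OF i1 i1]] integral_diff[OF i1 i1])
    qed
    finally show ?thesis by (simp add: e_int)
  qed
  have sum_eq: "c 0 + (\<Sum>k<N. c (int (Suc k)) + c (- int (Suc k))) = h 0 + Q (- int N - 1) - Q (int N)" for N
  proof (induction N)
    case (Suc N)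
    have e: "- int (Suc N) = - int N - 1" by simp
    have "c (- int (Suc N)) = Q (- int (Suc N) - 1) - Q (- int N - 1)"
      unfolding e[symmetric] using tel[of "- int (Suc N)"] by (simp del: of_nat_Suc)
    moreover have "c (int (Suc N)) = Q (int N) - Q (int (Suc N))"
      using tel[of "int (Suc N)"] by simp
    ultimately have "(c 0 + (\<Sum>k<N. c (int (Suc k)) + c (- int (Suc k)))) + (c (int (Suc N)) + c (- int (Suc N)))
        = h 0 + Q (- int N - 1) - Q (int N)
          + (Q (int N) - Q (int (Suc N)) + (Q (- int (Suc N) - 1) - Q (- int N - 1)))"
      by (simp only: Suc.IH)
    also have "\<dots> = h 0 + Q (- int (Suc N) - 1) - Q (int (Suc N))" by (simp del: of_nat_Suc)
    finally show ?case by (simp only: sum.lessThan_Suc add.assoc)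
  qed (simp add: tel)
  have "(\<lambda>N. Q (- int N - 1)) \<longlonglongrightarrow> 0"
  proof (rule Lim_null_comparison)
    show "\<forall>\<^sub>F n in sequentially. norm (Q (- int n - 1)) \<le> B / (real n + 1)"
    proof (intro always_eventually allI)
      fix n
      have "\<bar>- int n - 1\<bar> = int n + 1" by simp
      thus "norm (Q (- int n - 1)) \<le> B / (real n + 1)" using B[of "- int n - 1"] by (simp add: add.commute)
    qed
  qed real_asymp
  moreover have "(\<lambda>N. Q (int N)) \<longlonglongrightarrow> 0"
  proof (rule Lim_null_comparison)
    show "\<forall>\<^sub>F n in sequentially. norm (Q (int n)) \<le> B / real n"
      using eventually_gt_at_top[of 0]
    proof eventually_elim
      case (elim n)
      thus ?case using B[of "int n"] by simp
    qed
  qed real_asymp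
  ultimately have "(\<lambda>N. h 0 + Q (- int N - 1) - Q (int N)) \<longlonglongrightarrow> h 0 + 0 - 0"
    by (intro tendsto_intros)
  thus ?thesis unfolding sum_eq by simp
qed

text \<open>Riemann's psi-function: 1 + 2 omega(x) is the Jacobi theta series, the sum of exp(-pi
  n^2 x) over all integers n.\<close>

definition omega :: "real \<Rightarrow> real" where
  "omega x = (\<Sum>n. exp (- pi * real (Suc n) ^ 2 * x))"

lemma omega_term_le:
  assumes "x > 0"
  shows "exp (- pi * real (Suc n) ^ 2 * x) \<le> exp (- pi * x) * exp (- pi * x) ^ n"
proof -
  have "real (Suc n) * 1 \<le> real (Suc n) * real (Suc n)" by (intro mult_left_mono) auto
  hence "- pi * x * real (Suc n) ^ 2 \<le> - pi * x * real (Suc n)"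
    using assms by (intro mult_left_mono_neg) (auto simp: power2_eq_square)
  thus ?thesis using assms by (simp add: algebra_simps flip: exp_of_nat_mult exp_add)
qed

lemma summable_omega: "x > 0 \<Longrightarrow> summable (\<lambda>n. exp (- pi * real (Suc n) ^ 2 * x))"
  by (rule summable_comparison_test'[OF summable_mult[OF summable_geometric[of "exp (- pi * x)"], of "exp (- pi * x)"], of 0])
     (use omega_term_le in auto)

text \<open>The substitution u = c y with c^2 = 2 pi x turns pi x y^2 into u^2/2, which reduces the
  claim to the characteristic function of the standard normal distribution.\<close>

lemma Gaussian_Fourier:
  fixes x t :: real
  assumes x: "x > 0"
  shows "integrable lborel (\<lambda>y. exp (- pi * of_real x * of_real y ^ 2) * exp (- 2 * pi * \<i> * of_real t * of_real y) :: complex)"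
    and "(LBINT y. exp (- pi * of_real x * of_real y ^ 2) * exp (- 2 * pi * \<i> * of_real t * of_real y) :: complex)
           = of_real (exp (- pi * t ^ 2 / x) / sqrt x)"
proof -
  define c where "c = sqrt (2 * pi * x)"
  have c: "c > 0" "c ^ 2 = 2 * pi * x" using x by (auto simp: c_def)
  define s where "s = - 2 * pi * t / c"
  let ?G = "\<lambda>y. exp (- pi * of_real x * of_real y ^ 2) * exp (- 2 * pi * \<i> * of_real t * of_real y) :: complex"
  let ?N = "\<lambda>u. std_normal_density u *\<^sub>R iexp (s * u)"
  have GN: "?G y = of_real (sqrt (2 * pi)) * ?N (0 + c * y)" for y
  proof -
    have "- ((c * y)\<^sup>2 / 2) = - (pi * x * y ^ 2)" using c by (simp add: power_mult_distrib)
    moreover have "s * (c * y) = - (2 * pi * t * y)" using c by (simp add: s_def)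
    ultimately show ?thesis
      by (simp add: std_normal_density_def scaleR_conv_of_real exp_of_real[symmetric] mult_ac flip: of_real_mult of_real_power)
  qed
  have N_int: "integrable lborel ?N"
  proof (rule Bochner_Integration.integrable_bound[of _ std_normal_density])
    show "integrable lborel std_normal_density" by simp
  qed (auto simp: norm_mult)
  have "(CLBINT u. ?N u) = char std_normal_distribution s"
    unfolding char_def by (subst integral_density) auto
  also have "\<dots> = of_real (exp (- (s ^ 2) / 2))" by (simp add: char_std_normal_distribution)
  also have "- (s ^ 2) / 2 = - pi * t ^ 2 / x"
    using c x by (simp add: s_def power_divide power_mult_distrib field_simps power2_eq_square)
  finally have N_val: "(CLBINT u. ?N u) = of_real (exp (- pi * t ^ 2 / x))" .
  show "integrable lborel ?G" unfolding GN
    using lborel_integrable_real_affine[OF N_int, of c 0] c by (intro integrable_mult_right) auto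
  have "(LBINT y. ?G y) = of_real (sqrt (2 * pi)) * (LBINT y. ?N (0 + c * y))"
    unfolding GN by (rule integral_mult_right_zero)
  also have "(LBINT y. ?N (0 + c * y)) = (LBINT u. ?N u) /\<^sub>R c"
    using lborel_integral_real_affine[of c ?N 0] c by (simp add: scaleR_conv_of_real)
  also have "of_real (sqrt (2 * pi)) * \<dots> = of_real (exp (- pi * t ^ 2 / x) * (sqrt (2 * pi) / c))"
    unfolding N_val by (simp add: scaleR_conv_of_real divide_inverse)
  also have "sqrt (2 * pi) / c = 1 / sqrt x" by (simp add: c_def real_sqrt_mult)
  finally show "(LBINT y. ?G y) = of_real (exp (- pi * t ^ 2 / x) / sqrt x)" by simp
qed

text \<open>Poisson summation for a Gaussian. The sum h of all integer translates has Fourier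
  coefficients equal to the Fourier transform at the integers; the value of its Fourier series at 0
  is the right-hand side, and h(0) itself is the left-hand side.\<close>

theorem omega_inverse:
  assumes x: "x > 0"
  shows "1 + 2 * omega x = (1 + 2 * omega (1 / x)) / sqrt x"
proof -
  define F where "F z = exp (- pi * of_real x * z ^ 2)" for z :: complex
  \<comment> \<open>The translate by n is paired with that by -(n+1), so a series over the naturals
    covers every integer once. Since F is even, T n 1 = T n 0 already holds term by term, which
    gives h 1 = h 0 without reordering.\<close>
  define T where "T n z = F (z + of_nat n) + F (z - of_nat (Suc n))" for n z
  define h where "h z = (\<Sum>n. T n z)" for z
  define \<rho> where "\<rho> = exp (- pi * x / 2)"
  have \<rho>: "0 < \<rho>" "\<rho> < 1" using x by (auto simp: \<rho>_def)
  have F_even: "F (- z) = F z" for z by (simp add: F_def)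
  \<comment> \<open>A geometric majorant on every disc: n/2 remains of a^2 after the contributions
    of z are split off, because (Re z + a)^2 >= a^2/2 - (Re z)^2. It makes the series for h locally
    uniformly convergent on the plane.\<close>
  have F_bound: "norm (F (z + of_real a)) \<le> exp (2 * pi * x * r ^ 2) * \<rho> ^ n"
    if z: "norm z \<le> r" and a: "\<bar>a\<bar> \<ge> real n" for z r a n
  proof -
    have "Re ((z + of_real a) ^ 2) = (Re z + a) ^ 2 - (Im z) ^ 2" by (simp add: power2_eq_square)
    moreover have "(Im z) ^ 2 \<le> r ^ 2" "(Re z) ^ 2 \<le> r ^ 2"
      using z abs_Im_le_cmod[of z] abs_Re_le_cmod[of z] by (auto intro!: abs_le_square_iff[THEN iffD1])
    moreover have "(Re z + a) ^ 2 \<ge> a ^ 2 / 2 - (Re z) ^ 2"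
      using zero_le_power2[of "2 * Re z + a"] by (simp add: power2_eq_square algebra_simps)
    moreover have "a ^ 2 \<ge> real n"
    proof -
      have "real n \<le> real n ^ 2" by (cases n) (auto simp: power2_eq_square)
      also have "\<dots> \<le> a ^ 2" using a by (intro abs_le_square_iff[THEN iffD1]) auto
      finally show ?thesis .
    qed
    ultimately have "Re ((z + of_real a) ^ 2) \<ge> n / 2 - 2 * r ^ 2" by linarith
    hence "- pi * x * Re ((z + of_real a) ^ 2) \<le> - pi * x * (n / 2 - 2 * r ^ 2)"
      using x by (intro mult_left_mono_neg) auto
    also have "\<dots> = 2 * pi * x * r ^ 2 + n * (- pi * x / 2)" by (simp add: algebra_simps)
    finally have "exp (- pi * x * Re ((z + of_real a) ^ 2)) \<le> exp (2 * pi * x * r ^ 2 + n * (- pi * x / 2))"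
      by simp
    also have "\<dots> = exp (2 * pi * x * r ^ 2) * \<rho> ^ n"
      unfolding \<rho>_def exp_add exp_of_nat_mult[symmetric] ..
    finally show ?thesis by (simp add: F_def mult.assoc)
  qed
  have T_bound: "norm (T n z) \<le> 2 * exp (2 * pi * x * r ^ 2) * \<rho> ^ n" if "norm z \<le> r" for n z r
  proof -
    have "norm (F (z + of_real (real n))) \<le> exp (2 * pi * x * r ^ 2) * \<rho> ^ n"
      "norm (F (z + of_real (- real (Suc n)))) \<le> exp (2 * pi * x * r ^ 2) * \<rho> ^ n"
      using that by (intro F_bound; simp)+
    moreover have e: "z + of_nat n = z + of_real (real n)" "z - of_nat (Suc n) = z + of_real (- real (Suc n))"
      by simp_all
    ultimately show ?thesis unfolding T_def e
      using norm_triangle_ineq[of "F (z + of_real (real n))" "F (z + of_real (- real (Suc n)))"] by linarith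
  qed
  have summ: "summable (\<lambda>n. 2 * exp (2 * pi * x * r ^ 2) * \<rho> ^ n)" for r
    using \<rho> by (intro summable_mult summable_geometric) auto
  have unif: "uniform_limit (cball 0 r) (\<lambda>n z. \<Sum>i<n. T i z) h sequentially" for r
    unfolding h_def by (rule Weierstrass_m_test[OF T_bound summ]) auto
  have h_hol: "h holomorphic_on UNIV"
  proof (rule holomorphic_uniform_sequence[OF open_UNIV])
    show "(\<lambda>z. \<Sum>i<n. T i z) holomorphic_on UNIV" for n
      unfolding T_def F_def by (intro holomorphic_intros)
    show "\<exists>d>0. cball z d \<subseteq> UNIV \<and> uniform_limit (cball z d) (\<lambda>n z. \<Sum>i<n. T i z) h sequentially" for z :: complex
    proof (intro exI[of _ 1] conjI uniform_limit_on_subset[OF unif[of "norm z + 1"]])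
      show "cball z 1 \<subseteq> cball 0 (norm z + 1)"
      proof
        fix y assume "y \<in> cball z 1"
        hence "norm (y - z) \<le> 1" by (simp add: dist_norm norm_minus_commute)
        thus "y \<in> cball 0 (norm z + 1)" using norm_triangle_ineq[of "y - z" z] by simp
      qed
    qed auto
  qed
  have h01: "h 1 = h 0"
  proof -
    have "T n 1 = T n 0" for n
      using F_even[of "of_nat n"] F_even[of "of_nat (Suc n)"] by (simp add: T_def add_ac)
    thus ?thesis by (simp add: h_def)
  qed
  define c where "c k = integral {0..1} (\<lambda>y::real. h (of_real y) * exp (- 2 * pi * \<i> * of_int k * of_real y))" for k
  have c_eq: "c k = of_real (exp (- pi * of_int k ^ 2 / x) / sqrt x)" for k
  proof -
    define e where "e y = exp (- 2 * pi * \<i> * of_int k * of_real y)" for y :: real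
    define G where "G y = F (of_real y) * e y" for y :: real
    have e_shift: "e (y + of_int m) = e y" for y m
    proof -
      have "exp (- 2 * pi * \<i> * of_int k * of_int m) = (1::complex)"
        unfolding exp_eq_1 by (auto intro!: exI[of _ "- k * m"])
      moreover have "e (y + of_int m) = exp (- 2 * pi * \<i> * of_int k * of_real y + - 2 * pi * \<i> * of_int k * of_int m)"
        unfolding e_def by (simp add: distrib_left)
      ultimately show ?thesis unfolding exp_add e_def by simp
    qed
    have G_cont: "continuous_on A G" for A unfolding G_def F_def e_def by (intro continuous_intros)
    have G_eq: "G y = exp (- pi * of_real x * of_real y ^ 2) * exp (- 2 * pi * \<i> * of_real (of_int k) * of_real y)" for y
      by (simp add: G_def F_def e_def exp_of_real[symmetric])
    have G_int: "integrable lborel G" and G_val: "(LBINT y. G y) = of_real (exp (- pi * of_int k ^ 2 / x) / sqrt x)"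
      unfolding G_eq by (rule Gaussian_Fourier[OF x])+
    \<comment> \<open>The exponential e has period 1, so each term shifts to an integral of G over a
      unit interval. Term number N adds [N, N+1] on the right and [-(N+1), -N] on the left.\<close>
    have part: "integral {0..1} (\<lambda>y. (\<Sum>n<N. T n (of_real y)) * e y) = integral {- real N..real N} G" for N
    proof (induction N)
      case (Suc N)
      have eqT: "T N (of_real y) * e y = G (y + of_int (int N)) + G (y + of_int (- int (Suc N)))" for y
      proof -
        have a: "of_real y + of_nat N = of_real (y + of_int (int N))"
          "of_real y - of_nat (Suc N) = of_real (y + of_int (- int (Suc N)))"
          by (simp_all add: algebra_simps)
        show ?thesis unfolding G_def e_shift T_def a distrib_right ..
      qed
      have i: "(\<lambda>y. G (y + a)) integrable_on {0..1}" for a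
        by (intro integrable_continuous_interval continuous_on_compose2[OF G_cont] continuous_intros) auto
      have shift: "integral {0..1} (\<lambda>y. G (y + a)) = integral {a..a+1} G" for a
        using integral_shift_real_ivl[of a a "a + 1" G] by simp
      have "integral {0..1} (\<lambda>y. (\<Sum>n<Suc N. T n (of_real y)) * e y)
          = integral {0..1} (\<lambda>y. (\<Sum>n<N. T n (of_real y)) * e y + (G (y + of_int (int N)) + G (y + of_int (- int (Suc N)))))"
        by (simp add: distrib_right eqT)
      also have "\<dots> = integral {0..1} (\<lambda>y. (\<Sum>n<N. T n (of_real y)) * e y)
         + (integral {real N..real N + 1} G + integral {- real (Suc N)..- real (Suc N) + 1} G)"
      proof -
        have "(\<lambda>y. (\<Sum>n<N. T n (of_real y)) * e y) integrable_on {0..1}"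
          unfolding T_def F_def e_def by (intro integrable_continuous_interval continuous_intros)
        thus ?thesis using i shift[of "real N"] shift[of "- real (Suc N)"]
          by (simp add: integral_add integrable_add)
      qed
      also have "\<dots> = integral {- real (Suc N)..- real N} G + (integral {- real N..real N} G + integral {real N..real (Suc N)} G)"
        using Suc.IH by (simp add: add_ac)
      also have "\<dots> = integral {- real (Suc N)..real (Suc N)} G"
      proof -
        have "integral {- real N..real N} G + integral {real N..real (Suc N)} G = integral {- real N..real (Suc N)} G"
          "integral {- real (Suc N)..- real N} G + integral {- real N..real (Suc N)} G = integral {- real (Suc N)..real (Suc N)} G"
          by (rule Henstock_Kurzweil_Integration.integral_combine;
              simp add: integrable_continuous_interval[OF G_cont])+
        thus ?thesis by simp
      qed
      finally show ?case .
    qed simp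
    have "(\<lambda>N. integral {- real N..real N} G) \<longlonglongrightarrow> (LBINT y. G y)"
    proof -
      have "(\<lambda>N. LBINT y. indicator {- real N..real N} y *\<^sub>R G y) \<longlonglongrightarrow> (LBINT y. G y)"
      proof (rule integral_dominated_convergence[where w = "\<lambda>y. norm (G y)"])
        show "AE y in lborel. (\<lambda>N. indicator {- real N..real N} y *\<^sub>R G y) \<longlonglongrightarrow> G y"
        proof (intro AE_I2 tendsto_eventually)
          fix y :: real
          have "\<forall>\<^sub>F N in sequentially. real N \<ge> \<bar>y\<bar>"
            by (rule eventually_compose_filterlim[OF eventually_ge_at_top filterlim_real_sequentially])
          thus "\<forall>\<^sub>F N in sequentially. indicator {- real N..real N} y *\<^sub>R G y = G y"
            by eventually_elim (auto simp: indicator_def)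
        qed
      qed (use G_int in \<open>auto simp: indicator_def\<close>)
      moreover have "(LBINT y. indicator {- real N..real N} y *\<^sub>R G y) = integral {- real N..real N} G" for N
        using set_borel_integral_eq_integral(2)[of "{- real N..real N}" G]
              borel_integrable_compact[of "{- real N..real N}" G] G_cont
        by (simp add: set_integrable_def set_lebesgue_integral_def)
      ultimately show ?thesis by simp
    qed
    moreover have "(\<lambda>N. integral {0..1} (\<lambda>y. (\<Sum>n<N. T n (of_real y)) * e y)) \<longlonglongrightarrow> integral {0..1} (\<lambda>y. h (of_real y) * e y)"
    proof -
      have "uniform_limit {0..1} (\<lambda>N y. (\<Sum>n<N. T n (of_real y)) * e y) (\<lambda>y. h (of_real y) * e y) sequentially"
      proof (rule uniform_limitI)
        fix \<epsilon> :: real assume "\<epsilon> > 0"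
        from uniform_limitD[OF unif[of 1] this]
        show "\<forall>\<^sub>F N in sequentially. \<forall>y\<in>{0..1}. dist ((\<Sum>n<N. T n (of_real y)) * e y) (h (of_real y) * e y) < \<epsilon>"
        proof eventually_elim
          case (elim N)
          have "norm (e y) = 1" for y by (simp add: e_def)
          hence "dist ((\<Sum>n<N. T n (of_real y)) * e y) (h (of_real y) * e y) = dist (\<Sum>n<N. T n (of_real y)) (h (of_real y))" for y
            unfolding dist_norm left_diff_distrib[symmetric] norm_mult by simp
          thus ?case using elim by auto
        qed
      qed
      moreover have "continuous_on {0..1} (\<lambda>y. (\<Sum>n<N. T n (of_real y)) * e y)" for N
        unfolding T_def F_def e_def by (intro continuous_intros)
      ultimately obtain I J where IJ: "\<And>N. ((\<lambda>y. (\<Sum>n<N. T n (of_real y)) * e y) has_integral I N) {0..1}"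
          "((\<lambda>y. h (of_real y) * e y) has_integral J) {0..1}" "I \<longlonglongrightarrow> J"
        by (rule uniform_limit_integral) auto
      thus ?thesis by (simp only: integral_unique[OF IJ(1)] integral_unique[OF IJ(2)])
    qed
    ultimately have "integral {0..1} (\<lambda>y. h (of_real y) * e y) = (LBINT y. G y)"
      unfolding part by (rule LIMSEQ_unique[rotated])
    thus ?thesis unfolding G_val c_def e_def .
  qed
  have "(\<lambda>N. c 0 + (\<Sum>k<N. c (int (Suc k)) + c (- int (Suc k)))) \<longlonglongrightarrow> h 0"
    using Fourier_series_at_0[OF h_hol h01] unfolding c_def .
  also have "(\<lambda>N. c 0 + (\<Sum>k<N. c (int (Suc k)) + c (- int (Suc k)))) =
      (\<lambda>N. of_real ((1 + 2 * (\<Sum>k<N. exp (- pi * real (Suc k) ^ 2 * (1 / x)))) / sqrt x))"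
  proof -
    have "c (int (Suc k)) + c (- int (Suc k)) = of_real (2 * exp (- pi * real (Suc k) ^ 2 * (1 / x)) / sqrt x)" for k
      by (simp add: c_eq del: of_nat_Suc)
    moreover have "c 0 = of_real (1 / sqrt x)" by (simp add: c_eq)
    ultimately show ?thesis
      by (simp only: of_real_sum[symmetric] of_real_add[symmetric] sum_divide_distrib[symmetric]
            sum_distrib_left[symmetric] add_divide_distrib)
  qed
  finally have "(\<lambda>N. of_real ((1 + 2 * (\<Sum>k<N. exp (- pi * real (Suc k) ^ 2 * (1 / x)))) / sqrt x)) \<longlonglongrightarrow> h 0" .
  moreover have "(\<lambda>N. of_real ((1 + 2 * (\<Sum>k<N. exp (- pi * real (Suc k) ^ 2 * (1 / x)))) / sqrt x))
      \<longlonglongrightarrow> (of_real ((1 + 2 * omega (1 / x)) / sqrt x) :: complex)"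
    unfolding omega_def using x by (intro tendsto_intros summable_LIMSEQ summable_omega) auto
  ultimately have "h 0 = of_real ((1 + 2 * omega (1 / x)) / sqrt x)" by (rule LIMSEQ_unique)
  moreover have "h 0 = of_real (1 + 2 * omega x)"
  proof -
    let ?a = "\<lambda>n. exp (- pi * real n ^ 2 * x)"
    have s: "(\<lambda>n. ?a (Suc n)) sums omega x" unfolding omega_def using x by (intro summable_sums summable_omega)
    hence "?a sums (omega x + 1)" by (subst (asm) sums_Suc_iff) simp
    from sums_add[OF this s] have "(\<lambda>n. of_real (?a n + ?a (Suc n))) sums (of_real (omega x + 1 + omega x) :: complex)"
      by (rule sums_of_real)
    moreover have "of_real (?a n + ?a (Suc n)) = T n 0" for n
      using F_even[of "of_nat (Suc n)"]
      by (simp add: T_def F_def mult_ac del: of_nat_Suc flip: exp_of_real)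
    ultimately show ?thesis by (simp add: h_def sums_iff)
  qed
  ultimately show ?thesis by (simp only: of_real_eq_iff)
qed

section \<open>Parameter integrals and exponential integrals\<close>

text \<open>A local majorant g of the integrand alone is enough: by Cauchy's inequality on discs of
  radius r/2 it also majorises the derivative by 2g/r, hence the difference quotients, and dominated
  convergence applies.\<close>

lemma holomorphic_integral:
  fixes f :: "'a \<Rightarrow> complex \<Rightarrow> complex"
  assumes S: "open S"
    and hol: "\<And>x. x \<in> space M \<Longrightarrow> f x holomorphic_on S"
    and meas: "\<And>s. s \<in> S \<Longrightarrow> (\<lambda>x. f x s) \<in> borel_measurable M"
    and dom: "\<And>s. s \<in> S \<Longrightarrow> \<exists>r>0. cball s r \<subseteq> S \<and>
      (\<exists>g. integrable M g \<and> (\<forall>x\<in>space M. \<forall>y\<in>cball s r. norm (f x y) \<le> g x))"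
  shows "(\<lambda>s. \<integral>x. f x s \<partial>M) holomorphic_on S"
  unfolding holomorphic_on_open[OF S]
proof (intro ballI)
  fix s assume s: "s \<in> S"
  obtain r g where r: "r > 0" "cball s r \<subseteq> S" and g: "integrable M g"
      "\<And>x y. x \<in> space M \<Longrightarrow> y \<in> cball s r \<Longrightarrow> norm (f x y) \<le> g x"
    using dom[OF s] by blast
  have int: "integrable M (\<lambda>x. f x y)" if "y \<in> cball s r" for y
  proof (rule Bochner_Integration.integrable_bound[OF g(1) meas])
    show "y \<in> S" using that r by auto
    show "AE x in M. norm (f x y) \<le> norm (g x)"
    proof (rule AE_I2)
      fix x assume "x \<in> space M"
      from g(2)[OF this that] show "norm (f x y) \<le> norm (g x)" by simp
    qed
  qed
  let ?B = "ball s (r / 2)"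
  have lip: "norm (f x y - f x s) \<le> 2 / r * g x * norm (y - s)" if x: "x \<in> space M" and y: "y \<in> ?B" for x y
  proof (rule field_differentiable_bound[of ?B])
    fix z assume z: "z \<in> ?B"
    have zS: "cball z (r / 2) \<subseteq> cball s r"
    proof
      fix w assume "w \<in> cball z (r / 2)"
      hence "dist z w \<le> r / 2" by simp
      moreover have "dist s z < r / 2" using z by simp
      ultimately have "dist s w \<le> r" using dist_triangle[of s w z] by linarith
      thus "w \<in> cball s r" by simp
    qed
    have "z \<in> cball z (r / 2)" using r(1) by simp
    hence "z \<in> S" using subsetD[OF zS] subsetD[OF r(2)] by blast
    thus "(f x has_field_derivative deriv (f x) z) (at z within ?B)"
      by (rule has_field_derivative_at_within[OF holomorphic_derivI[OF hol[OF x] S]])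
    have "norm ((deriv ^^ 1) (f x) z) \<le> fact 1 * g x / (r / 2) ^ 1"
    proof (rule Cauchy_inequality)
      show "f x holomorphic_on ball z (r / 2)" "continuous_on (cball z (r / 2)) (f x)"
        using order_trans[OF zS r(2)] order_trans[OF ball_subset_cball order_trans[OF zS r(2)]]
        by (auto intro!: holomorphic_on_imp_continuous_on intro: holomorphic_on_subset[OF hol[OF x]])
      show "norm (f x w) \<le> g x" if "norm (z - w) = r / 2" for w
        using zS that by (intro g(2) x) (auto simp: dist_norm subset_iff)
    qed (use r in auto)
    thus "norm (deriv (f x) z) \<le> 2 / r * g x" by (simp add: field_simps)
  qed (use r y in auto)
  have "((\<lambda>y. ((\<integral>x. f x y \<partial>M) - (\<integral>x. f x s \<partial>M)) / (y - s)) \<longlongrightarrow> (\<integral>x. deriv (f x) s \<partial>M)) (at s within ?B)"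
    unfolding tendsto_at_iff_sequentially o_def
  proof (intro allI impI)
    fix X :: "nat \<Rightarrow> complex" assume X: "\<forall>i. X i \<in> ?B - {s}" "X \<longlonglongrightarrow> s"
    have XB: "X i \<in> cball s r" "X i \<in> ?B" "X i \<noteq> s" for i using X(1) r(1) by (auto simp: less_eq_real_def dest: spec[of _ i])
    have lim: "(\<lambda>i. (f x (X i) - f x s) / (X i - s)) \<longlonglongrightarrow> deriv (f x) s" if x: "x \<in> space M" for x
    proof -
      have "(f x has_field_derivative deriv (f x) s) (at s)"
        by (rule holomorphic_derivI[OF hol[OF x] S s])
      hence "((\<lambda>y. (f x y - f x s) / (y - s)) \<longlongrightarrow> deriv (f x) s) (at s)"
        by (simp add: has_field_derivative_iff)
      thus ?thesis using X(2) XB(3) unfolding tendsto_at_iff_sequentially o_def by simp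
    qed
    have m1: "(\<lambda>x. (f x (X i) - f x s) / (X i - s)) \<in> borel_measurable M" for i
      using XB[of i] r s by (intro borel_measurable_divide borel_measurable_diff meas) auto
    have "(\<lambda>i. \<integral>x. (f x (X i) - f x s) / (X i - s) \<partial>M) \<longlonglongrightarrow> (\<integral>x. deriv (f x) s \<partial>M)"
    proof (rule integral_dominated_convergence[where w = "\<lambda>x. 2 / r * g x"])
      show "(\<lambda>x. deriv (f x) s) \<in> borel_measurable M"
        by (rule borel_measurable_LIMSEQ_metric[OF m1 lim])
      show "AE x in M. norm ((f x (X i) - f x s) / (X i - s)) \<le> 2 / r * g x" for i
      proof (rule AE_I2)
        fix x assume "x \<in> space M"
        thus "norm ((f x (X i) - f x s) / (X i - s)) \<le> 2 / r * g x"
          using lip[of x "X i"] XB[of i] by (simp add: norm_divide pos_divide_le_eq)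
      qed
    qed (use m1 lim g in auto)
    moreover have "(\<integral>x. (f x (X i) - f x s) / (X i - s) \<partial>M) = ((\<integral>x. f x (X i) \<partial>M) - (\<integral>x. f x s \<partial>M)) / (X i - s)" for i
      using int[OF XB(1)[of i]] int[of s] r by simp
    ultimately show "(\<lambda>i. ((\<integral>x. f x (X i) \<partial>M) - (\<integral>x. f x s \<partial>M)) / (X i - s)) \<longlonglongrightarrow> (\<integral>x. deriv (f x) s \<partial>M)"
      by (simp only:)
  qed
  hence "((\<lambda>s. \<integral>x. f x s \<partial>M) has_field_derivative (\<integral>x. deriv (f x) s \<partial>M)) (at s within ?B)"
    by (simp add: has_field_derivative_iff)
  thus "\<exists>f'. ((\<lambda>s. \<integral>x. f x s \<partial>M) has_field_derivative f') (at s)"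
    using r by (subst (asm) at_within_open) auto
qed

lemma set_integral_FTC_atLeast:
  fixes f F :: "real \<Rightarrow> complex"
  assumes F: "\<And>x. x \<ge> c \<Longrightarrow> (F has_vector_derivative f x) (at x)"
    and cont: "continuous_on {c..} f" and int: "set_integrable lborel {c..} f"
    and lim: "(F \<longlongrightarrow> B) at_top"
  shows "(LINT x:{c..}|lborel. f x) = B - F c"
proof -
  have "((\<lambda>y. LBINT x. indicator {..y} x *\<^sub>R (indicator {c..} x *\<^sub>R f x)) \<longlongrightarrow> (LINT x:{c..}|lborel. f x)) at_top"
    unfolding set_lebesgue_integral_def
    by (rule tendsto_integral_at_top) (use int in \<open>auto simp: set_integrable_def\<close>)
  moreover have "((\<lambda>y. LBINT x. indicator {..y} x *\<^sub>R (indicator {c..} x *\<^sub>R f x)) \<longlongrightarrow> B - F c) at_top"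
  proof (rule Lim_transform_eventually[OF tendsto_diff[OF lim tendsto_const]])
    show "\<forall>\<^sub>F y in at_top. F y - F c = (LBINT x. indicator {..y} x *\<^sub>R (indicator {c..} x *\<^sub>R f x))"
      using eventually_ge_at_top[of c]
    proof eventually_elim
      case (elim y)
      have "(LBINT x. indicator {c..y} x *\<^sub>R f x) = F y - F c"
        using elim by (intro integral_FTC_Icc) 
          (auto intro!: has_vector_derivative_at_within F continuous_on_subset[OF cont])
      moreover have "indicator {..y} x *\<^sub>R (indicator {c..} x *\<^sub>R f x) = indicator {c..y} x *\<^sub>R f x" for x
        by (auto simp: indicator_def)
      ultimately show ?case by (simp only:)
    qed
  qed
  ultimately show ?thesis by (rule tendsto_unique[OF trivial_limit_at_top_linorder])
qed

lemma set_integrable_exp_real: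
  fixes a c :: real
  assumes "a > 0"
  shows "set_integrable lborel {c..} (\<lambda>t. exp (- a * t))"
proof -
  have "(\<lambda>t. exp (- a * t)) absolutely_integrable_on {c..}"
    by (rule nonnegative_absolutely_integrable_1)
       (use has_integral_exp_minus_to_infinity[OF assms, of c] in \<open>auto simp: integrable_on_def\<close>)
  thus ?thesis unfolding set_integrable_def by (subst (asm) integrable_completion) auto
qed

lemma exp_integral_atLeast:
  fixes a :: complex and c :: real
  assumes a: "Re a > 0"
  shows "set_integrable lborel {c..} (\<lambda>t. exp (- a * of_real t))"
    and "(LINT t:{c..}|lborel. exp (- a * of_real t)) = exp (- a * of_real c) / a"
proof -
  show int: "set_integrable lborel {c..} (\<lambda>t. exp (- a * of_real t))"
    by (rule set_integrable_bound[OF set_integrable_exp_real[OF a, of c]])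
       (auto simp: set_borel_measurable_def)
  have "a \<noteq> 0" using a by auto
  have "((\<lambda>t. - exp (- a * of_real t) / a) \<longlongrightarrow> 0) at_top"
  proof (rule tendsto_norm_zero_cancel)
    have "((\<lambda>t. exp (- Re a * t) / norm a) \<longlongrightarrow> 0) at_top" using a \<open>a \<noteq> 0\<close> by real_asymp
    thus "((\<lambda>t. norm (- exp (- a * of_real t) / a)) \<longlongrightarrow> 0) at_top" by (simp add: norm_divide)
  qed
  moreover have "((\<lambda>t. - exp (- a * of_real t) / a) has_vector_derivative exp (- a * of_real x)) (at x)" for x
  proof -
    have "((\<lambda>t. - exp (- a * t) / a) has_field_derivative exp (- a * of_real x)) (at (of_real x))"
      using \<open>a \<noteq> 0\<close> by (auto intro!: derivative_eq_intros)
    from has_vector_derivative_real_field[OF this] show ?thesis .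
  qed
  ultimately have "(LINT t:{c..}|lborel. exp (- a * of_real t)) = 0 - (- exp (- a * of_real c) / a)"
    by (intro set_integral_FTC_atLeast int) (auto intro!: continuous_intros)
  thus "(LINT t:{c..}|lborel. exp (- a * of_real t)) = exp (- a * of_real c) / a" by simp
qed

lemma exp_integral_indicator:
  fixes a :: complex
  assumes "Re a > 0"
  shows "integrable lborel (\<lambda>t. indicator {0..} t *\<^sub>R exp (- a * of_real t))"
    and "(LBINT t. indicator {0..} t *\<^sub>R exp (- a * of_real t)) = 1 / a"
  using exp_integral_atLeast[OF assms, of 0] by (simp_all add: set_integrable_def set_lebesgue_integral_def)

text \<open>Meant for series that can only be majorised on bounded ranges of t; each [a,T) is a
  neighbourhood of its points relative to the half-line.\<close>

lemma continuous_on_atLeast: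
  fixes f :: "real \<Rightarrow> 'a::topological_space"
  assumes "\<And>T. continuous_on {a..<T} f"
  shows "continuous_on {a..} f"
proof (intro continuous_on_eq_continuous_within[THEN iffD2] ballI)
  fix t :: real assume t: "t \<in> {a..}"
  have "continuous (at t within {a..<t+1}) f"
    using assms[of "t + 1"] t by (auto simp: continuous_on_eq_continuous_within)
  moreover have "at t within {a..<t+1} = at t within {a..}"
    by (rule at_within_nhd[of t "{..<t+1}"]) auto
  ultimately show "continuous (at t within {a..}) f" by simp
qed

lemma linear_exp_integral_atLeast:
  fixes a :: complex and c :: real
  assumes a: "Re a > 0"
  shows "set_integrable lborel {c..} (\<lambda>t. of_real (t - c) * exp (- a * of_real t))"
    and "(LINT t:{c..}|lborel. of_real (t - c) * exp (- a * of_real t)) = exp (- a * of_real c) / a ^ 2"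
proof -
  \<comment> \<open>Half of the exponential decay is spent on the linear factor, the other half on
    integrability.\<close>
  define r where "r = Re a / 2"
  have r: "r > 0" "Re a = 2 * r" using a by (auto simp: r_def)
  have "a \<noteq> 0" using a by auto
  show int: "set_integrable lborel {c..} (\<lambda>t. of_real (t - c) * exp (- a * of_real t))"
  proof (rule set_integrable_bound[OF set_integrable_mult_right[OF set_integrable_exp_real[OF r(1), of c]]])
    show "AE t in lborel. t \<in> {c..} \<longrightarrow> norm (of_real (t - c) * exp (- a * of_real t)) \<le> norm (exp (- r * c) / r * exp (- r * t))"
    proof (intro AE_I2 impI)
      fix t assume "t \<in> {c..}"
      hence t: "t \<ge> c" by simp
      have "r * (t - c) \<le> exp (r * (t - c))" using exp_ge_add_one_self[of "r * (t - c)"] by linarith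
      hence "r * (t - c) * exp (- 2 * r * t) \<le> exp (r * (t - c)) * exp (- 2 * r * t)"
        by (intro mult_right_mono) auto
      also have "\<dots> = exp (- r * c) * exp (- r * t)" by (simp add: exp_add[symmetric] algebra_simps)
      finally show "norm (of_real (t - c) * exp (- a * of_real t)) \<le> norm (exp (- r * c) / r * exp (- r * t))"
        unfolding norm_mult norm_of_real norm_exp_eq_Re using r t
        by (simp add: field_simps abs_mult)
    qed
  qed (auto simp: set_borel_measurable_def)
  let ?F = "\<lambda>t. - (of_real (t - c) / a + 1 / a ^ 2) * exp (- a * of_real t)"
  have "(?F \<longlongrightarrow> 0) at_top"
  proof (rule Lim_null_comparison)
    show "\<forall>\<^sub>F t in at_top. norm (?F t) \<le> ((t - c) / norm a + 1 / norm a ^ 2) * exp (- Re a * t)"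
      using eventually_ge_at_top[of c]
    proof eventually_elim
      case (elim t)
      have "norm (of_real (t - c) / a + 1 / a ^ 2) \<le> (t - c) / norm a + 1 / norm a ^ 2"
        using elim by (intro order_trans[OF norm_triangle_ineq]) (simp add: norm_divide norm_power flip: of_real_diff)
      hence "norm (of_real (t - c) / a + 1 / a ^ 2) * exp (- Re a * t)
          \<le> ((t - c) / norm a + 1 / norm a ^ 2) * exp (- Re a * t)" by (intro mult_right_mono) auto
      thus ?case by (simp only: norm_mult norm_minus_cancel norm_exp_eq_Re) simp
    qed
    show "((\<lambda>t. ((t - c) / norm a + 1 / norm a ^ 2) * exp (- Re a * t)) \<longlongrightarrow> 0) at_top"
      using a \<open>a \<noteq> 0\<close> by real_asymp
  qed
  moreover have "(?F has_vector_derivative of_real (x - c) * exp (- a * of_real x)) (at x)" for x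
  proof -
    have "((\<lambda>t. - ((t - of_real c) / a + 1 / a ^ 2) * exp (- a * t)) has_field_derivative
        (of_real x - of_real c) * exp (- a * of_real x)) (at (of_real x))"
      using \<open>a \<noteq> 0\<close> by (auto intro!: derivative_eq_intros simp: field_simps power2_eq_square)
    from has_vector_derivative_real_field[OF this] show ?thesis by simp
  qed
  ultimately have "(LINT t:{c..}|lborel. of_real (t - c) * exp (- a * of_real t)) = 0 - ?F c"
    by (intro set_integral_FTC_atLeast int) (auto intro!: continuous_intros)
  thus "(LINT t:{c..}|lborel. of_real (t - c) * exp (- a * of_real t)) = exp (- a * of_real c) / a ^ 2"
    by simp
qed

text \<open>The real change of variables t = exp u is applied to the real and the imaginary part,
  which \<open>p\<close> stands for. The measurability hypothesis serves to pass from Lebesgue to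
  Borel measure.\<close>

lemma integral_substitution_exp:
  fixes f :: "real \<Rightarrow> complex"
  assumes abs: "f absolutely_integrable_on {0<..}"
    and meas: "(\<lambda>u. exp u *\<^sub>R f (exp u)) \<in> borel_measurable borel"
  shows "integrable lborel (\<lambda>u. exp u *\<^sub>R f (exp u))"
    and "(LBINT u. exp u *\<^sub>R f (exp u)) = integral {0<..} f"
proof -
  have range: "range (exp :: real \<Rightarrow> real) = {0<..}"
  proof (intro equalityI subsetI)
    fix x :: real assume "x \<in> {0<..}"
    thus "x \<in> range exp" by (intro image_eqI[of _ _ "ln x"]) auto
  qed auto
  have cov: "(\<lambda>u. exp u * p (f (exp u))) absolutely_integrable_on UNIV \<and>
      integral UNIV (\<lambda>u. exp u * p (f (exp u))) = p (integral {0<..} f)"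
    if p: "bounded_linear p" for p :: "complex \<Rightarrow> real"
  proof -
    have "(p \<circ> f) absolutely_integrable_on {0<..}" by (rule absolutely_integrable_linear[OF abs p])
    moreover have "integral {0<..} (p \<circ> f) = p (integral {0<..} f)"
      using abs p by (intro integral_linear set_lebesgue_integral_eq_integral(1)) auto
    ultimately show ?thesis
      using has_absolute_integral_change_of_variables_1'[of UNIV exp exp "p \<circ> f" "p (integral {0<..} f)"]
      by (auto simp: range o_def inj_on_def intro!: derivative_eq_intros)
  qed
  have meas': "(\<lambda>u. exp u * p (f (exp u))) \<in> borel_measurable borel"
    if p: "bounded_linear p" for p :: "complex \<Rightarrow> real"
  proof -
    have "(\<lambda>u. p (exp u *\<^sub>R f (exp u))) \<in> borel_measurable borel"
      by (intro borel_measurable_continuous_onI[THEN measurable_compose[OF meas]] linear_continuous_on p)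
    thus ?thesis by (simp add: linear_scale[OF bounded_linear.linear[OF p]])
  qed
  have leb: "integrable lborel (\<lambda>u. exp u * p (f (exp u))) \<and>
     (LBINT u. exp u * p (f (exp u))) = p (integral {0<..} f)"
    if p: "bounded_linear p" for p :: "complex \<Rightarrow> real"
  proof -
    have "integrable lebesgue (\<lambda>u. exp u * p (f (exp u)))" using cov[OF p] by (simp add: set_integrable_def)
    hence i: "integrable lborel (\<lambda>u. exp u * p (f (exp u)))"
      using integrable_completion[of "\<lambda>u. exp u * p (f (exp u))" lborel] meas'[OF p] by simp
    moreover from i have "(LBINT u. exp u * p (f (exp u))) = integral UNIV (\<lambda>u. exp u * p (f (exp u)))"
      by (simp add: integral_lborel)
    ultimately show ?thesis using cov[OF p] by simp
  qed
  note re = leb[OF bounded_linear_Re] and im = leb[OF bounded_linear_Im]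
  have eq: "exp u *\<^sub>R f (exp u) = of_real (exp u * Re (f (exp u))) + \<i> * of_real (exp u * Im (f (exp u)))" for u
    by (simp add: complex_eq_iff)
  show "integrable lborel (\<lambda>u. exp u *\<^sub>R f (exp u))"
    unfolding eq using re im by (intro Bochner_Integration.integrable_add integrable_mult_right integrable_of_real) auto
  have "(LBINT u. exp u *\<^sub>R f (exp u)) = of_real (Re (integral {0<..} f)) + \<i> * of_real (Im (integral {0<..} f))"
    unfolding eq using re im
    by (subst Bochner_Integration.integral_add)
       (auto intro!: integrable_mult_right integrable_of_real simp del: of_real_mult)
  thus "(LBINT u. exp u *\<^sub>R f (exp u)) = integral {0<..} f" by (simp add: complex_eq_iff)
qed

text \<open>Euler's integral with t = a exp u. Scaling by a becomes the translation u -> u + ln a,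
  under which Lebesgue measure on the line is invariant; this yields the factor a^(-z).\<close>

lemma Gamma_integral_exp:
  fixes z :: complex and a :: real
  assumes z: "Re z > 0" and a: "a > 0"
  shows "integrable lborel (\<lambda>u. exp (z * of_real u) * of_real (exp (- a * exp u)))"
    and "(LBINT u. exp (z * of_real u) * of_real (exp (- a * exp u))) = of_real a powr (- z) * Gamma z"
proof -
  let ?f = "\<lambda>t. of_real t powr (z - 1) / of_real (exp t) :: complex"
  define G where "G u = exp (z * of_real u) * of_real (exp (- exp u))" for u :: real
  have G: "exp u *\<^sub>R ?f (exp u) = G u" for u
  proof -
    have "exp u *\<^sub>R ?f (exp u) = (exp (of_real u) * exp ((z - 1) * of_real u)) * of_real (exp (- exp u))"
      by (simp add: powr_def scaleR_conv_of_real exp_minus field_simps Ln_of_real flip: exp_of_real)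
    also have "exp (of_real u) * exp ((z - 1) * of_real u) = exp (z * of_real u)"
      by (simp add: algebra_simps flip: exp_add)
    finally show ?thesis by (simp add: G_def)
  qed
  have meas: "G \<in> borel_measurable borel" unfolding G_def by measurable
  have int: "integrable lborel G" and val: "(LBINT u. G u) = Gamma z"
    using integral_substitution_exp[OF absolutely_integrable_Gamma_integral'[OF z]] meas
      integral_unique[OF Gamma_integral_complex'[OF z]] unfolding G by auto
  have shift: "exp (z * of_real u) * of_real (exp (- a * exp u)) = of_real a powr (- z) * G (ln a + 1 * u)" for u
  proof -
    have "G (ln a + u) = exp (z * of_real (ln a)) * exp (z * of_real u) * of_real (exp (- a * exp u))"
      using a by (simp add: G_def exp_add distrib_left)
    moreover have "of_real a powr (- z) * exp (z * of_real (ln a)) = 1"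
      using a by (simp add: powr_def Ln_of_real flip: exp_add)
    ultimately show ?thesis by (simp add: mult.assoc[symmetric])
  qed
  show "integrable lborel (\<lambda>u. exp (z * of_real u) * of_real (exp (- a * exp u)))"
    unfolding shift by (intro integrable_mult_right lborel_integrable_real_affine int) simp
  have "(LBINT u. G (ln a + 1 * u)) = Gamma z"
    using lborel_integral_real_affine[of 1 G "ln a"] val by simp
  thus "(LBINT u. exp (z * of_real u) * of_real (exp (- a * exp u))) = of_real a powr (- z) * Gamma z"
    unfolding shift by simp
qed

section \<open>The entire function xi\<close>

lemma omega_nonneg: "x > 0 \<Longrightarrow> omega x \<ge> 0"
  unfolding omega_def by (intro suminf_nonneg summable_omega) auto

lemma omega_le:
  assumes "x \<ge> 1"
  shows "omega x \<le> 2 * exp (- pi * x)"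
proof -
  have x: "x > 0" using assms by simp
  have "pi * x \<ge> 1 * 1" using pi_ge_two assms by (intro mult_mono) auto
  hence "2 \<le> exp (pi * x)" using exp_ge_add_one_self[of "pi * x"] by linarith
  hence half: "exp (- pi * x) \<le> 1 / 2" by (simp add: exp_minus field_simps)
  have "omega x \<le> (\<Sum>n. exp (- pi * x) * exp (- pi * x) ^ n)"
    unfolding omega_def using x
    by (intro suminf_le omega_term_le summable_omega summable_mult summable_geometric) auto
  also have "\<dots> = exp (- pi * x) * (1 / (1 - exp (- pi * x)))"
    using x by (subst suminf_mult) (auto simp: suminf_geometric intro!: summable_geometric)
  also have "\<dots> \<le> exp (- pi * x) * 2"
  proof (intro mult_left_mono)
    have "1 - exp (- pi * x) \<ge> 1 / 2" using half by simp
    from frac_le[OF _ order_refl _ this, of 1] show "1 / (1 - exp (- pi * x)) \<le> 2" by simp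
  qed auto
  finally show ?thesis by simp
qed

lemma omega_measurable [measurable]: "(\<lambda>u. omega (exp u)) \<in> borel_measurable borel"
  unfolding omega_def by measurable

lemma power_div_fact_le_exp:
  assumes "(x::real) \<ge> 0"
  shows "x ^ n / fact n \<le> exp x"
proof -
  have "sum (\<lambda>k. x ^ k / fact k) {n} \<le> (\<Sum>k. x ^ k / fact k)"
    by (rule sum_le_suminf) (use assms summable_exp[of x] in \<open>auto simp: divide_inverse mult.commute\<close>)
  thus ?thesis by (simp add: exp_def scaleR_conv_of_real divide_inverse mult.commute)
qed

text \<open>In the variable x = exp u, the integrand of Riemann's formula: omega(x) (x^(s/2) +
  x^((1-s)/2)) dx/x over x >= 1. It is unchanged under s -> 1 - s.\<close>

definition xi_kernel :: "real \<Rightarrow> complex \<Rightarrow> complex" where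
  "xi_kernel u s = indicator {0..} u *\<^sub>R
     (of_real (omega (exp u)) * (exp (s / 2 * of_real u) + exp ((1 - s) / 2 * of_real u)))"

definition xi_integral :: "complex \<Rightarrow> complex" where
  "xi_integral s = (LBINT u. xi_kernel u s)"

text \<open>Riemann's representation taken as an explicit entire function. That it continues the
  classical product is \<open>xi_entire_eq\<close>; zeta itself is recovered from it in
  \<open>zeta_eq\<close>.\<close>

definition xi_entire :: "complex \<Rightarrow> complex" where
  "xi_entire s = 1 / 2 + s * (s - 1) / 2 * xi_integral s"

text \<open>For u >= 0, omega(exp u) <= 2 exp(-exp u) <= 2 n! exp(-n u) for every n. The condition
  on n makes (1 + r)/2 - n <= -1, so the decay exp(-u) is left over. The factorial is the source of
  the R log R in the growth of xi.\<close>

lemma xi_kernel_bound: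
  assumes "norm s \<le> r" "real n \<ge> (3 + r) / 2"
  shows "norm (xi_kernel u s) \<le> 4 * fact n * (indicator {0..} u * exp (- 1 * u))"
proof (cases "u \<ge> 0")
  case True
  have e: "norm (exp (w / 2 * of_real u)) \<le> exp ((1 + r) / 2 * u)" if "norm w \<le> 1 + r" for w :: complex
  proof -
    have "Re w * u \<le> (1 + r) * u"
      using that True complex_Re_le_cmod[of w] by (intro mult_right_mono) auto
    thus ?thesis by simp
  qed
  have "norm (1 - s) \<le> 1 + r" using norm_triangle_ineq4[of 1 s] assms(1) by simp
  hence E: "norm (exp (s / 2 * of_real u) + exp ((1 - s) / 2 * of_real u)) \<le> 2 * exp ((1 + r) / 2 * u)"
    using norm_triangle_ineq[of "exp (s / 2 * of_real u)" "exp ((1 - s) / 2 * of_real u)"]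
      e[of s] e[of "1 - s"] assms(1) by linarith
  have om: "0 \<le> omega (exp u)" "omega (exp u) \<le> 2 * exp (- exp u)"
  proof -
    show "0 \<le> omega (exp u)" by (rule omega_nonneg) simp
    have "omega (exp u) \<le> 2 * exp (- pi * exp u)" by (rule omega_le) (use True in simp)
    also have "- pi * exp u \<le> - 1 * exp u" using pi_ge_two by (intro mult_right_mono) auto
    finally show "omega (exp u) \<le> 2 * exp (- exp u)" by simp
  qed
  have "norm (xi_kernel u s) = omega (exp u) * norm (exp (s / 2 * of_real u) + exp ((1 - s) / 2 * of_real u))"
    unfolding xi_kernel_def using True om(1) by (simp add: norm_mult)
  also have "\<dots> \<le> 2 * exp (- exp u) * (2 * exp ((1 + r) / 2 * u))"
    by (intro mult_mono om E) auto
  also have "exp (- exp u) \<le> fact n / exp (n * u)"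
    using power_div_fact_le_exp[of "exp u" n] unfolding exp_of_nat_mult by (simp add: exp_minus field_simps)
  also have "2 * (fact n / exp (n * u)) * (2 * exp ((1 + r) / 2 * u)) = 4 * fact n * exp ((1 + r) / 2 * u - n * u)"
    by (simp add: exp_diff)
  also have "(1 + r) / 2 * u - n * u \<le> - u"
  proof -
    have "((1 + r) / 2 - n) * u \<le> (- 1) * u" using assms(2) True by (intro mult_right_mono) (auto simp: field_simps)
    thus ?thesis by (simp add: algebra_simps)
  qed
  finally show ?thesis using True by simp
qed (simp add: xi_kernel_def)

lemma integrable_exp_indicator: "integrable lborel (\<lambda>u::real. c * (indicator {0..} u * exp (- 1 * u)) :: real)"
  using set_integrable_exp_real[of 1 0] by (auto simp: set_integrable_def intro!: integrable_mult_right)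

lemma integral_exp_indicator: "(LBINT u. c * (indicator {0..} u * exp (- 1 * u))) = (c :: real)"
proof -
  have "complex_of_real (LINT u:{0..}|lborel. exp (- 1 * u)) = 1"
    using exp_integral_atLeast(2)[of 1 0] by (simp flip: exp_of_real set_integral_complex_of_real)
  thus ?thesis by (simp add: set_lebesgue_integral_def)
qed

lemma xi_kernel_measurable [measurable]: "(\<lambda>u. xi_kernel u s) \<in> borel_measurable borel"
  unfolding xi_kernel_def by measurable

lemma xi_kernel_integrable: "integrable lborel (\<lambda>u. xi_kernel u s)"
proof -
  obtain n where "real n \<ge> (3 + norm s) / 2" using real_arch_simple by blast
  thus ?thesis
    by (intro Bochner_Integration.integrable_bound[OF integrable_exp_indicator[of "4 * fact n"]])
       (use xi_kernel_bound[of s "norm s" n] in \<open>auto intro!: AE_I2 order_trans[OF _ abs_ge_self]\<close>)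
qed

lemma xi_integral_holomorphic: "xi_integral holomorphic_on UNIV"
  unfolding xi_integral_def[abs_def]
proof (rule holomorphic_integral)
  show "xi_kernel u holomorphic_on UNIV" for u
    unfolding xi_kernel_def[abs_def] scaleR_conv_of_real by (intro holomorphic_intros) auto
  fix s :: complex
  obtain n where n: "real n \<ge> (3 + (norm s + 1)) / 2" using real_arch_simple by blast
  have "norm (xi_kernel u y) \<le> 4 * fact n * (indicator {0..} u * exp (- 1 * u))" if "y \<in> cball s 1" for u y
  proof (rule xi_kernel_bound[OF _ n])
    have "norm (y - s) \<le> 1" using that by (simp add: dist_norm norm_minus_commute)
    thus "norm y \<le> norm s + 1" using norm_triangle_ineq[of "y - s" s] by simp
  qed
  thus "\<exists>r>0. cball s r \<subseteq> UNIV \<and> (\<exists>g. integrable lborel g \<and> (\<forall>u\<in>space lborel. \<forall>y\<in>cball s r. norm (xi_kernel u y) \<le> g u))"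
    using integrable_exp_indicator[of "4 * fact n"]
    by (intro exI[of _ "1::real"] conjI exI[of _ "\<lambda>u. 4 * fact n * (indicator {0..} u * exp (- 1 * u))"] ballI)
       simp_all
qed auto

lemma xi_integral_bound:
  assumes "real n \<ge> (3 + norm s) / 2"
  shows "norm (xi_integral s) \<le> 4 * fact n"
proof -
  have "norm (xi_integral s) \<le> (LBINT u. 4 * fact n * (indicator {0..} u * exp (- 1 * u)))"
    unfolding xi_integral_def
    by (rule Bochner_Integration.integral_norm_bound_integral[OF xi_kernel_integrable integrable_exp_indicator])
       (rule xi_kernel_bound[OF order_refl assms])
  also have "\<dots> = 4 * fact n"
    by (simp only: integral_exp_indicator)
  finally show ?thesis .
qed

lemma xi_entire_holomorphic: "xi_entire holomorphic_on UNIV"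
  unfolding xi_entire_def[abs_def] by (intro holomorphic_intros xi_integral_holomorphic) auto

lemma xi_entire_reflect: "xi_entire (1 - s) = xi_entire s"
proof -
  have "xi_integral (1 - s) = xi_integral s"
    unfolding xi_integral_def xi_kernel_def by (simp add: add.commute)
  thus ?thesis by (simp add: xi_entire_def algebra_simps)
qed

lemma xi_entire_1 [simp]: "xi_entire 1 = 1 / 2"
  by (simp add: xi_entire_def)

text \<open>At s = 1/2 the definition reads 1/2 - I/8 with I the integral, so only I = 4 has to be
  excluded. From pi exp u >= 3 (1 + u) the kernel is at most 4 exp(-3 - u), which gives |I| <= 4
  exp(-3).\<close>

lemma xi_entire_half: "xi_entire (1 / 2) \<noteq> 0"
proof -
  have "norm (xi_integral (1 / 2)) \<le> (LBINT u. 4 * exp (- 3) * (indicator {0..} u * exp (- 1 * u)))"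
    unfolding xi_integral_def
  proof (rule Bochner_Integration.integral_norm_bound_integral[OF xi_kernel_integrable integrable_exp_indicator])
    fix u :: real
    show "norm (xi_kernel u (1 / 2)) \<le> 4 * exp (- 3) * (indicator {0..} u * exp (- 1 * u))"
    proof (cases "u \<ge> 0")
      case True
      have "xi_kernel u (1 / 2) = of_real (omega (exp u) * (2 * exp (u / 4)))"
        using True by (simp add: xi_kernel_def exp_of_real[symmetric])
      hence "norm (xi_kernel u (1 / 2)) = omega (exp u) * (2 * exp (u / 4))"
        using omega_nonneg[of "exp u"] by (simp add: norm_mult del: of_real_mult)
      also have "\<dots> \<le> (2 * exp (- pi * exp u)) * (2 * exp (u / 4))"
        using True by (intro mult_right_mono omega_le) auto
      also have "\<dots> = 4 * exp (- pi * exp u + u / 4)" unfolding exp_add by simp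
      also have "- pi * exp u + u / 4 \<le> - 3 + - 1 * u"
      proof -
        have "pi * exp u \<ge> 3 * (1 + u)"
          using pi_gt3 exp_ge_add_one_self[of u] True by (intro mult_mono) auto
        thus ?thesis using True by simp
      qed
      finally show ?thesis using True unfolding exp_add by simp
    qed (simp add: xi_kernel_def)
  qed
  also have "\<dots> = 4 * exp (- 3)"
    by (simp only: integral_exp_indicator)

  also have "\<dots> < 4" by simp
  finally have "norm (xi_integral (1 / 2)) < 4" .
  hence "xi_integral (1 / 2) \<noteq> 4" by auto
  thus ?thesis by (simp add: xi_entire_def field_simps)
qed

text \<open>The constant is 43 = 9 + 2 + 32: the numerical factor 9 is at most exp 9, R^2 <=
  exp(2R), and n! <= n^n with n <= 4R is at most exp(32 R^(5/4)), using ln(4R) <= 4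
  (4R)^(1/4).\<close>

lemma xi_entire_growth:
  fixes z :: complex
  assumes R: "R \<ge> 1" and z: "norm z \<le> R"
  shows "norm (xi_entire (1 / 2 - \<i> * z)) \<le> exp (43 * R powr (5/4))"
proof -
  let ?s = "1 / 2 - \<i> * z"
  define n where "n = nat \<lceil>R\<rceil> + 2"
  have n: "real n \<ge> R + 2" "real n \<le> 4 * R" using R by (auto simp: n_def; linarith)+
  have s: "norm ?s \<le> 2 * R" "norm (?s - 1) \<le> 2 * R"
    using norm_triangle_ineq4[of "1/2" "\<i> * z"] norm_triangle_ineq4[of "-1/2" "\<i> * z"] z R
    by (auto simp: norm_mult)
  have s': "norm ?s \<le> 1 / 2 + R" using norm_triangle_ineq4[of "1/2" "\<i> * z"] z by (simp add: norm_mult)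
  have nn: "real n \<ge> (3 + norm ?s) / 2" using n(1) s' R by simp
  have "norm (xi_entire ?s) \<le> 1 / 2 + norm ?s * norm (?s - 1) / 2 * norm (xi_integral ?s)"
    unfolding xi_entire_def
    by (rule order_trans[OF norm_triangle_ineq]) (simp add: norm_mult norm_divide)
  also have "\<dots> \<le> 1 / 2 + (2 * R) * (2 * R) / 2 * (4 * fact n)"
    using s R by (intro add_left_mono mult_mono divide_right_mono xi_integral_bound nn) auto
  also have "\<dots> = 1 / 2 + 8 * R ^ 2 * fact n" by (simp add: power2_eq_square)
  also have "\<dots> \<le> 9 * (R ^ 2 * fact n)"
  proof -
    have "1 * 1 \<le> R ^ 2 * (fact n :: real)" using R by (intro mult_mono) auto
    hence "1 / 2 \<le> R ^ 2 * (fact n :: real)" by linarith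
    thus ?thesis by linarith
  qed
  also have "\<dots> \<le> exp 9 * (exp (2 * R) * exp (32 * R powr (5/4)))"
  proof (intro mult_mono)
    show "(9::real) \<le> exp 9" using exp_ge_add_one_self[of 9] by linarith
    have "R \<le> exp R" using exp_ge_add_one_self[of R] by linarith
    hence "R ^ 2 \<le> exp R ^ 2" using R by (intro power_mono) auto
    thus "R ^ 2 \<le> exp (2 * R)" by (simp add: exp_double)
    have "fact n \<le> real n ^ n" using fact_le_power[of n] by simp
    also have "\<dots> = exp (n * ln n)" using n R by (simp add: exp_of_nat_mult)
    also have "n * ln n \<le> (4 * R) * (4 * (4 * R) powr (1/4))"
    proof (intro mult_mono)
      have "ln (real n) \<le> ln (4 * R)" using n R by simp
      also have "\<dots> \<le> (4 * R) powr (1/4) / (1/4)" using R by (intro ln_powr_bound) auto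
      finally show "ln (real n) \<le> 4 * (4 * R) powr (1/4)" by simp
    qed (use n R in auto)
    also have "(4 * R) * (4 * (4 * R) powr (1/4)) = 16 * 4 powr (1/4) * R powr (5/4)"
    proof -
      have "R * R powr (1/4) = R powr (1 + 1/4)" using R by (subst powr_add) auto
      thus ?thesis using R by (simp add: powr_mult)
    qed
    also have "\<dots> \<le> 16 * 2 * R powr (5/4)"
    proof (intro mult_right_mono mult_left_mono)
      have "(4::real) powr (1/4) \<le> 4 powr (1/2)" by (intro powr_mono) auto
      thus "(4::real) powr (1/4) \<le> 2" by (simp add: powr_half_sqrt)
    qed auto
    finally show "fact n \<le> exp (32 * R powr (5/4))" by simp
  qed auto
  also have "\<dots> = exp (9 + 2 * R + 32 * R powr (5/4))" by (simp add: exp_add)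
  also have "\<dots> \<le> exp (43 * R powr (5/4))"
  proof -
    have "R powr (5/4) \<ge> R powr 1" using R by (intro powr_mono) auto
    thus ?thesis using R by simp
  qed
  finally show ?thesis .
qed

section \<open>The Mellin transform of omega and the classical product for Re s > 1\<close>

lemma of_real_powr_eq:
  assumes "(x::real) > 0"
  shows "of_real x powr (z::complex) = exp (z * of_real (ln x))"
  using assms by (simp add: powr_def Ln_of_real)

lemma norm_inverse_nat_powr:
  "norm (1 / of_nat (Suc n) powr (s::complex)) = real (Suc n) powr (- Re s)"
proof -
  have "norm (of_real (real (Suc n)) powr s) = real (Suc n) powr Re s"
    by (subst norm_powr_real_powr) auto
  thus ?thesis by (simp add: norm_divide powr_minus_divide del: of_nat_Suc)
qed

lemma summable_Suc_powr: "s > 1 \<Longrightarrow> summable (\<lambda>n. real (Suc n) powr (- s))"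
  using summable_real_powr_iff[of "- s"] summable_Suc_iff[of "\<lambda>n. real n powr (- s)"] by simp

lemma summable_zeta: "Re s > 1 \<Longrightarrow> summable (\<lambda>n. 1 / of_nat (Suc n) powr s)"
  by (rule summable_norm_cancel) (simp only: norm_inverse_nat_powr summable_Suc_powr)

text \<open>Term n of omega contributes a Gamma integral with a = pi (n+1)^2, hence the factor
  pi^(-s/2) (n+1)^(-s). Sum and integral may be exchanged because the integrals of the absolute
  values are the same expressions at Re s and add up for Re s > 1.\<close>

lemma Mellin_omega:
  fixes s :: complex
  assumes s: "Re s > 1"
  shows "integrable lborel (\<lambda>u. of_real (omega (exp u)) * exp (s / 2 * of_real u))"
    and "(LBINT u. of_real (omega (exp u)) * exp (s / 2 * of_real u))
           = of_real pi powr (- s / 2) * Gamma (s / 2) * (\<Sum>n. 1 / of_nat (Suc n) powr s)"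
proof -
  define a where "a n = pi * real (Suc n) ^ 2" for n
  have a: "a n > 0" for n by (simp add: a_def)
  define f where "f n u = exp (s / 2 * of_real u) * of_real (exp (- a n * exp u))" for n u
  have s2: "Re (s / 2) > 0" "Re (of_real (Re s / 2) :: complex) > 0" using s by auto
  have int: "integrable lborel (f n)" for n
    unfolding f_def by (rule Gamma_integral_exp(1)[OF s2(1) a])
  have a_powr: "of_real (a n) powr (- (s / 2)) = of_real pi powr (- s / 2) * (1 / of_nat (Suc n) powr s)" for n
  proof -
    have "ln (a n) = ln pi + 2 * ln (real (Suc n))"
      by (simp add: a_def ln_mult ln_realpow del: of_nat_Suc)
    hence "of_real (a n) powr (- (s / 2)) = exp (- s / 2 * of_real (ln pi)) * exp (- s * of_real (ln (real (Suc n))))"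
      unfolding of_real_powr_eq[OF a] by (simp add: exp_add[symmetric] algebra_simps)
    also have "exp (- s * of_real (ln (real (Suc n)))) = 1 / of_real (real (Suc n)) powr s"
      by (subst of_real_powr_eq) (auto simp: exp_minus field_simps)
    finally show ?thesis by (simp add: of_real_powr_eq)
  qed
  have "norm (f n u) = exp (Re s / 2 * u) * exp (- a n * exp u)" for n u
    by (simp add: f_def norm_mult)
  hence norm_f: "complex_of_real (norm (f n u)) = exp (of_real (Re s / 2) * of_real u) * of_real (exp (- a n * exp u))" for n u
    by (simp add: exp_of_real[symmetric])
  \<comment> \<open>The absolute value of the integrand is the integrand at the real point Re s, so
    the complex Gamma integral also evaluates its integral.\<close>
  have norm_int: "(LBINT u. norm (f n u)) = a n powr (- (Re s / 2)) * Gamma (Re s / 2)" for n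
  proof -
    have "complex_of_real (LBINT u. norm (f n u)) = (CLBINT u. of_real (norm (f n u)))" by simp
    also have "\<dots> = of_real (a n) powr (- of_real (Re s / 2)) * Gamma (of_real (Re s / 2))"
      unfolding norm_f by (rule Gamma_integral_exp(2)[OF s2(2) a])
    also have "\<dots> = of_real (a n powr (- (Re s / 2)) * Gamma (Re s / 2))"
      using a[of n] by (simp add: powr_of_real[symmetric] Gamma_complex_of_real del: of_real_divide)
    finally show ?thesis by (simp only: of_real_eq_iff)
  qed
  have a_powr_real: "a n powr (- (Re s / 2)) = pi powr (- (Re s / 2)) * real (Suc n) powr (- Re s)" for n
  proof -
    have "(real (Suc n) ^ 2) powr q = real (Suc n) powr (2 * q)" for q
      using powr_powr[of "real (Suc n)" 2 q] by (simp del: of_nat_Suc)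
    thus ?thesis by (simp add: a_def powr_mult del: of_nat_Suc)
  qed
  have summ_int: "summable (\<lambda>n. LBINT u. norm (f n u))"
    unfolding norm_int a_powr_real by (intro summable_mult2 summable_mult summable_Suc_powr s)
  have sums_f: "(\<lambda>n. f n u) sums (of_real (omega (exp u)) * exp (s / 2 * of_real u))" for u
  proof -
    have "(\<lambda>n. exp (- a n * exp u)) sums omega (exp u)"
      unfolding omega_def a_def using summable_omega[of "exp u"] by (simp add: summable_sums)
    from sums_mult[OF sums_of_real[OF this], of "exp (s / 2 * of_real u)"]
    show ?thesis by (simp add: f_def[abs_def] mult.commute)
  qed
  have summ_norm: "summable (\<lambda>n. norm (f n u))" for u
  proof -
    have "summable (\<lambda>n. exp (- a n * exp u))"
      unfolding a_def using summable_omega[of "exp u"] by simp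
    from summable_mult[OF this, of "norm (exp (s / 2 * of_real u))"]
    show ?thesis by (simp add: f_def norm_mult)
  qed
  have eq: "(\<Sum>n. f n u) = of_real (omega (exp u)) * exp (s / 2 * of_real u)" for u
    using sums_f by (rule sums_unique[symmetric])
  show "integrable lborel (\<lambda>u. of_real (omega (exp u)) * exp (s / 2 * of_real u))"
    using integrable_suminf[of lborel f, OF int _ summ_int] summ_norm unfolding eq by simp
  have "(LBINT u. of_real (omega (exp u)) * exp (s / 2 * of_real u)) = (\<Sum>n. LBINT u. f n u)"
    using integral_suminf[of lborel f, OF int _ summ_int] summ_norm unfolding eq by simp
  also have "(\<lambda>n. LBINT u. f n u) = (\<lambda>n. (of_real pi powr (- s / 2) * Gamma (s / 2)) * (1 / of_nat (Suc n) powr s))"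
    unfolding f_def Gamma_integral_exp(2)[OF s2(1) a] a_powr by (simp add: mult_ac)
  also have "suminf \<dots> = of_real pi powr (- s / 2) * Gamma (s / 2) * (\<Sum>n. 1 / of_nat (Suc n) powr s)"
    by (rule suminf_mult[OF summable_zeta[OF s]])
  finally show "(LBINT u. of_real (omega (exp u)) * exp (s / 2 * of_real u))
           = of_real pi powr (- s / 2) * Gamma (s / 2) * (\<Sum>n. 1 / of_nat (Suc n) powr s)" .
qed

lemma omega_exp_minus: "omega (exp (- u)) = exp (u / 2) * omega (exp u) + (exp (u / 2) - 1) / 2"
proof -
  have "sqrt (exp u) = exp (u / 2)" by (rule real_sqrt_unique) (auto simp flip: exp_double)
  moreover have "1 / exp u = exp (- u)" by (simp add: exp_minus inverse_eq_divide)
  ultimately have "1 + 2 * omega (exp u) = (1 + 2 * omega (exp (- u))) / exp (u / 2)"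
    using omega_inverse[of "exp u"] by simp
  thus ?thesis by (simp add: field_simps)
qed

text \<open>Riemann's argument: the Mellin integral over the line is cut at u = 0, the negative half
  is reflected, and the transformation law \<open>omega_exp_minus\<close> turns it into the second
  term of the kernel plus elementary exponentials that integrate to 1 / (s (s - 1)).\<close>

theorem xi_entire_eq:
  fixes s :: complex
  assumes s: "Re s > 1"
  shows "xi_entire s = 1 / 2 * s * (s - 1) * of_real pi powr (- s / 2) * Gamma (s / 2) * (\<Sum>n. 1 / of_nat (Suc n) powr s)"
proof -
  define F where "F u = of_real (omega (exp u)) * exp (s / 2 * of_real u)" for u :: real
  have F_int: "integrable lborel F" unfolding F_def by (rule Mellin_omega(1)[OF s])
  \<comment> \<open>Twice the elementary part that the transformation law of omega leaves over after
    the reflection.\<close>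
  define E where "E u = indicator {0..} u *\<^sub>R (exp (- ((s - 1) / 2) * of_real u) - exp (- (s / 2) * of_real u))" for u :: real
  have ints: "set_integrable lborel {0..} (\<lambda>u. exp (- ((s - 1) / 2) * of_real u))"
    "set_integrable lborel {0..} (\<lambda>u. exp (- (s / 2) * of_real u))"
    using s by (intro exp_integral_atLeast(1); simp)+
  have E_int: "integrable lborel E"
    using set_integral_diff(1)[OF ints] unfolding set_integrable_def E_def[abs_def] .
  have E_val: "(LBINT u. E u) = 2 / (s * (s - 1))"
  proof -
    have "(LBINT u. E u) = (LINT u:{0..}|lborel. exp (- ((s - 1) / 2) * of_real u))
        - (LINT u:{0..}|lborel. exp (- (s / 2) * of_real u))"
      unfolding set_integral_diff(2)[OF ints, symmetric] by (simp add: E_def set_lebesgue_integral_def)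
    also have "\<dots> = 1 / ((s - 1) / 2) - 1 / (s / 2)"
      using exp_integral_atLeast(2)[of "(s - 1) / 2" 0] exp_integral_atLeast(2)[of "s / 2" 0] s by simp
    also have "\<dots> = 2 / (s * (s - 1))"
    proof -
      have "s \<noteq> 0" "s \<noteq> 1" using s by auto
      thus ?thesis by (simp add: field_simps)
    qed
    finally show ?thesis .
  qed
  have int1: "integrable lborel (\<lambda>u. indicator {0..} u *\<^sub>R F u)"
    and int2: "integrable lborel (\<lambda>u. indicator {..<0} u *\<^sub>R F u)"
    using F_int by (auto intro!: integrable_mult_indicator)
  have "(LBINT u. F u) = (LBINT u. indicator {0..} u *\<^sub>R F u + indicator {..<0} u *\<^sub>R F u)"
    by (intro Bochner_Integration.integral_cong) (auto simp: indicator_def)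
  also have "\<dots> = (LBINT u. indicator {0..} u *\<^sub>R F u) + (LBINT u. indicator {..<0} u *\<^sub>R F u)"
    by (rule Bochner_Integration.integral_add[OF int1 int2])
  also have "(LBINT u. indicator {..<0} u *\<^sub>R F u) = (LBINT u. indicator {..<0} (- u) *\<^sub>R F (- u))"
    using lborel_integral_real_affine[of "- 1" "\<lambda>u. indicator {..<0} u *\<^sub>R F u" 0] by simp
  also have "\<dots> = (LBINT u. indicator {0..} u *\<^sub>R F (- u))"
  proof (rule integral_cong_AE)
    show "AE u in lborel. indicator {..<0} (- u) *\<^sub>R F (- u) = indicator {0..} u *\<^sub>R F (- u)"
      using AE_lborel_singleton[of "0::real"] by eventually_elim (auto simp: indicator_def)
  qed (auto simp: F_def)
  also have "(LBINT u. indicator {0..} u *\<^sub>R F u) + (LBINT u. indicator {0..} u *\<^sub>R F (- u))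
      = (LBINT u. indicator {0..} u *\<^sub>R F u + indicator {0..} u *\<^sub>R F (- u))"
  proof (rule Bochner_Integration.integral_add[OF int1, symmetric])
    have "integrable lborel (\<lambda>u. F (- u))"
      using lborel_integrable_real_affine[OF F_int, of "- 1" 0] by simp
    thus "integrable lborel (\<lambda>u. indicator {0..} u *\<^sub>R F (- u))" by (auto intro!: integrable_mult_indicator)
  qed
  also have "\<dots> = (LBINT u. xi_kernel u s + 1 / 2 * E u)"
  proof (intro Bochner_Integration.integral_cong refl)
    fix u :: real
    have "F (- u) = of_real (omega (exp u)) * exp ((1 - s) / 2 * of_real u)
        + (exp (- ((s - 1) / 2) * of_real u) - exp (- (s / 2) * of_real u)) / 2"
    proof -
      have e: "- ((s - 1) / 2) = (1 - s) / 2" by (simp add: field_simps)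
      have "F (- u) = (exp (of_real u / 2) * of_real (omega (exp u)) + (exp (of_real u / 2) - 1) / 2) * exp (- (s / 2) * of_real u)"
        by (simp add: F_def omega_exp_minus exp_of_real[symmetric])
      also have "\<dots> = of_real (omega (exp u)) * (exp (of_real u / 2) * exp (- (s / 2) * of_real u))
          + ((exp (of_real u / 2) * exp (- (s / 2) * of_real u)) - exp (- (s / 2) * of_real u)) / 2"
        by (simp add: algebra_simps diff_divide_distrib)
      also have "exp (of_real u / 2) * exp (- (s / 2) * of_real u) = exp ((1 - s) / 2 * of_real u)"
        by (simp add: exp_add[symmetric] field_simps)
      also have "exp ((1 - s) / 2 * of_real u) = exp (- ((s - 1) / 2) * of_real u)"
        unfolding e ..
      finally have "F (- u) = of_real (omega (exp u)) * exp (- ((s - 1) / 2) * of_real u)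
          + (exp (- ((s - 1) / 2) * of_real u) - exp (- (s / 2) * of_real u)) / 2" .
      thus ?thesis by (simp only: e)
    qed
    thus "indicator {0..} u *\<^sub>R F u + indicator {0..} u *\<^sub>R F (- u) = xi_kernel u s + 1 / 2 * E u"
      unfolding xi_kernel_def E_def by (cases "u \<ge> 0") (simp_all add: F_def[of u] distrib_left)
  qed
  also have "\<dots> = xi_integral s + 1 / 2 * (LBINT u. E u)"
    using xi_kernel_integrable E_int by (subst Bochner_Integration.integral_add) (auto simp: xi_integral_def)
  also have "\<dots> = xi_integral s + 1 / (s * (s - 1))" by (simp add: E_val)
  finally have "of_real pi powr (- s / 2) * Gamma (s / 2) * (\<Sum>n. 1 / of_nat (Suc n) powr s) = xi_integral s + 1 / (s * (s - 1))"
    unfolding F_def Mellin_omega(2)[OF s] .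
  moreover have "1 / 2 * s * (s - 1) * (xi_integral s + 1 / (s * (s - 1))) = xi_entire s"
  proof -
    have "s \<noteq> 0" "s \<noteq> 1" using s by auto
    thus ?thesis by (simp add: xi_entire_def field_simps)
  qed
  ultimately show ?thesis by (metis mult.assoc)
qed

section \<open>Zeta and its logarithmic derivative\<close>

lemma powr_of_nat_Suc_has_derivative:
  "((\<lambda>s. c / of_nat (Suc n) powr s) has_field_derivative
     - of_real (ln (real (Suc n))) * c / of_nat (Suc n) powr s) (at (s::complex) within A)"
proof -
  have eq: "c / of_nat (Suc n) powr s = c * exp (- s * of_real (ln (real (Suc n))))" for s :: complex
    using of_real_powr_eq[of "real (Suc n)" s] by (simp add: exp_minus divide_inverse del: of_nat_Suc)
  have "((\<lambda>s. c * exp (- s * of_real (ln (real (Suc n))))) has_field_derivative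
      - of_real (ln (real (Suc n))) * (c * exp (- s * of_real (ln (real (Suc n)))))) (at s within A)"
    by (auto intro!: derivative_eq_intros simp del: of_nat_Suc)
  thus ?thesis unfolding eq[symmetric] by simp
qed

text \<open>Termwise differentiation is justified by ln n <= n^\<epsilon> / \<epsilon> with
  \<epsilon> = (\<sigma> - 1)/2: the derived series is dominated by the original one at a smaller
  exponent still above 1. Used for the series of both zeta and Lambda.\<close>

lemma Dirichlet_series_deriv:
  fixes a :: "nat \<Rightarrow> complex"
  assumes summ: "\<And>\<sigma>. \<sigma> > 1 \<Longrightarrow> summable (\<lambda>n. norm (a n) * real (Suc n) powr (- \<sigma>))" and s: "Re s > 1"
  shows "((\<lambda>s. \<Sum>n. a n / of_nat (Suc n) powr s) has_field_derivative
           (\<Sum>n. - of_real (ln (real (Suc n))) * a n / of_nat (Suc n) powr s)) (at s)"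
    and "summable (\<lambda>n. norm (- of_real (ln (real (Suc n))) * a n / of_nat (Suc n) powr s))"
proof -
  have norm_eq: "norm (b / of_nat (Suc n) powr z) = norm b * real (Suc n) powr (- Re z)" for b z n
    using norm_inverse_nat_powr[of n z] by (simp add: norm_divide norm_inverse field_simps del: of_nat_Suc)
  have bound: "summable (\<lambda>n. norm (a n) * ln (real (Suc n)) * real (Suc n) powr (- \<sigma>))" if \<sigma>: "\<sigma> > 1" for \<sigma>
  proof -
    define \<epsilon> where "\<epsilon> = (\<sigma> - 1) / 2"
    have \<epsilon>: "\<epsilon> > 0" "\<sigma> - \<epsilon> > 1" using \<sigma> by (auto simp: \<epsilon>_def field_simps)
    show ?thesis
    proof (rule summable_comparison_test')
      show "summable (\<lambda>n. 1 / \<epsilon> * (norm (a n) * real (Suc n) powr (- (\<sigma> - \<epsilon>))))"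
        by (intro summable_mult summ \<epsilon>)
      fix n :: nat
      have "ln (real (Suc n)) * real (Suc n) powr (- \<sigma>) \<le> (real (Suc n) powr \<epsilon> / \<epsilon>) * real (Suc n) powr (- \<sigma>)"
        using \<epsilon> by (intro mult_right_mono ln_powr_bound) auto
      also have "\<dots> = 1 / \<epsilon> * real (Suc n) powr (- (\<sigma> - \<epsilon>))"
        by (simp add: powr_add[symmetric] del: of_nat_Suc)
      finally have "norm (a n) * (ln (real (Suc n)) * real (Suc n) powr (- \<sigma>)) \<le> norm (a n) * (1 / \<epsilon> * real (Suc n) powr (- (\<sigma> - \<epsilon>)))"
        by (intro mult_left_mono) auto
      thus "norm (norm (a n) * ln (real (Suc n)) * real (Suc n) powr (- \<sigma>)) \<le> 1 / \<epsilon> * (norm (a n) * real (Suc n) powr (- (\<sigma> - \<epsilon>)))"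
        by (simp add: mult_ac del: of_nat_Suc)
    qed
  qed
  have norm_eq': "norm (- of_real (ln (real (Suc n))) * a n / of_nat (Suc n) powr z)
      = norm (a n) * ln (real (Suc n)) * real (Suc n) powr (- Re z)" for n z
    unfolding norm_eq by (simp add: norm_mult del: of_nat_Suc)
  show "summable (\<lambda>n. norm (- of_real (ln (real (Suc n))) * a n / of_nat (Suc n) powr s))"
    unfolding norm_eq' by (rule bound[OF s])
  define \<sigma> where "\<sigma> = (1 + Re s) / 2"
  have \<sigma>: "\<sigma> > 1" "\<sigma> < Re s" using s by (auto simp: \<sigma>_def)
  let ?S = "{z. Re z > \<sigma>}"
  show "((\<lambda>s. \<Sum>n. a n / of_nat (Suc n) powr s) has_field_derivative
           (\<Sum>n. - of_real (ln (real (Suc n))) * a n / of_nat (Suc n) powr s)) (at s)"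
  proof (rule has_field_derivative_series'(2)[of ?S])
    show "convex ?S" by (rule convex_halfspace_Re_gt)
    show "((\<lambda>s. a n / of_nat (Suc n) powr s) has_field_derivative
      - of_real (ln (real (Suc n))) * a n / of_nat (Suc n) powr z) (at z within ?S)" for n z
      by (rule powr_of_nat_Suc_has_derivative)
    show "uniformly_convergent_on ?S (\<lambda>n z. \<Sum>i<n. - of_real (ln (real (Suc i))) * a i / of_nat (Suc i) powr z)"
    proof (rule Weierstrass_m_test'[OF _ bound[OF \<sigma>(1)]])
      fix n z assume "z \<in> ?S"
      thus "norm (- of_real (ln (real (Suc n))) * a n / of_nat (Suc n) powr z)
          \<le> norm (a n) * ln (real (Suc n)) * real (Suc n) powr (- \<sigma>)"
        unfolding norm_eq' by (intro mult_left_mono powr_mono) auto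
    qed
    show "summable (\<lambda>n. a n / of_nat (Suc n) powr s)"
      by (rule summable_norm_cancel) (simp only: norm_eq summ[OF s])
    show "s \<in> ?S" using \<sigma> by simp
    show "s \<in> interior ?S" using \<sigma> by (subst interior_open) (auto intro: open_halfspace_Re_gt)
  qed
qed

definition zeta_series :: "complex \<Rightarrow> complex" where
  "zeta_series s = (\<Sum>n. 1 / of_nat (Suc n) powr s)"

definition mangoldt_series :: "complex \<Rightarrow> complex" where
  "mangoldt_series s = (\<Sum>n. mangoldt (Suc n) / of_nat (Suc n) powr s)"

text \<open>Lambda(n) <= ln n, and the series of ln n / n^\<sigma> converges absolutely as the
  derived series of zeta.\<close>

lemma summable_mangoldt:
  assumes "\<sigma> > 1"
  shows "summable (\<lambda>n. norm (mangoldt (Suc n) :: complex) * real (Suc n) powr (- \<sigma>))"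
proof -
  have "summable (\<lambda>n. norm (- complex_of_real (ln (real (Suc n))) * 1 / of_nat (Suc n) powr of_real \<sigma>))"
    by (rule Dirichlet_series_deriv(2)) (use assms summable_Suc_powr in auto)
  hence "summable (\<lambda>n. ln (real (Suc n)) * real (Suc n) powr (- \<sigma>))"
    using norm_inverse_nat_powr[of _ "of_real \<sigma>"]
    by (simp add: norm_divide norm_mult norm_inverse divide_inverse del: of_nat_Suc)
  thus ?thesis
  proof (rule summable_comparison_test')
    fix n :: nat
    show "norm (norm (mangoldt (Suc n) :: complex) * real (Suc n) powr (- \<sigma>)) \<le> ln (real (Suc n)) * real (Suc n) powr (- \<sigma>)"
      using mangoldt_le[of "Suc n"] by (auto intro!: mult_right_mono simp: abs_mult simp del: of_nat_Suc)
  qed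
qed

lemma zeta_series_deriv:
  "Re s > 1 \<Longrightarrow> (zeta_series has_field_derivative (\<Sum>n. - of_real (ln (real (Suc n))) / of_nat (Suc n) powr s)) (at s)"
  unfolding zeta_series_def[abs_def] using Dirichlet_series_deriv(1)[of "\<lambda>_. 1" s] summable_Suc_powr by simp

lemma mangoldt_series_deriv:
  assumes "Re s > 1" shows "\<exists>D. (mangoldt_series has_field_derivative D) (at s)"
  unfolding mangoldt_series_def[abs_def]
  using Dirichlet_series_deriv(1)[of "\<lambda>n. mangoldt (Suc n)" s, OF summable_mangoldt assms] by blast

lemma has_sum_Suc_iff:
  "((\<lambda>n. f (Suc n)) has_sum S) UNIV \<longleftrightarrow> (f has_sum S) {0<..}"
proof (rule has_sum_reindex_bij_betw)
  show "bij_betw Suc UNIV {0<..}"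
    by (rule bij_betwI[of _ _ _ "\<lambda>n. n - 1"]) auto
qed

text \<open>The Dirichlet convolution of Lambda with the constant 1 is ln. The product of the two
  series is an absolutely summable double sum over (d, e), regrouped by n = d e. The right-hand side
  is minus the derived series of zeta, so this is the formula for -zeta'/zeta in product
  form.\<close>

theorem zeta_mangoldt_convolution:
  assumes s: "Re s > 1"
  shows "zeta_series s * mangoldt_series s = - (\<Sum>n. - of_real (ln (real (Suc n))) / of_nat (Suc n) powr s)"
proof -
  define t where "t n = 1 / of_nat n powr s" for n :: nat
  have t_mult: "t d * t e = t (d * e)" if "d > 0" "e > 0" for d e
    using that of_real_powr_eq[of "real d" s] of_real_powr_eq[of "real e" s] of_real_powr_eq[of "real (d * e)" s]
    by (simp add: t_def ln_mult exp_add distrib_left)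
  have t_norm: "norm (t (Suc n)) = real (Suc n) powr (- Re s)" for n
    unfolding t_def by (rule norm_inverse_nat_powr)
  let ?P = "{0<..} :: nat set"
  have Z_abs: "summable (\<lambda>n. norm (t (Suc n)))" unfolding t_norm by (rule summable_Suc_powr[OF s])
  have Z: "(t has_sum zeta_series s) ?P"
    unfolding has_sum_Suc_iff[symmetric]
    by (rule norm_summable_imp_has_sum[OF Z_abs])
       (use summable_zeta[OF s] in \<open>simp add: zeta_series_def t_def summable_sums del: of_nat_Suc\<close>)
  have D_abs: "summable (\<lambda>n. norm (mangoldt (Suc n) * t (Suc n)))"
    unfolding norm_mult t_norm by (rule summable_mangoldt[OF s])
  have D: "((\<lambda>n. mangoldt n * t n) has_sum mangoldt_series s) ?P"
    unfolding has_sum_Suc_iff[of "\<lambda>n. mangoldt n * t n", symmetric]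
    by (rule norm_summable_imp_has_sum[OF D_abs])
       (use summable_norm_cancel[OF D_abs] in \<open>simp add: mangoldt_series_def t_def summable_sums del: of_nat_Suc\<close>)
  have abs_has: "((\<lambda>n. norm (g n)) has_sum (\<Sum>n. norm (g (Suc n)))) ?P"
    if "summable (\<lambda>n. norm (g (Suc n)))" for g :: "nat \<Rightarrow> complex"
    unfolding has_sum_Suc_iff[of "\<lambda>n. norm (g n)", symmetric]
    using that by (intro norm_summable_imp_has_sum) (auto simp: summable_sums)
  have prod: "((\<lambda>(d, e). mangoldt d * t d * t e) has_sum (mangoldt_series s * zeta_series s)) (?P \<times> ?P)"
  proof (rule has_sum_SigmaI)
    show "((\<lambda>d. mangoldt d * t d * zeta_series s) has_sum mangoldt_series s * zeta_series s) ?P"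
      by (rule has_sum_cmult_left[OF D])
    show "((\<lambda>e. case (d, e) of (d, e) \<Rightarrow> mangoldt d * t d * t e) has_sum mangoldt d * t d * zeta_series s) ?P" for d
      using has_sum_cmult_right[OF Z, of "mangoldt d * t d"] by simp
    have "(\<lambda>x. norm (case x of (d, e) \<Rightarrow> mangoldt d * t d * t e)) summable_on (?P \<times> ?P)"
    proof (rule summable_on_SigmaI)
      show "((\<lambda>e. norm (case (d, e) of (d, e) \<Rightarrow> mangoldt d * t d * t e)) has_sum
          norm (mangoldt d * t d) * (\<Sum>n. norm (t (Suc n)))) ?P" for d
        using has_sum_cmult_right[OF abs_has[OF Z_abs], of "norm (mangoldt d * t d)"] by (simp add: norm_mult)
      show "(\<lambda>d. norm (mangoldt d * t d) * (\<Sum>n. norm (t (Suc n)))) summable_on ?P"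
        using has_sum_imp_summable[OF has_sum_cmult_left[OF abs_has[of "\<lambda>d. mangoldt d * t d", OF D_abs]]] .
    qed auto
    thus "(\<lambda>(d, e). mangoldt d * t d * t e) summable_on (?P \<times> ?P)"
      by (rule abs_summable_summable)
  qed
  \<comment> \<open>Positive n with a divisor d correspond to pairs (d, e) of positive numbers
    through n = d e.\<close>
  have "bij_betw (\<lambda>(n, d). (d, n div d)) (SIGMA n:?P. {d. d dvd n}) (?P \<times> ?P)"
    by (rule bij_betwI[of _ _ _ "\<lambda>(d, e). (d * e, d)"]) (auto intro!: Nat.gr0I)
  from has_sum_reindex_bij_betw[OF this, of "\<lambda>(d, e). mangoldt d * t d * t e"] prod
  have "((\<lambda>x. case (case x of (n, d) \<Rightarrow> (d, n div d)) of (d, e) \<Rightarrow> mangoldt d * t d * t e) has_sum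
      (mangoldt_series s * zeta_series s)) (SIGMA n:?P. {d. d dvd n})" by simp
  hence "((\<lambda>n. of_real (ln (real n)) * t n) has_sum (mangoldt_series s * zeta_series s)) ?P"
  proof (rule has_sum_SigmaD)
    fix n :: nat assume n: "n \<in> ?P"
    have "(\<Sum>d | d dvd n. mangoldt d * t d * t (n div d)) = (\<Sum>d | d dvd n. mangoldt d * t n)"
    proof (rule sum.cong)
      fix d assume "d \<in> {d. d dvd n}"
      then obtain e where e: "n = d * e" by (auto elim: dvdE)
      thus "mangoldt d * t d * t (n div d) = mangoldt d * t n"
        using n t_mult[of d e] by (auto simp: mult.assoc)
    qed simp
    also have "\<dots> = of_real (ln (real n)) * t n"
      using n by (simp add: sum_distrib_right[symmetric] mangoldt_sum)
    finally show "((\<lambda>d. case case (n, d) of (n, d) \<Rightarrow> (d, n div d) of (d, e) \<Rightarrow> mangoldt d * t d * t e) has_sum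
        of_real (ln (real n)) * t n) {d. d dvd n}"
      using has_sum_finite[of "{d. d dvd n}" "\<lambda>d. mangoldt d * t d * t (n div d)"] n
      by (simp add: finite_divisors_nat)
  qed
  hence "(\<lambda>n. of_real (ln (real (Suc n))) * t (Suc n)) sums (mangoldt_series s * zeta_series s)"
    unfolding has_sum_Suc_iff[of "\<lambda>n. of_real (ln (real n)) * t n", symmetric] by (rule has_sum_imp_sums)
  from sums_minus[OF this]
  have "(\<lambda>n. - of_real (ln (real (Suc n))) / of_nat (Suc n) powr s) sums (- (mangoldt_series s * zeta_series s))"
    by (simp add: t_def del: of_nat_Suc)
  thus ?thesis by (simp add: sums_iff mult.commute)
qed

lemma zeta_series_deriv_mangoldt:
  assumes "Re s > 1"
  shows "(zeta_series has_field_derivative - (zeta_series s * mangoldt_series s)) (at s)"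
  using zeta_series_deriv[OF assms] zeta_mangoldt_convolution[OF assms] by simp

text \<open>If E is a primitive of the series of Lambda(n) n^{-s}, then zeta exp(E) has derivative zero.\<close>

theorem zeta_series_nonzero:
  assumes s: "Re s > 1"
  shows "zeta_series s \<noteq> 0"
proof
  assume 0: "zeta_series s = 0"
  let ?S = "{z. Re z > 1}"
  have S: "convex ?S" "open ?S" by (auto intro: convex_halfspace_Re_gt open_halfspace_Re_gt)
  have "mangoldt_series holomorphic_on ?S"
    unfolding holomorphic_on_open[OF S(2)] using mangoldt_series_deriv by auto
  then obtain E where E: "\<And>z. z \<in> ?S \<Longrightarrow> (E has_field_derivative mangoldt_series z) (at z within ?S)"
    using holomorphic_convex_primitive'[OF S] by blast
  have "\<exists>c. \<forall>z\<in>?S. zeta_series z * exp (E z) = c"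
  proof (rule has_field_derivative_zero_constant[OF S(1)])
    fix z assume z: "z \<in> ?S"
    have "((\<lambda>z. zeta_series z * exp (E z)) has_field_derivative
        zeta_series z * (exp (E z) * mangoldt_series z) + - (zeta_series z * mangoldt_series z) * exp (E z)) (at z within ?S)"
    proof (rule DERIV_mult')
      show "(zeta_series has_field_derivative - (zeta_series z * mangoldt_series z)) (at z within ?S)"
        using z by (intro has_field_derivative_at_within[OF zeta_series_deriv_mangoldt]) auto
      show "((\<lambda>z. exp (E z)) has_field_derivative exp (E z) * mangoldt_series z) (at z within ?S)"
        by (rule DERIV_chain2[OF DERIV_exp E[OF z]])
    qed
    thus "((\<lambda>z. zeta_series z * exp (E z)) has_field_derivative 0) (at z within ?S)"
      by (simp add: mult_ac)
  qed
  then obtain c where c: "\<And>z. Re z > 1 \<Longrightarrow> zeta_series z * exp (E z) = c" by auto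
  \<comment> \<open>A single zero makes the constant 0 on the whole half-plane, so zeta would vanish
    at 2, against the value pi^2/6.\<close>
  have "zeta_series 2 * exp (E 2) = 0" using c[of 2] c[OF s] 0 by simp
  hence "zeta_series 2 = 0" by simp
  moreover have "zeta_series 2 = of_real (pi ^ 2 / 6)"
  proof -
    have "(\<lambda>n. complex_of_real (1 / (real n + 1) ^ 2)) sums of_real (pi ^ 2 / 6)"
      using inverse_squares_sums by (intro sums_of_real) (simp add: add.commute)
    moreover have "complex_of_real (1 / (real n + 1) ^ 2) = 1 / of_nat (Suc n) powr 2" for n
      using powr_nat[of "of_nat (Suc n) :: complex" 2] by (simp add: add.commute)
    ultimately show ?thesis unfolding zeta_series_def by (simp add: sums_iff)
  qed
  ultimately show False by (simp del: of_real_divide of_real_power)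
qed

section \<open>The continuation of zeta and the identification of xi\<close>

lemma Re_pos_not_nonpos_Ints:
  assumes "Re z > 0" shows "z \<notin> (\<int>\<^sub>\<le>\<^sub>0 :: complex set)"
proof
  assume "z \<in> \<int>\<^sub>\<le>\<^sub>0"
  hence "Re z \<le> 0" by (auto elim!: nonpos_Ints_cases)
  thus False using assms by simp
qed

text \<open>The right-hand side satisfies the conditions in the definition of zeta, and the identity
  theorem on the connected set of all s other than 1 gives uniqueness. 1/Gamma is entire, and the
  shift to s/2 + 1 absorbs the factor s, so 0 is no exceptional point. At s = 1 division by 0 yields
  the conventional value 0.\<close>

theorem zeta_eq:
  "zeta s = xi_entire s * of_real pi powr (s / 2) * rGamma (s / 2 + 1) / (s - 1)"
proof -
  define f where "f s = xi_entire s * of_real pi powr (s / 2) * rGamma (s / 2 + 1) / (s - 1)" for s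
  have pi_powr: "of_real pi powr z = exp (z * of_real (ln pi))" for z :: complex
    by (rule of_real_powr_eq) simp
  have hol: "f holomorphic_on (- {1})"
    unfolding f_def[abs_def] pi_powr
    by (intro holomorphic_intros holomorphic_on_subset[OF xi_entire_holomorphic]) auto
  have ser: "f s = (\<Sum>n. 1 / of_nat (Suc n) powr s)" if s: "Re s > 1" for s
  proof -
    have nz: "s \<noteq> 0" "s \<noteq> 1" using s by auto
    have "s / 2 + 1 \<notin> \<int>\<^sub>\<le>\<^sub>0" using s by (intro Re_pos_not_nonpos_Ints) simp
    hence "rGamma (s / 2 + 1) * Gamma (s / 2 + 1) = 1" by (simp add: Gamma_def rGamma_eq_zero_iff)
    moreover have "Gamma (s / 2 + 1) = s / 2 * Gamma (s / 2)"
      using s by (intro Gamma_plus1 Re_pos_not_nonpos_Ints) simp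
    moreover have "of_real pi powr (- s / 2) * of_real pi powr (s / 2) = 1"
      by (simp add: pi_powr exp_add[symmetric])
    ultimately have *: "(s / 2 * Gamma (s / 2)) * rGamma (s / 2 + 1) * (of_real pi powr (- s / 2) * of_real pi powr (s / 2)) = 1"
      by (simp add: mult.commute)
    have "f s = (\<Sum>n. 1 / of_nat (Suc n) powr s) *
      ((s / 2 * Gamma (s / 2)) * rGamma (s / 2 + 1) * (of_real pi powr (- s / 2) * of_real pi powr (s / 2)))"
    proof -
      have "s - 1 \<noteq> 0" using nz by simp
      thus ?thesis unfolding f_def xi_entire_eq[OF s] by (simp only: divide_eq_eq) (simp add: mult_ac)
    qed
    thus ?thesis unfolding * by simp
  qed
  have "zeta = f"
    unfolding zeta_def
  proof (rule the_equality)
    show "f holomorphic_on (- {1}) \<and> f 1 = 0 \<and> (\<forall>s. Re s > 1 \<longrightarrow> f s = (\<Sum>n. 1 / of_nat (Suc n) powr s))"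
      using hol ser by (auto simp: f_def)
    fix g assume g: "g holomorphic_on (- {1}) \<and> g 1 = 0 \<and> (\<forall>s. Re s > 1 \<longrightarrow> g s = (\<Sum>n. 1 / of_nat (Suc n) powr s))"
    show "g = f"
    proof
      fix z :: complex
      show "g z = f z"
      proof (cases "z = 1")
        case False
        show ?thesis
        proof (rule analytic_continuation_open[of "{s. Re s > 1}" "- {1}" g f])
          show "connected (- {1::complex})" by (rule connected_punctured_universe) simp
          show "{s. Re s > 1} \<noteq> {}" by (auto intro!: exI[of _ 2])
        qed (use g hol ser False in \<open>auto intro: open_halfspace_Re_gt\<close>)
      qed (use g in \<open>simp add: f_def\<close>)
    qed
  qed
  thus ?thesis unfolding f_def[symmetric] by (rule fun_cong)
qed

text \<open>Near every z, with z itself left out, rGamma(s/2) (s - 1) is nonzero, and there the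
  product agrees with \<open>xi_entire\<close>. Hence the product has limit
  \<open>xi_entire z\<close> at z, and that is the value \<open>remove_sings\<close>
  assigns.\<close>

theorem xi_eq: "xi = xi_entire"
proof
  fix z :: complex
  let ?f = "\<lambda>s. 1 / 2 * s * (s - 1) * of_real pi powr (- s / 2) * Gamma (s / 2) * zeta s"
  have "\<forall>\<^sub>F s in at z. rGamma (s / 2) * (s - 1) \<noteq> 0 \<and> s \<in> UNIV"
  proof (rule non_zero_neighbour_alt)
    show "(\<lambda>s. rGamma (s / 2) * (s - 1)) holomorphic_on UNIV" by (intro holomorphic_intros) auto
    show "rGamma (2 / 2) * (2 - 1) \<noteq> (0::complex)" by simp
  qed auto
  hence "\<forall>\<^sub>F s in at z. xi_entire s = ?f s"
  proof eventually_elim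
    case (elim s)
    have "of_real pi powr (- s / 2) * of_real pi powr (s / 2) = (1::complex)"
      by (simp add: of_real_powr_eq exp_add[symmetric])
    moreover have "(s / 2) * rGamma (s / 2 + 1) * Gamma (s / 2) = 1"
      using elim by (simp add: rGamma_plus1 Gamma_def)
    ultimately have "xi_entire s = xi_entire s * ((s - 1) / (s - 1)) *
        (of_real pi powr (- s / 2) * of_real pi powr (s / 2)) * ((s / 2) * rGamma (s / 2 + 1) * Gamma (s / 2))"
      using elim by simp
    also have "\<dots> = ?f s" by (simp add: zeta_eq mult_ac)
    finally show ?case .
  qed
  moreover have "xi_entire \<midarrow>z\<rightarrow> xi_entire z"
    using xi_entire_holomorphic
    by (intro isContD) (auto simp: holomorphic_on_open dest!: DERIV_isCont)
  ultimately have "?f \<midarrow>z\<rightarrow> xi_entire z" by (rule Lim_transform_eventually[rotated])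
  thus "xi z = xi_entire z" unfolding xi_def by (rule remove_sings_eqI)
qed

lemma xi_eq_zeta_series:
  "Re s > 1 \<Longrightarrow> xi_entire s = 1 / 2 * s * (s - 1) * exp (- s / 2 * of_real (ln pi)) * Gamma (s / 2) * zeta_series s"
  using xi_entire_eq[of s] by (simp add: zeta_series_def of_real_powr_eq)


lemma xi_entire_nonzero:
  assumes s: "Re s > 1" shows "xi_entire s \<noteq> 0"
proof -
  have "Gamma (s / 2) \<noteq> 0" using Re_pos_not_nonpos_Ints[of "s / 2"] s by (simp add: Gamma_eq_zero_iff)
  moreover have "s \<noteq> 0" "s \<noteq> 1" using s by auto
  ultimately show ?thesis using zeta_series_nonzero[OF s] by (simp add: xi_eq_zeta_series[OF s])
qed

lemma xi_entire_zero_strip: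
  assumes "xi_entire s = 0" shows "0 \<le> Re s" "Re s \<le> 1"
proof -
  show "Re s \<le> 1" using xi_entire_nonzero[of s] assms by fastforce
  have "xi_entire (1 - s) = 0" using assms by (simp add: xi_entire_reflect)
  thus "0 \<le> Re s" using xi_entire_nonzero[of "1 - s"] by fastforce
qed

theorem xi_log_deriv:
  assumes s: "Re s > 1"
  shows "deriv xi_entire s / xi_entire s =
    1 / s + 1 / (s - 1) - of_real (ln pi) / 2 + Digamma (s / 2) / 2 - mangoldt_series s"
proof -
  have nz: "s \<noteq> 0" "s - 1 \<noteq> 0" using s by auto
  let ?L = "of_real (ln pi) :: complex"
  let ?S = "{s. Re s > 1}"
  have G: "((\<lambda>s. Gamma (s / 2)) has_field_derivative Gamma (s / 2) * Digamma (s / 2) * (1 / 2)) (at s)"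
    using Re_pos_not_nonpos_Ints[of "s / 2"] s
    by (intro DERIV_chain2[OF has_field_derivative_Gamma]) (auto intro!: derivative_eq_intros)
  have nonpole: "s / 2 \<notin> \<int>\<^sub>\<le>\<^sub>0" using s by (intro Re_pos_not_nonpos_Ints) simp
  have "((\<lambda>s. 1 / 2 * s * (s - 1) * exp (- s / 2 * ?L) * Gamma (s / 2) * zeta_series s) has_field_derivative
      (1 / 2 * s * (s - 1) * exp (- s / 2 * ?L) * Gamma (s / 2) * zeta_series s) *
      (1 / s + 1 / (s - 1) - ?L / 2 + Digamma (s / 2) / 2 - mangoldt_series s)) (at s)"
    using nz nonpole by (auto intro!: derivative_eq_intros zeta_series_deriv_mangoldt[OF s] simp: field_simps)
  hence "(xi_entire has_field_derivative xi_entire s *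
      (1 / s + 1 / (s - 1) - ?L / 2 + Digamma (s / 2) / 2 - mangoldt_series s)) (at s)"
    unfolding xi_eq_zeta_series[OF s, symmetric]
    by (rule has_field_derivative_transform_within_open[of _ _ _ ?S])
       (use s in \<open>auto simp: xi_eq_zeta_series intro: open_halfspace_Re_gt\<close>)
  thus ?thesis using xi_entire_nonzero[OF s] by (simp add: DERIV_imp_deriv)
qed

section \<open>The zero-free region\<close>

lemma (in even_entire) mult_pos: "f a = 0 \<Longrightarrow> mult a > 0"
  using zorder_exist_zero[OF holo open_UNIV connected_UNIV UNIV_I, of a] f0
  by (auto simp: mult_def)

lemma xi_line_eq: "xi_line z = xi_entire (1 / 2 - \<i> * z)"
  by (simp add: xi_line_def xi_eq)

interpretation xi: even_entire xi_line 43
proof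
  show "xi_line holomorphic_on UNIV"
    unfolding xi_line_eq[abs_def]
    by (rule holomorphic_on_compose_gen[OF _ xi_entire_holomorphic, unfolded o_def])
       (auto intro!: holomorphic_intros)
  show "xi_line 0 \<noteq> 0" using xi_entire_half by (simp add: xi_line_eq)
  show "xi_line (- z) = xi_line z" for z
    using xi_entire_reflect[of "1 / 2 - \<i> * z"] by (simp add: xi_line_eq add.commute)
  show "norm (xi_line z) \<le> exp (43 * R powr (5/4))" if "R \<ge> 1" "norm z \<le> R" for R z
    using xi_entire_growth[OF that] by (simp add: xi_line_eq)
qed simp

lemma deriv_xi_line: "deriv xi_line z = - \<i> * deriv xi_entire (1 / 2 - \<i> * z)"
proof (rule DERIV_imp_deriv)
  have "(xi_entire has_field_derivative deriv xi_entire (1 / 2 - \<i> * z)) (at (1 / 2 - \<i> * z))"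
    by (rule holomorphic_derivI[OF xi_entire_holomorphic]) auto
  hence "((\<lambda>z. xi_entire (1 / 2 - \<i> * z)) has_field_derivative deriv xi_entire (1 / 2 - \<i> * z) * (- \<i>)) (at z)"
    by (rule DERIV_chain2) (auto intro!: derivative_eq_intros)
  thus "(xi_line has_field_derivative - \<i> * deriv xi_entire (1 / 2 - \<i> * z)) (at z)"
    by (simp add: xi_line_eq[abs_def] mult.commute)
qed

lemma xi_line_zero_Im:
  assumes "xi_line \<gamma> = 0" shows "\<bar>Im \<gamma>\<bar> \<le> 1 / 2"
  using xi_entire_zero_strip[of "1 / 2 - \<i> * \<gamma>"] assms by (auto simp: xi_line_eq)

text \<open>The rotation z = i (s - 1/2) carries the expansion of the even function to the zeros
  \<rho> = 1/2 - i \<gamma> of xi, where the terms become 1/(s - \<rho>).\<close>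

lemma xi_log_deriv_limit:
  assumes s: "xi_entire s \<noteq> 0"
  shows "(\<lambda>n. \<Sum>\<gamma>\<in>xi.zeros_upto (real n). xi.mult \<gamma> / (s - (1 / 2 - \<i> * \<gamma>)))
           \<longlonglongrightarrow> deriv xi_entire s / xi_entire s"
proof -
  define z where "z = \<i> * (s - 1 / 2)"
  have z: "1 / 2 - \<i> * z = s" by (simp add: z_def algebra_simps flip: mult.assoc)
  have "xi_line z \<noteq> 0" using s by (simp add: xi_line_eq z)
  from tendsto_mult_left[OF xi.log_deriv_limit[OF this], of \<i>]
  have "(\<lambda>n. \<i> * (\<Sum>\<gamma>\<in>xi.zeros_upto (real n). xi.mult \<gamma> / (z - \<gamma>))) \<longlonglongrightarrow> deriv xi_entire s / xi_entire s"
    by (simp add: deriv_xi_line xi_line_eq z flip: mult.assoc)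
  moreover have "\<i> * (xi.mult \<gamma> / (z - \<gamma>)) = xi.mult \<gamma> / (s - (1 / 2 - \<i> * \<gamma>))" for \<gamma>
  proof -
    have "z - \<gamma> = \<i> * (s - (1 / 2 - \<i> * \<gamma>))" by (simp add: z_def algebra_simps flip: mult.assoc)
    thus ?thesis by simp
  qed
  ultimately show ?thesis by (simp add: sum_distrib_left)
qed

text \<open>Every zero satisfies Re \<rho> <= 1 < Re s, so each term 1/(s - \<rho>) of the expansion
  has nonnegative real part; all of them, or all but a chosen one, may be dropped.\<close>

lemma Re_xi_log_deriv_ge:
  assumes s: "Re s > 1"
  shows "Re (deriv xi_entire s / xi_entire s) \<ge> 0"
    and "xi_entire \<rho> = 0 \<Longrightarrow> Re (deriv xi_entire s / xi_entire s) \<ge> Re (1 / (s - \<rho>))"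
proof -
  let ?t = "\<lambda>\<gamma>. xi.mult \<gamma> / (s - (1 / 2 - \<i> * \<gamma>))"
  have lim: "(\<lambda>n. \<Sum>\<gamma>\<in>xi.zeros_upto (real n). Re (?t \<gamma>)) \<longlonglongrightarrow> Re (deriv xi_entire s / xi_entire s)"
    using tendsto_Re[OF xi_log_deriv_limit[OF xi_entire_nonzero[OF s]]] by (simp add: Re_sum)
  have Re_inv: "Re (1 / (s - \<rho>)) \<ge> 0" if "xi_entire \<rho> = 0" for \<rho>
    using xi_entire_zero_strip(2)[OF that] s by (simp add: Re_divide)
  have tm: "Re (?t \<gamma>) \<ge> 0" if "xi_line \<gamma> = 0" for \<gamma>
  proof -
    have "Re (?t \<gamma>) = real (xi.mult \<gamma>) * Re (1 / (s - (1 / 2 - \<i> * \<gamma>)))"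
      by (simp add: Re_divide)
    thus ?thesis using Re_inv[of "1 / 2 - \<i> * \<gamma>"] that by (simp add: xi_line_eq)
  qed
  show "Re (deriv xi_entire s / xi_entire s) \<ge> 0"
    by (rule LIMSEQ_le_const[OF lim]) (auto intro!: exI[of _ 0] sum_nonneg tm simp: xi.zeros_upto_def)
  assume \<rho>: "xi_entire \<rho> = 0"
  define \<gamma>0 where "\<gamma>0 = \<i> * (\<rho> - 1 / 2)"
  have \<rho>_eq: "1 / 2 - \<i> * \<gamma>0 = \<rho>" by (simp add: \<gamma>0_def algebra_simps flip: mult.assoc)
  hence 0: "xi_line \<gamma>0 = 0" using \<rho> by (simp add: xi_line_eq)
  obtain N where N: "norm \<gamma>0 \<le> real N" using real_arch_simple by blast
  show "Re (deriv xi_entire s / xi_entire s) \<ge> Re (1 / (s - \<rho>))"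
  proof (rule LIMSEQ_le_const[OF lim], intro exI[of _ N] allI impI)
    fix n assume "n \<ge> N"
    hence mem: "\<gamma>0 \<in> xi.zeros_upto (real n)" using 0 N by (auto simp: xi.zeros_upto_def)
    have "Re (1 / (s - \<rho>)) = 1 * Re (1 / (s - \<rho>))" by simp
    also have "\<dots> \<le> real (xi.mult \<gamma>0) * Re (1 / (s - \<rho>))"
      using xi.mult_pos[OF 0] Re_inv[OF \<rho>] by (intro mult_right_mono) auto
    also have "\<dots> = Re (?t \<gamma>0)" unfolding \<rho>_eq by (simp add: Re_divide)
    also have "\<dots> \<le> (\<Sum>\<gamma>\<in>xi.zeros_upto (real n). Re (?t \<gamma>))"
      using mem by (intro member_le_sum tm xi.finite_zeros_upto) (auto simp: xi.zeros_upto_def)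
    finally show "Re (1 / (s - \<rho>)) \<le> (\<Sum>\<gamma>\<in>xi.zeros_upto (real n). Re (?t \<gamma>))" .
  qed
qed

text \<open>The series for digamma is cut at N >= |z|. The first N terms are at most the harmonic
  number, hence at most 1 + ln N; the tail has terms of size N/n^2 and is at most 2.\<close>

lemma Re_Digamma_le:
  fixes z :: complex
  assumes z: "Re z \<ge> 1 / 2" and N: "norm z \<le> real N" "N \<ge> 1"
  shows "Re (Digamma z) \<le> 3 + ln (real N)"
proof -
  define a where "a n = Re (inverse (of_nat (Suc n)) - inverse (z + of_nat n))" for n
  have "z \<noteq> 0" using z by auto
  hence summ: "summable (\<lambda>n. inverse (of_nat (Suc n)) - inverse (z + of_nat n))" by (rule summable_Digamma)
  hence a_summ: "summable a" unfolding a_def by (rule summable_Re)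
  have "Re (Digamma z) = suminf a - euler_mascheroni"
  proof -
    have "Re (euler_mascheroni :: complex) = euler_mascheroni"
      by (metis Re_complex_of_real of_real_euler_mascheroni)
    thus ?thesis unfolding Digamma_def a_def minus_complex.sel(1)[of "suminf _"] using summ by (simp add: Re_suminf)
  qed
  also have "suminf a = (\<Sum>n. a (n + N)) + sum a {..<N}" by (rule suminf_split_initial_segment[OF a_summ])
  also have "sum a {..<N} \<le> harm N"
    unfolding harm_altdef
  proof (rule sum_mono)
    fix n
    have "Re (inverse (z + of_nat n)) \<ge> 0" using z by simp
    moreover have "Re (inverse (of_nat (Suc n))) = inverse (real (Suc n))" by (metis Re_complex_of_real of_real_inverse of_real_of_nat_eq)
    ultimately show "a n \<le> inverse (real (Suc n))" unfolding a_def minus_complex.sel by linarith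
  qed
  also have "harm N \<le> 1 + ln (real N)"
  proof -
    have "harm (Suc 0) = (1::real)" by (simp add: harm_def)
    thus ?thesis using euler_mascheroni_sequence_decreasing[of 1 N] N(2) by simp
  qed
  also have "(\<Sum>n. a (n + N)) \<le> 2"
  proof -
    \<comment> \<open>With m = n + N, the estimates |z - 1| <= N + 1 and |z + m| >= (m + 2)/2 bound
      the tail term by 2 (N + 1) / ((m + 1)(m + 2)), which telescopes to a total of 2.\<close>
    let ?b = "\<lambda>n. 1 / (real (n + N) + 1) - 1 / (real (Suc n + N) + 1)"
    have b_sums: "(\<lambda>n. 2 * (real N + 1) * ?b n) sums (2 * (real N + 1) * (1 / (real (0 + N) + 1) - 0))"
    proof (rule sums_mult, rule telescope_sums')
      show "(\<lambda>n. 1 / (real (n + N) + 1)) \<longlonglongrightarrow> 0" by real_asymp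
    qed
    have "a (n + N) \<le> 2 * (real N + 1) * ?b n" for n
    proof -
      let ?m = "real (n + N)"
      have m1: "?m \<ge> 1" using N(2) by simp
      have nz: "z + of_nat (n + N) \<noteq> 0"
      proof
        assume "z + of_nat (n + N) = 0"
        hence "Re (z + of_nat (n + N)) = 0" by simp
        thus False using z by simp
      qed
      have "norm (z + of_nat (n + N)) \<ge> Re (z + of_nat (n + N))" by (rule complex_Re_le_cmod)
      hence ge: "norm (z + of_nat (n + N)) \<ge> (?m + 2) / 2" using z m1 by simp
      have nz2: "(of_nat (Suc (n + N)) :: complex) \<noteq> 0" by (simp del: of_nat_Suc)
      have "inverse (of_nat (Suc (n + N))) - inverse (z + of_nat (n + N)) = (z - 1) / (of_nat (Suc (n + N)) * (z + of_nat (n + N)))"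
        using nz nz2 by (simp add: inverse_eq_divide diff_frac_eq)
      hence "a (n + N) \<le> norm ((z - 1) / (of_nat (Suc (n + N)) * (z + of_nat (n + N))))"
        unfolding a_def by (simp only: complex_Re_le_cmod)
      also have "\<dots> = norm (z - 1) / ((?m + 1) * norm (z + of_nat (n + N)))"
      proof -
        have "norm (of_nat (Suc (n + N)) :: complex) = ?m + 1" by (simp only: norm_of_nat)
        thus ?thesis by (simp only: norm_divide norm_mult)
      qed
      also have "\<dots> \<le> (real N + 1) / ((?m + 1) * ((?m + 2) / 2))"
        using norm_triangle_ineq4[of z 1] N(1) ge m1
        by (intro frac_le mult_left_mono mult_pos_pos) auto
      also have "\<dots> = 2 * (real N + 1) * ?b n"
        using m1 by (simp add: divide_simps) (simp add: algebra_simps)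
      finally show ?thesis .
    qed
    hence "(\<Sum>n. a (n + N)) \<le> (\<Sum>n. 2 * (real N + 1) * ?b n)"
      using summable_ignore_initial_segment[OF a_summ, of N] sums_summable[OF b_sums] by (intro suminf_le) auto
    also have "\<dots> = 2 * (real N + 1) * (1 / (real (0 + N) + 1) - 0)"
      by (rule sums_unique[OF b_sums, symmetric])
    also have "\<dots> = 2" by (simp add: field_simps)
    finally show ?thesis .
  qed
  finally show ?thesis using euler_mascheroni_pos by simp
qed

text \<open>The logarithmic derivative of xi is solved for the series of Lambda. With L = ln(|t| +
  3) >= 1, the term 1/s costs at most L and half the digamma bound at most (3 + L)/2 <= 2L. The term
  xi'/xi is kept, since its sign and the contribution of one zero are what matter later.\<close>

lemma mangoldt_series_bound:
  fixes \<sigma> t :: real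
  assumes \<sigma>: "1 < \<sigma>" "\<sigma> \<le> 2"
  defines "s \<equiv> Complex \<sigma> t"
  shows "Re (mangoldt_series s) \<le> Re (1 / (s - 1)) + 4 * ln (\<bar>t\<bar> + 3) - Re (deriv xi_entire s / xi_entire s)"
proof -
  have s: "Re s > 1" "Re s = \<sigma>" "Im s = t" using \<sigma> by (auto simp: s_def)
  define N where "N = nat \<lceil>\<bar>t\<bar> + 1\<rceil>"
  have N: "real N \<ge> \<bar>t\<bar> + 1" "real N \<le> \<bar>t\<bar> + 3" "N \<ge> 1" by (auto simp: N_def; linarith)+
  have "norm s \<le> \<bar>\<sigma>\<bar> + \<bar>t\<bar>" using cmod_le[of s] s by simp
  hence "norm (s / 2) \<le> real N" using N(1) \<sigma> by simp
  hence "Re (Digamma (s / 2)) \<le> 3 + ln (real N)"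
    using \<sigma> N(3) s by (intro Re_Digamma_le) auto
  also have "ln (real N) \<le> ln (\<bar>t\<bar> + 3)" using N by simp
  finally have dig: "Re (Digamma (s / 2)) \<le> 3 + ln (\<bar>t\<bar> + 3)" by simp
  have L1: "ln (\<bar>t\<bar> + 3) \<ge> 1"
    using exp_le by (subst ln_ge_iff) auto
  have "Re (1 / s) \<le> norm (1 / s)" by (rule complex_Re_le_cmod)
  also have "\<dots> \<le> 1" using s complex_Re_le_cmod[of s] by (simp add: norm_divide divide_le_eq)
  finally have inv: "Re (1 / s) \<le> 1" .
  have pi: "ln pi \<ge> 0" using pi_ge_two by simp
  have "mangoldt_series s = 1 / s + 1 / (s - 1) - of_real (ln pi) / 2 + Digamma (s / 2) / 2 - deriv xi_entire s / xi_entire s"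
    using xi_log_deriv[OF s(1)] by simp
  hence "Re (mangoldt_series s) = Re (1 / s) + Re (1 / (s - 1)) - ln pi / 2 + Re (Digamma (s / 2)) / 2 - Re (deriv xi_entire s / xi_entire s)"
    by simp
  thus ?thesis using inv dig pi L1 by linarith
qed

text \<open>Mertens' inequality 3 + 4 cos \<theta> + cos 2\<theta> = 2 (1 + cos \<theta>)^2 >= 0,
  applied with \<theta> = t ln n to each term of the series.\<close>

lemma mangoldt_series_341:
  assumes \<sigma>: "\<sigma> > 1"
  shows "3 * Re (mangoldt_series (Complex \<sigma> 0)) + 4 * Re (mangoldt_series (Complex \<sigma> t)) + Re (mangoldt_series (Complex \<sigma> (2 * t))) \<ge> 0"
proof -
  define c where "c n = mangoldt (Suc n) * real (Suc n) powr (- \<sigma>)" for n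
  have tm: "Re (mangoldt (Suc n) / of_nat (Suc n) powr Complex \<sigma> y) = c n * cos (y * ln (real (Suc n)))" for n y
  proof -
    have "mangoldt (Suc n) / of_nat (Suc n) powr Complex \<sigma> y
        = of_real (mangoldt (Suc n)) * exp (- Complex \<sigma> y * of_real (ln (real (Suc n))))"
      using of_real_powr_eq[of "real (Suc n)" "Complex \<sigma> y"] by (simp add: exp_minus divide_inverse del: of_nat_Suc)
    thus ?thesis
      by (simp add: Re_exp c_def powr_def mult_ac del: of_nat_Suc of_real_mangoldt)
  qed
  have sums: "(\<lambda>n. c n * cos (y * ln (real (Suc n)))) sums Re (mangoldt_series (Complex \<sigma> y))" for y
  proof -
    have "summable (\<lambda>n. mangoldt (Suc n) / of_nat (Suc n) powr Complex \<sigma> y)"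
    proof (rule summable_norm_cancel)
      have "norm (mangoldt (Suc n) / of_nat (Suc n) powr Complex \<sigma> y) = norm (mangoldt (Suc n) :: complex) * real (Suc n) powr (- \<sigma>)" for n
        using norm_inverse_nat_powr[of n "Complex \<sigma> y"] by (simp add: norm_mult norm_divide norm_inverse divide_inverse del: of_nat_Suc norm_mangoldt)
      thus "summable (\<lambda>n. norm (mangoldt (Suc n) / of_nat (Suc n) powr Complex \<sigma> y))"
        using summable_mangoldt[OF \<sigma>] by (simp only:)
    qed
    from sums_Re[OF summable_sums[OF this]] show ?thesis unfolding tm mangoldt_series_def .
  qed
  have S: "(\<lambda>n. 3 * (c n * cos (0 * ln (real (Suc n)))) + 4 * (c n * cos (t * ln (real (Suc n)))) + c n * cos (2 * t * ln (real (Suc n))))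
    sums (3 * Re (mangoldt_series (Complex \<sigma> 0)) + 4 * Re (mangoldt_series (Complex \<sigma> t)) + Re (mangoldt_series (Complex \<sigma> (2 * t))))"
    by (intro sums_add sums_mult sums)
  have P: "3 * (c n * cos (0 * ln (real (Suc n)))) + 4 * (c n * cos (t * ln (real (Suc n)))) + c n * cos (2 * t * ln (real (Suc n))) \<ge> 0" for n
  proof -
    have "c n \<ge> 0" by (simp add: c_def mangoldt_nonneg)
    moreover have "3 * (c n * cos (0 * ln (real (Suc n)))) + 4 * (c n * cos (t * ln (real (Suc n)))) + c n * cos (2 * t * ln (real (Suc n)))
        = c n * (2 * (1 + cos (t * ln (real (Suc n)))) ^ 2)"
    proof -
      define \<theta> where "\<theta> = t * ln (real (Suc n))"
      have e: "cos (2 * t * ln (real (Suc n))) = 2 * cos \<theta> ^ 2 - 1"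
        using cos_double_cos[of \<theta>] by (simp add: \<theta>_def mult.assoc del: of_nat_Suc)
      show ?thesis unfolding e \<theta>_def[symmetric] by (simp add: power2_eq_square algebra_simps)
    qed
    ultimately show ?thesis by simp
  qed
  show ?thesis by (rule sums_le[OF _ sums_zero S]) (rule P)
qed

text \<open>De la Vallee Poussin's argument: in the 3-4-1 inequality at height t = Im \<rho> only
  this zero is kept, in the middle term, giving 4/(\<sigma> - \<beta>) <= 3/(\<sigma> - 1) +
  O(ln(|t| + 3)). The lower bound on |t| keeps the pole term 1/(s - 1) bounded at heights t and
  2t.\<close>

lemma zero_free_region_high:
  assumes t0: "t0 > 0"
  obtains c where "c > 0" "\<And>\<rho>. xi_entire \<rho> = 0 \<Longrightarrow> \<bar>Im \<rho>\<bar> \<ge> t0 \<Longrightarrow> Re \<rho> \<le> 1 - c / ln (\<bar>Im \<rho>\<bar> + 3)"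
proof -
  \<comment> \<open>36 = 3 * 4 + 4 * 4 + 8 collects the logarithmic terms at heights 0, t and 2t;
    5/t0 = 4/t0 + 1/t0 collects the pole terms at t and 2t.\<close>
  define B where "B = 36 + 5 / t0"
  have B: "B > 0" "B \<ge> 36" using t0 by (auto simp: B_def add_pos_pos)
  show ?thesis
  proof (rule that[of "1 / (14 * B)"])
    show "1 / (14 * B) > 0" using B by simp
    fix \<rho> assume \<rho>: "xi_entire \<rho> = 0" "\<bar>Im \<rho>\<bar> \<ge> t0"
    define t where "t = Im \<rho>"
    define \<beta> where "\<beta> = Re \<rho>"
    define L where "L = ln (\<bar>t\<bar> + 3)"
    have L1: "L \<ge> 1" unfolding L_def using exp_le by (subst ln_ge_iff) auto
    have t: "\<bar>t\<bar> \<ge> t0" "t \<noteq> 0" using \<rho>(2) t0 by (auto simp: t_def)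
    have \<beta>: "\<beta> \<le> 1" using xi_entire_zero_strip[OF \<rho>(1)] by (simp add: \<beta>_def)
    \<comment> \<open>With \<sigma> - 1 = 1/(2BL) the inequality becomes 4/(\<sigma> - \<beta>) <=
      6BL + BL, so \<sigma> - \<beta> >= 4/(7BL). Since 4/7 > 1/2, the gain is 4/7 - 1/2 = 1/14,
      whence the constant 1/(14B).\<close>
    define \<delta> where "\<delta> = 1 / (2 * B)"
    have \<delta>: "\<delta> > 0" "\<delta> \<le> 1" using B by (auto simp: \<delta>_def)
    define \<sigma> where "\<sigma> = 1 + \<delta> / L"
    have dL: "\<delta> / L > 0" "\<delta> / L \<le> 1" using \<delta> L1 by (auto simp: divide_le_eq)
    have \<sigma>: "1 < \<sigma>" "\<sigma> \<le> 2" using dL by (auto simp: \<sigma>_def)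
    have inv: "Re (1 / (Complex \<sigma> y - 1)) \<le> 1 / t0" if "\<bar>y\<bar> \<ge> t0" for y
    proof -
      have "Re (1 / (Complex \<sigma> y - 1)) \<le> norm (1 / (Complex \<sigma> y - 1))" by (rule complex_Re_le_cmod)
      also have "\<dots> \<le> 1 / t0"
        using abs_Im_le_cmod[of "Complex \<sigma> y - 1"] that t0 unfolding norm_divide
        by (intro frac_le) auto
      finally show ?thesis .
    qed
    have b0: "Re (mangoldt_series (Complex \<sigma> 0)) \<le> L / \<delta> + 4 * L"
    proof -
      have "Re (1 / (Complex \<sigma> 0 - 1)) = L / \<delta>"
        using \<delta> L1 by (simp add: Re_divide \<sigma>_def power2_eq_square field_simps)
      moreover have "ln (\<bar>0\<bar> + 3) \<le> L" unfolding L_def by simp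
      ultimately show ?thesis
        using mangoldt_series_bound[OF \<sigma>, of 0] Re_xi_log_deriv_ge(1)[of "Complex \<sigma> 0"] \<sigma> by simp
    qed
    have b1: "Re (mangoldt_series (Complex \<sigma> t)) \<le> 1 / t0 + 4 * L - 1 / (\<sigma> - \<beta>)"
    proof -
      have "Complex \<sigma> t - \<rho> = of_real (\<sigma> - \<beta>)" by (simp add: complex_eq_iff t_def \<beta>_def)
      hence "Re (1 / (Complex \<sigma> t - \<rho>)) = 1 / (\<sigma> - \<beta>)" by simp
      thus ?thesis
        using mangoldt_series_bound[OF \<sigma>, of t] Re_xi_log_deriv_ge(2)[of "Complex \<sigma> t" \<rho>, OF _ \<rho>(1)] \<sigma> inv[OF t(1)]
        by (simp add: L_def)
    qed
    have b2: "Re (mangoldt_series (Complex \<sigma> (2 * t))) \<le> 1 / t0 + 8 * L"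
    proof -
      have "\<bar>2 * t\<bar> + 3 \<le> (\<bar>t\<bar> + 3) ^ 2" by (simp add: power2_eq_square algebra_simps abs_mult)
      hence "ln (\<bar>2 * t\<bar> + 3) \<le> ln ((\<bar>t\<bar> + 3) ^ 2)" by (subst ln_le_cancel_iff) auto
      hence "ln (\<bar>2 * t\<bar> + 3) \<le> 2 * L" by (simp add: L_def ln_realpow)
      moreover have "t0 \<le> \<bar>2 * t\<bar>" using t(1) t0 by simp
      ultimately show ?thesis
        using mangoldt_series_bound[OF \<sigma>, of "2 * t"] Re_xi_log_deriv_ge(1)[of "Complex \<sigma> (2 * t)"] \<sigma> inv[of "2 * t"] t(1)
        by simp
    qed
    have "4 / (\<sigma> - \<beta>) \<le> 3 * L / \<delta> + 36 * L + 5 / t0"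
      using mangoldt_series_341[OF \<sigma>(1), of t] b0 b1 b2 by simp
    also have "\<dots> \<le> 3 * L / \<delta> + B * L"
      using L1 t0 mult_left_mono[of 1 L "5 / t0"] by (simp add: B_def distrib_right)
    also have "\<dots> = 7 * B * L" using B by (simp add: \<delta>_def field_simps)
    finally have "4 \<le> 7 * B * L * (\<sigma> - \<beta>)" using \<sigma> \<beta> by (simp add: divide_le_eq)
    hence "4 / (7 * B * L) \<le> \<sigma> - \<beta>" using B L1 by (simp add: divide_le_eq mult_ac)
    moreover have "\<sigma> = 1 + 1 / (2 * B * L)" by (simp add: \<sigma>_def \<delta>_def)
    moreover have "4 / (7 * B * L) - 1 / (2 * B * L) = 1 / (14 * B) / L"
      using B L1 by (simp add: field_simps)
    ultimately have "\<beta> \<le> 1 - 1 / (14 * B) / L" by linarith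
    thus "Re \<rho> \<le> 1 - 1 / (14 * B) / ln (\<bar>Im \<rho>\<bar> + 3)" by (simp add: \<beta>_def L_def t_def)
  qed
qed

text \<open>Low zeros are handled by xi(1) = 1/2, which gives a zero-free disc around 1. Since Re
  \<rho> = 1/2 + Im \<gamma> and |Im \<rho>| <= |\<gamma>|, the bound on Re \<rho> is one on Im
  \<gamma>; evenness supplies the bound on -Im \<gamma>.\<close>

theorem zero_free_region:
  obtains c where "c > 0" "\<And>\<gamma>. xi_line \<gamma> = 0 \<Longrightarrow> \<bar>Im \<gamma>\<bar> \<le> 1 / 2 - c / ln (norm \<gamma> + 3)"
proof -
  have "continuous (at 1) xi_entire"
    using holomorphic_on_imp_continuous_on[OF xi_entire_holomorphic] by (simp add: continuous_on_eq_continuous_at)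
  from continuous_at_avoid[OF this, of 0]
  obtain r where r: "r > 0" "\<And>y. dist 1 y < r \<Longrightarrow> xi_entire y \<noteq> 0" by auto
  obtain c1 where c1: "c1 > 0" "\<And>\<rho>. xi_entire \<rho> = 0 \<Longrightarrow> \<bar>Im \<rho>\<bar> \<ge> r / 2 \<Longrightarrow> Re \<rho> \<le> 1 - c1 / ln (\<bar>Im \<rho>\<bar> + 3)"
    using zero_free_region_high[of "r / 2"] r(1) by auto
  define c where "c = min c1 (r / 2)"
  have c: "c > 0" "c \<le> c1" "c \<le> r / 2" using c1(1) r(1) by (auto simp: c_def)
  have half: "Im \<gamma> \<le> 1 / 2 - c / ln (norm \<gamma> + 3)" if "xi_line \<gamma> = 0" for \<gamma>
  proof -
    define \<rho> where "\<rho> = 1 / 2 - \<i> * \<gamma>"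
    have \<rho>: "xi_entire \<rho> = 0" "Re \<rho> = 1 / 2 + Im \<gamma>" "Im \<rho> = - Re \<gamma>"
      using that by (auto simp: \<rho>_def xi_line_eq)
    have L1: "ln (norm \<gamma> + 3) \<ge> 1" using exp_le norm_ge_zero[of \<gamma>] by (subst ln_ge_iff) (auto simp del: norm_ge_zero)
    show ?thesis
    proof (cases "\<bar>Im \<rho>\<bar> \<ge> r / 2")
      case True
      have "1 \<le> ln (\<bar>Im \<rho>\<bar> + 3)" using exp_le by (subst ln_ge_iff) auto
      moreover have "ln (\<bar>Im \<rho>\<bar> + 3) \<le> ln (norm \<gamma> + 3)" using \<rho>(3) abs_Re_le_cmod[of \<gamma>] by simp
      ultimately have "c / ln (norm \<gamma> + 3) \<le> c1 / ln (\<bar>Im \<rho>\<bar> + 3)" using c by (intro frac_le) auto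
      thus ?thesis using c1(2)[OF \<rho>(1) True] \<rho>(2) by simp
    next
      case False
      \<comment> \<open>Outside the disc of radius r around 1 but within r/2 of the real axis,
        \<rho> must lie at least r/2 to the left of 1.\<close>
      have "dist 1 \<rho> \<ge> r" using r(2)[of \<rho>] \<rho>(1) by (cases "dist 1 \<rho> < r") auto
      moreover have "dist 1 \<rho> \<le> \<bar>1 - Re \<rho>\<bar> + \<bar>Im \<rho>\<bar>" using cmod_le[of "1 - \<rho>"] by (simp add: dist_norm)
      moreover have "Re \<rho> \<le> 1" using xi_entire_zero_strip[OF \<rho>(1)] by simp
      ultimately have "1 - Re \<rho> \<ge> r / 2" using False by linarith
      moreover have "c / ln (norm \<gamma> + 3) \<le> c" using c(1) L1 by (simp add: divide_le_eq)
      ultimately show ?thesis using \<rho>(2) c(3) by simp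
    qed
  qed
  show ?thesis
  proof (rule that[OF c(1)])
    fix \<gamma> assume "xi_line \<gamma> = 0"
    thus "\<bar>Im \<gamma>\<bar> \<le> 1 / 2 - c / ln (norm \<gamma> + 3)"
      using half[of \<gamma>] half[of "- \<gamma>"] xi.ev[of \<gamma>] by simp
  qed
qed

section \<open>Uniqueness of Laplace transforms\<close>

text \<open>Lerch's theorem with integer parameters. After multiplication by exp(-k0 t), the
  hypothesis says that u is orthogonal to all powers of exp(-t), hence to all polynomials in it;
  approximating u itself by such polynomials shows that the integral of u^2 is 0.\<close>

lemma Laplace_unique_real:
  fixes f :: "real \<Rightarrow> real"
  assumes cont: "continuous_on {0..} f" and bound: "\<And>t. t \<ge> 0 \<Longrightarrow> \<bar>f t\<bar> \<le> K * exp (b * t)"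
    and k0: "real k0 > b"
    and zero: "\<And>k. k \<ge> k0 \<Longrightarrow> (LINT t:{0..}|lborel. f t * exp (- real k * t)) = 0"
    and t: "t \<ge> 0"
  shows "f t = 0"
proof -
  let ?I = "\<lambda>t. indicator {0..} t :: real"
  have K: "K \<ge> 0" using bound[of 0] by simp
  have meas: "(\<lambda>t. ?I t * (f t * g t)) \<in> borel_measurable borel" if "continuous_on UNIV g" for g
    using borel_measurable_continuous_on_indicator[of "{0..}" "\<lambda>t. f t * g t"] cont continuous_on_subset[OF that]
    by (auto intro!: continuous_intros)
  have int0: "integrable lborel (\<lambda>t. ?I t * (f t * exp (- real k * t)))" if "k \<ge> k0" for k
  proof (rule Bochner_Integration.integrable_bound)
    have "real k - b > 0" using that k0 by linarith
    from set_integrable_exp_real[OF this, of 0]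
    show "integrable lborel (\<lambda>t. K * (?I t * exp (- (real k - b) * t)))"
      by (auto simp: set_integrable_def intro!: integrable_mult_right)
    show "AE t in lborel. norm (?I t * (f t * exp (- real k * t))) \<le> norm (K * (?I t * exp (- (real k - b) * t)))"
    proof (rule AE_I2)
      fix t :: real
      have "\<bar>f t\<bar> * exp (- real k * t) \<le> (K * exp (b * t)) * exp (- real k * t)" if "t \<ge> 0"
        using bound[OF that] by (intro mult_right_mono) auto
      also have "(K * exp (b * t)) * exp (- real k * t) = K * exp (- (real k - b) * t)"
        by (simp add: exp_add[symmetric] algebra_simps)
      finally show "norm (?I t * (f t * exp (- real k * t))) \<le> norm (K * (?I t * exp (- (real k - b) * t)))"
        using K by (auto simp: indicator_def abs_mult)
    qed
  qed (auto intro!: meas continuous_intros)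
  define u where "u t = f t * exp (- real k0 * t)" for t
  have u_int: "integrable lborel (\<lambda>t. ?I t * u t)" unfolding u_def by (rule int0) simp
  have u_bound: "\<bar>u t\<bar> \<le> K * exp (- (real k0 - b) * t)" if "t \<ge> 0" for t
  proof -
    have "\<bar>f t\<bar> * exp (- real k0 * t) \<le> (K * exp (b * t)) * exp (- real k0 * t)"
      using bound[OF that] by (intro mult_right_mono) auto
    also have "\<dots> = K * exp (- (real k0 - b) * t)" by (simp add: exp_add[symmetric] algebra_simps)
    finally show ?thesis by (simp add: u_def abs_mult)
  qed
  have u_cont: "continuous_on {0..} u" unfolding u_def by (intro continuous_intros cont)
  \<comment> \<open>This is u in the variable x = exp(-t). Because k0 > b, u decays, so the value 0
    at x = 0 makes G continuous on [0,1]. G only serves the approximation; all integrals stay in the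
    variable t.\<close>
  define G where "G x = (if x \<le> 0 then 0 else u (- ln x))" for x
  have G_exp: "G (exp (- t)) = u t" for t by (simp add: G_def)
  have G_cont: "continuous_on {0..1} G"
  proof (intro continuous_on_eq_continuous_within[THEN iffD2] ballI)
    fix x :: real assume x: "x \<in> {0..1}"
    show "continuous (at x within {0..1}) G"
    proof (cases "x = 0")
      case False
      hence x0: "x > 0" using x by simp
      have "continuous_on {0<..1} (\<lambda>x. u (- ln x))"
        by (rule continuous_on_compose2[OF u_cont]) (auto intro!: continuous_intros)
      hence "continuous_on {0<..1} G" by (rule continuous_on_eq) (auto simp: G_def)
      hence "continuous (at x within {0<..1}) G" using x x0 by (auto simp: continuous_on_eq_continuous_within)
      moreover have "at x within {0<..1} = at x within {0..1}"
        by (rule at_within_nhd[of x "{0<..}"]) (use x0 in auto)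
      ultimately show ?thesis by simp
    next
      case True
      have "(G \<longlongrightarrow> 0) (at 0 within {0..1})"
      proof (rule Lim_null_comparison)
        show "\<forall>\<^sub>F x in at 0 within {0..1}. norm (G x) \<le> K * x powr (real k0 - b)"
        proof (rule eventually_at_filter[THEN iffD2], intro always_eventually allI impI)
          fix x :: real assume "x \<noteq> 0" "x \<in> {0..1}"
          hence x: "x > 0" "x \<le> 1" by auto
          have "norm (G x) \<le> K * exp (- (real k0 - b) * (- ln x))"
            using u_bound[of "- ln x"] x by (simp add: G_def)
          thus "norm (G x) \<le> K * x powr (real k0 - b)" using x by (simp add: powr_def algebra_simps)
        qed
        have "((\<lambda>x. K * x powr (real k0 - b)) \<longlongrightarrow> K * 0 powr (real k0 - b)) (at 0 within {0..1})"
          using k0 by (intro tendsto_intros) (auto simp: eventually_at_filter)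
        thus "((\<lambda>x. K * x powr (real k0 - b)) \<longlongrightarrow> 0) (at 0 within {0..1})" by simp
      qed
      thus ?thesis using True by (simp add: continuous_within G_def)
    qed
  qed
  have sq_int: "integrable lborel (\<lambda>t. ?I t * (u t * u t))"
  proof (rule Bochner_Integration.integrable_bound[OF integrable_mult_right[OF u_int, of K]])
    show "(\<lambda>t. ?I t * (u t * u t)) \<in> borel_measurable lborel"
      using borel_measurable_continuous_on_indicator[of "{0..}" "\<lambda>t. u t * u t"] u_cont
      by (auto intro!: continuous_intros)
    show "AE t in lborel. norm (?I t * (u t * u t)) \<le> norm (K * (?I t * u t))"
    proof (rule AE_I2)
      fix t :: real
      have uK: "\<bar>u t\<bar> \<le> K" if "t \<ge> 0"
      proof -
        have "(real k0 - b) * t \<ge> 0" using that k0 by simp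
        hence "exp (- (real k0 - b) * t) \<le> 1" by (simp only: exp_le_one_iff minus_mult_left[symmetric] neg_le_0_iff_le)
        from mult_left_mono[OF this K] show ?thesis using u_bound[OF that] by simp
      qed
      have "\<bar>u t\<bar> * \<bar>u t\<bar> \<le> K * \<bar>u t\<bar>" if "t \<ge> 0"
        using uK[OF that] by (intro mult_right_mono) auto
      thus "norm (?I t * (u t * u t)) \<le> norm (K * (?I t * u t))"
        using K by (cases "t \<ge> 0") (simp_all add: abs_mult)
    qed
  qed
  define M where "M = (LBINT t. \<bar>?I t * u t\<bar>)"
  have M: "M \<ge> 0" unfolding M_def by simp
  \<comment> \<open>One factor u is replaced by p(exp(-t)) at a cost of at most \<epsilon>; the
    integral of u p(exp(-t)) is a combination of transforms at k0 + i and vanishes.\<close>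
  have small: "(LBINT t. ?I t * (u t * u t)) \<le> \<epsilon> * M" if \<epsilon>: "\<epsilon> > 0" for \<epsilon>
  proof -
    obtain p where p: "real_polynomial_function p" "\<And>x. x \<in> {0..1} \<Longrightarrow> \<bar>G x - p x\<bar> < \<epsilon>"
      using Stone_Weierstrass_real_polynomial_function[OF compact_Icc G_cont \<epsilon>] by blast
    then obtain c n where c: "p = (\<lambda>x. \<Sum>i\<le>n. c i * x ^ i)" using real_polynomial_function_iff_sum by blast
    have up: "?I t * (u t * p (exp (- t))) = (\<Sum>i\<le>n. c i * (?I t * (f t * exp (- real (k0 + i) * t))))" for t
    proof -
      have "exp (- t) ^ i * exp (- real k0 * t) = exp (- real (k0 + i) * t)" for i
        by (simp add: exp_of_nat_mult[symmetric] exp_add[symmetric] algebra_simps)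
      hence e: "c i * (?I t * (f t * exp (- real (k0 + i) * t))) = ?I t * (u t * (c i * exp (- t) ^ i))" for i
        by (simp add: u_def mult_ac)
      show ?thesis unfolding c sum_distrib_left e ..
    qed
    have p_int: "integrable lborel (\<lambda>t. ?I t * (u t * p (exp (- t))))"
      unfolding up by (intro Bochner_Integration.integrable_sum integrable_mult_right int0) simp
    have "(LBINT t. ?I t * (u t * p (exp (- t)))) = (\<Sum>i\<le>n. c i * (LBINT t. ?I t * (f t * exp (- real (k0 + i) * t))))"
    proof -
      have "integrable lborel (\<lambda>t. c i * (?I t * (f t * exp (- real (k0 + i) * t))))" for i
        by (intro integrable_mult_right int0) simp
      thus ?thesis unfolding up by (simp only: Bochner_Integration.integral_sum integral_mult_right_zero)
    qed
    also have "\<dots> = 0"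
    proof -
      have "(LBINT t. ?I t * (f t * exp (- real (k0 + i) * t))) = 0" for i
        by (rule zero[of "k0 + i", unfolded set_lebesgue_integral_def real_scaleR_def]) simp
      thus ?thesis by (simp only: mult_zero_right sum.neutral_const)
    qed
    finally have p0: "(LBINT t. ?I t * (u t * p (exp (- t)))) = 0" .
    have "(LBINT t. ?I t * (u t * u t)) = (LBINT t. ?I t * (u t * u t) - ?I t * (u t * p (exp (- t))))"
      using p0 by (subst Bochner_Integration.integral_diff[OF sq_int p_int]) simp
    also have "\<dots> \<le> (LBINT t. \<epsilon> * \<bar>?I t * u t\<bar>)"
    proof (rule integral_mono)
      show "integrable lborel (\<lambda>t. ?I t * (u t * u t) - ?I t * (u t * p (exp (- t))))"
        by (rule Bochner_Integration.integrable_diff[OF sq_int p_int])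
      show "integrable lborel (\<lambda>t. \<epsilon> * \<bar>?I t * u t\<bar>)" using u_int by (intro integrable_mult_right integrable_abs)
      fix t :: real
      show "?I t * (u t * u t) - ?I t * (u t * p (exp (- t))) \<le> \<epsilon> * \<bar>?I t * u t\<bar>"
      proof (cases "t \<ge> 0")
        case True
        have "u t * u t - u t * p (exp (- t)) \<le> \<bar>u t\<bar> * \<bar>G (exp (- t)) - p (exp (- t))\<bar>"
          unfolding G_exp abs_mult[symmetric] right_diff_distrib[symmetric] by simp
        also have "\<dots> \<le> \<bar>u t\<bar> * \<epsilon>" using p(2)[of "exp (- t)"] True by (intro mult_left_mono) auto
        finally show ?thesis using True by (simp add: mult.commute)
      qed simp
    qed
    also have "\<dots> = \<epsilon> * M" by (simp add: M_def)
    finally show ?thesis .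
  qed
  have "(LBINT t. ?I t * (u t * u t)) \<le> 0"
  proof (rule field_le_epsilon)
    fix e :: real assume e: "e > 0"
    have "(LBINT t. ?I t * (u t * u t)) \<le> (e / (M + 1)) * M" by (rule small) (use e M in auto)
    also have "\<dots> \<le> 0 + e" using e M by (simp add: field_simps)
    finally show "(LBINT t. ?I t * (u t * u t)) \<le> 0 + e" .
  qed
  moreover have nonneg: "?I t * (u t * u t) \<ge> 0" for t by (simp add: indicator_def)
  hence "(LBINT t. ?I t * (u t * u t)) \<ge> 0" by (intro integral_nonneg_AE) auto
  ultimately have "(LBINT t. ?I t * (u t * u t)) = 0" by linarith
  hence AE: "AE t in lborel. ?I t * (u t * u t) = 0"
    using integral_nonneg_eq_0_iff_AE[OF sq_int] nonneg by simp
  \<comment> \<open>The right end t + 1 keeps the interval nondegenerate also for t = 0.\<close>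
  have "((\<lambda>t. u t * u t) has_integral 0) (cbox 0 (t + 1))"
  proof -
    have cont: "continuous_on {0..t + 1} (\<lambda>t. u t * u t)"
      by (intro continuous_intros continuous_on_subset[OF u_cont]) auto
    have "(LINT x:{0..t + 1}|lborel. u x * u x) = (LINT x:{0..t + 1}|lborel. 0)"
      unfolding set_lebesgue_integral_def
    proof (rule integral_cong_AE)
      show "AE x in lborel. indicator {0..t + 1} x *\<^sub>R (u x * u x) = indicator {0..t + 1} x *\<^sub>R 0"
        using AE by eventually_elim (auto simp: indicator_def split: if_splits)
      show "(\<lambda>x. indicator {0..t + 1} x *\<^sub>R (u x * u x)) \<in> borel_measurable lborel"
        using borel_measurable_continuous_on_indicator[OF _ cont] by simp
    qed simp
    moreover have "set_integrable lborel {0..t + 1} (\<lambda>t. u t * u t)"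
      unfolding set_integrable_def using borel_integrable_compact[OF compact_Icc cont] by simp
    ultimately show ?thesis
      using set_borel_integral_eq_integral[of "{0..t + 1}" "\<lambda>t. u t * u t"]
      by (simp add: has_integral_iff)
  qed
  hence "u t * u t = 0"
    by (rule has_integral_0_cbox_imp_0[rotated 2])
       (use t u_cont in \<open>auto intro!: continuous_intros intro: continuous_on_subset\<close>)
  thus ?thesis by (simp add: u_def)
qed

text \<open>The sum over odd squares is pi^2/8, namely pi^2/6 without its even quarter. Adding
  Catalan's series cancels the denominators 3, 7, 11, ... and doubles the rest, leaving 2/(4n+1)^2;
  multiplication by 8 gives the claim. So the constant C is the Lerch-type series of Psi at t =
  0.\<close>

lemma sums_quarter_squares: "(\<lambda>n. 1 / (real n + 1 / 4) ^ 2) sums (pi ^ 2 + 8 * catalan_const)"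
proof -
  define b where "b n = 1 / (2 * real n + 1) ^ 2" for n
  have pair: "sum f {n * 2..<n * 2 + 2} = f (2 * n) + f (2 * n + 1)" for f :: "nat \<Rightarrow> real" and n
    by (simp add: eval_nat_numeral mult.commute add.commute)
  have z2: "(\<lambda>n. 1 / (real n + 1) ^ 2) sums (pi ^ 2 / 6)"
    using inverse_squares_sums by (simp add: add.commute)
  have g: "(\<lambda>n. b n + 1 / 4 * (1 / (real n + 1) ^ 2)) sums (pi ^ 2 / 6)"
  proof -
    have "1 / (real (2 * n + 1) + 1) ^ 2 = 1 / 4 * (1 / (real n + 1) ^ 2)" for n
    proof -
      have "real (2 * n + 1) + 1 = 2 * (real n + 1)" by simp
      thus ?thesis by (simp only: power_mult_distrib) simp
    qed
    thus ?thesis using sums_group[OF z2, of 2] unfolding pair b_def by (simp add: add.commute)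
  qed
  have b: "b sums (pi ^ 2 / 8)"
    using sums_diff[OF g sums_mult[OF z2, of "1 / 4"]] by (simp add: field_simps)
  have "summable (\<lambda>n. (-1) ^ n / (2 * real n + 1) ^ 2)"
    by (rule summable_comparison_test'[OF sums_summable[OF b], of 0]) (simp add: b_def)
  hence G: "(\<lambda>n. (-1) ^ n / (2 * real n + 1) ^ 2) sums catalan_const"
    unfolding catalan_const_def by (rule summable_sums)
  from sums_group[OF sums_add[OF b G], of 2]
  have "(\<lambda>n. 2 / (4 * real n + 1) ^ 2) sums (pi ^ 2 / 8 + catalan_const)"
    unfolding pair b_def by (simp add: mult.commute)
  from sums_mult[OF this, of 8] have "(\<lambda>n. 8 * (2 / (4 * real n + 1) ^ 2)) sums (pi ^ 2 + 8 * catalan_const)"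
    by (simp add: distrib_left)
  moreover have "8 * (2 / (4 * real n + 1) ^ 2) = 1 / (real n + 1 / 4) ^ 2" for n
  proof -
    have "real n + 1 / 4 = (4 * real n + 1) / 4" by simp
    thus ?thesis by (simp only: power_divide) simp
  qed
  ultimately show ?thesis by simp
qed

section \<open>The Laplace transform of Psi\<close>

text \<open>An infinite series with a cut-off \<open>max 0\<close> in place of a finite sum whose
  range depends on t: every term is continuous and has its own Laplace transform.\<close>

definition Psi_prime_part :: "real \<Rightarrow> real" where
  "Psi_prime_part t = (\<Sum>n. mangoldt (Suc n) / sqrt (real (Suc n)) * max 0 (t - ln (real (Suc n))))"

text \<open>The difference of C and the Lerch term, merged into one series with nonnegative terms
  for t >= 0; the exponent 2 (n + 1/4) = 2n + 1/2 combines exp(-2nt) with exp(-t/2).\<close>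

definition Psi_gamma_part :: "real \<Rightarrow> real" where
  "Psi_gamma_part t = (\<Sum>n. 1 / (real n + 1 / 4) ^ 2 * (1 - exp (- 2 * (real n + 1 / 4) * t)))"

lemma Psi_prime_part_eq_0:
  assumes "exp t \<le> real N" "n \<notin> {..<N}"
  shows "mangoldt (Suc n) / sqrt (real (Suc n)) * max 0 (t - ln (real (Suc n))) = 0"
proof -
  have "exp t \<le> real (Suc n)" using assms by simp
  hence "t \<le> ln (real (Suc n))" by (subst ln_ge_iff) auto
  thus ?thesis by simp
qed

lemma Psi_prime_part_eq:
  assumes "exp t \<le> real N"
  shows "Psi_prime_part t = (\<Sum>n<N. mangoldt (Suc n) / sqrt (real (Suc n)) * max 0 (t - ln (real (Suc n))))"
  unfolding Psi_prime_part_def by (rule suminf_finite[OF finite_lessThan Psi_prime_part_eq_0[OF assms]])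

lemma Psi_prime_part_sums:
  "(\<lambda>n. mangoldt (Suc n) / sqrt (real (Suc n)) * max 0 (t - ln (real (Suc n)))) sums Psi_prime_part t"
proof -
  obtain N where N: "exp t \<le> real N" using real_arch_simple by blast
  show ?thesis unfolding Psi_prime_part_eq[OF N]
    by (rule sums_finite[OF finite_lessThan Psi_prime_part_eq_0[OF N]])
qed

lemma Psi_prime_part_sum:
  "Psi_prime_part t = (\<Sum>n | n \<ge> 1 \<and> real n \<le> exp t. mangoldt n / sqrt (real n) * (t - ln (real n)))"
proof -
  define N where "N = nat \<lceil>exp t\<rceil>"
  have N: "exp t \<le> real N" by (simp add: N_def)
  have le: "real n \<le> exp t \<longleftrightarrow> ln (real n) \<le> t" if "n \<ge> 1" for n
    using that ln_ge_iff[of "real n" ] by (metis ln_le_cancel_iff exp_gt_zero ln_exp of_nat_0_less_iff zero_less_one order_less_le_trans)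
  have "Psi_prime_part t = (\<Sum>n\<in>Suc ` {..<N}. mangoldt n / sqrt (real n) * max 0 (t - ln (real n)))"
    unfolding Psi_prime_part_eq[OF N] by (subst sum.reindex) auto
  also have "\<dots> = (\<Sum>n | n \<ge> 1 \<and> real n \<le> exp t. mangoldt n / sqrt (real n) * max 0 (t - ln (real n)))"
  proof (rule sum.mono_neutral_right)
    show "{n. n \<ge> 1 \<and> real n \<le> exp t} \<subseteq> Suc ` {..<N}"
    proof
      fix n assume "n \<in> {n. n \<ge> 1 \<and> real n \<le> exp t}"
      hence "n \<ge> 1" "real n \<le> real N" using N by auto
      thus "n \<in> Suc ` {..<N}" by (intro image_eqI[of _ _ "n - 1"]) auto
    qed
    show "\<forall>n\<in>Suc ` {..<N} - {n. n \<ge> 1 \<and> real n \<le> exp t}. mangoldt n / sqrt (real n) * max 0 (t - ln (real n)) = 0"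
      using le by (auto simp: max_def not_le)
  qed auto
  also have "\<dots> = (\<Sum>n | n \<ge> 1 \<and> real n \<le> exp t. mangoldt n / sqrt (real n) * (t - ln (real n)))"
    using le by (intro sum.cong) auto
  finally show ?thesis .
qed

lemma lerch_exp_le:
  assumes "t \<ge> 0"
  shows "exp (- 2 * (real n + 1 / 4) * t) \<le> 1"
proof -
  have "2 * (real n + 1 / 4) * t \<ge> 0" using assms by simp
  hence "- (2 * (real n + 1 / 4) * t) \<le> 0" by linarith
  thus ?thesis by (simp only: exp_le_one_iff mult_minus_left)
qed

lemma abs_one_minus_le: "0 < x \<Longrightarrow> x \<le> 1 \<Longrightarrow> \<bar>1 - x\<bar> \<le> (1::real)"
  by linarith

lemma lerch_summable:
  assumes "t \<ge> 0"
  shows "summable (\<lambda>n. 1 / (real n + 1 / 4) ^ 2 * exp (- 2 * (real n + 1 / 4) * t))"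
proof (rule summable_comparison_test'[OF sums_summable[OF sums_quarter_squares], of 0])
  fix n :: nat
  from mult_left_mono[OF lerch_exp_le[OF assms, of n], of "1 / (real n + 1 / 4) ^ 2"]
  show "norm (1 / (real n + 1 / 4) ^ 2 * exp (- 2 * (real n + 1 / 4) * t)) \<le> 1 / (real n + 1 / 4) ^ 2"
    by simp
qed

lemma Psi_gamma_part_sums:
  assumes "t \<ge> 0"
  shows "(\<lambda>n. 1 / (real n + 1 / 4) ^ 2 * (1 - exp (- 2 * (real n + 1 / 4) * t))) sums Psi_gamma_part t"
  unfolding Psi_gamma_part_def
  using summable_diff[OF sums_summable[OF sums_quarter_squares] lerch_summable[OF assms]]
  by (intro summable_sums) (simp add: right_diff_distrib)

lemma Psi_gamma_part_eq:
  assumes t: "t \<ge> 0"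
  shows "(pi ^ 2 + 8 * catalan_const) - exp (- t / 2) * lerch_phi (exp (- 2 * t)) 2 (1 / 4) = Psi_gamma_part t"
proof -
  let ?e = "\<lambda>n. 1 / (real n + 1 / 4) ^ 2 * exp (- 2 * (real n + 1 / 4) * t)"
  have tm: "exp (- t / 2) * ((real n + 1 / 4) powr (- 2) * exp (- 2 * t) ^ n) = ?e n" for n
  proof -
    have "exp (- t / 2) * exp (- 2 * t) ^ n = exp (- 2 * (real n + 1 / 4) * t)"
      by (simp add: exp_of_nat_mult[symmetric] exp_add[symmetric] algebra_simps)
    moreover have "(real n + 1 / 4) powr (- 2) = 1 / (real n + 1 / 4) ^ 2"
      by (simp add: powr_minus_divide)
    ultimately show ?thesis by (simp add: mult_ac)
  qed
  have "summable (\<lambda>n. exp (- t / 2) * ((real n + 1 / 4) powr (- 2) * exp (- 2 * t) ^ n))"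
    unfolding tm by (rule lerch_summable[OF t])
  hence "summable (\<lambda>n. (real n + 1 / 4) powr (- 2) * exp (- 2 * t) ^ n)"
    by (subst (asm) summable_cmult_iff) simp
  from suminf_mult[OF this, of "exp (- t / 2)"]
  have "exp (- t / 2) * lerch_phi (exp (- 2 * t)) 2 (1 / 4) = suminf ?e"
    unfolding tm lerch_phi_def by simp
  moreover have "(\<lambda>n. 1 / (real n + 1 / 4) ^ 2 - ?e n) sums ((pi ^ 2 + 8 * catalan_const) - suminf ?e)"
    by (intro sums_diff sums_quarter_squares summable_sums lerch_summable t)
  ultimately show ?thesis
    unfolding Psi_gamma_part_def by (simp add: sums_iff right_diff_distrib)
qed

lemma Psi_eq:
  assumes "t \<ge> 0"
  shows "Psi t = 4 * (exp (t / 2) + exp (- t / 2) - 2) - Psi_prime_part t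
    + t / 2 * (Digamma (1 / 4) - ln pi) + 1 / 4 * Psi_gamma_part t"
  unfolding Psi_def Psi_prime_part_sum[symmetric] Psi_gamma_part_eq[OF assms] ..

text \<open>A new prime power enters at t = ln n with weight t - ln n = 0, so the prime part has no
  jumps; on bounded ranges it is one fixed finite sum. The gamma part converges uniformly, being
  dominated by 1/(n + 1/4)^2.\<close>

lemma Psi_continuous: "continuous_on {0..} Psi"
proof (rule continuous_on_eq)
  have prime: "continuous_on {0..<T} Psi_prime_part" for T
  proof -
    obtain N where N: "exp T \<le> real N" using real_arch_simple by blast
    have "continuous_on {0..<T} (\<lambda>t. \<Sum>n<N. mangoldt (Suc n) / sqrt (real (Suc n)) * max 0 (t - ln (real (Suc n))))"
      by (intro continuous_intros)
    thus ?thesis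
    proof (rule continuous_on_eq)
      fix t assume "t \<in> {0..<T}"
      hence "exp t \<le> exp T" by simp
      hence "exp t \<le> real N" using N by linarith
      thus "(\<Sum>n<N. mangoldt (Suc n) / sqrt (real (Suc n)) * max 0 (t - ln (real (Suc n)))) = Psi_prime_part t"
        by (rule Psi_prime_part_eq[symmetric])
    qed
  qed
  have gamma: "continuous_on {0..} Psi_gamma_part"
    unfolding Psi_gamma_part_def[abs_def]
  proof (rule uniform_limit_theorem[OF _ Weierstrass_m_test[OF _ sums_summable[OF sums_quarter_squares]]])
    show "\<forall>\<^sub>F n in sequentially. continuous_on {0..} (\<lambda>t. \<Sum>i<n. 1 / (real i + 1 / 4) ^ 2 * (1 - exp (- 2 * (real i + 1 / 4) * t)))"
      by (intro always_eventually allI continuous_intros)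
    fix n and t :: real assume "t \<in> {0..}"
    hence "\<bar>1 - exp (- 2 * (real n + 1 / 4) * t)\<bar> \<le> 1" by (intro abs_one_minus_le lerch_exp_le) auto
    from mult_left_mono[OF this, of "1 / (real n + 1 / 4) ^ 2"]
    show "norm (1 / (real n + 1 / 4) ^ 2 * (1 - exp (- 2 * (real n + 1 / 4) * t))) \<le> 1 / (real n + 1 / 4) ^ 2"
      by (simp add: abs_mult)
  qed simp
  show "continuous_on {0..} (\<lambda>t. 4 * (exp (t / 2) + exp (- t / 2) - 2) - Psi_prime_part t
    + t / 2 * (Digamma (1 / 4) - ln pi) + 1 / 4 * Psi_gamma_part t)"
    by (intro continuous_intros continuous_on_atLeast[OF prime] gamma) auto
qed (simp add: Psi_eq)

text \<open>Any exponential bound suffices for the uniqueness argument. The exponent 3 comes from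
  the prime part: at most exp t terms, each at most t^2 <= exp(2t).\<close>

lemma Psi_crude_bound: "\<exists>K. \<forall>t\<ge>0. \<bar>Psi t\<bar> \<le> K * exp (3 * t)"
proof -
  define C where "C = pi ^ 2 + 8 * catalan_const"
  define K where "K = 16 + 1 + \<bar>Digamma (1 / 4) - ln pi\<bar> + C"
  have "\<bar>Psi t\<bar> \<le> K * exp (3 * t)" if t: "t \<ge> 0" for t
  proof -
    let ?E = "exp (3 * t)"
    have E1: "?E \<ge> 1" using t by simp
    have e1: "\<bar>4 * (exp (t / 2) + exp (- t / 2) - 2)\<bar> \<le> 16 * ?E"
    proof -
      have *: "\<bar>4 * (p + q - 2)\<bar> \<le> 16 * E" if "p \<le> E" "q \<le> E" "0 < p" "0 < q" "1 \<le> E" for p q E :: real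
      proof -
        have "4 * (p + q - 2) \<le> 16 * E" using that(1,2,5) by argo
        moreover have "- (4 * (p + q - 2)) \<le> 16 * E" using that(3,4,5) by argo
        ultimately show ?thesis by (rule abs_leI)
      qed
      show ?thesis by (rule *) (use t in simp_all)
    qed
    have tE: "t \<le> ?E" using exp_ge_add_one_self[of "3 * t"] t by linarith
    have e2: "\<bar>Psi_prime_part t\<bar> \<le> 1 * ?E"
    proof -
      let ?S = "{n. n \<ge> 1 \<and> real n \<le> exp t}"
      have S: "?S \<subseteq> {1..nat \<lfloor>exp t\<rfloor>}" by (auto simp: le_nat_iff le_floor_iff)
      hence "card ?S \<le> nat \<lfloor>exp t\<rfloor>" using card_mono[OF _ S] by simp
      hence card: "real (card ?S) \<le> exp t" by (simp add: le_nat_iff le_floor_iff)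
      have "\<bar>Psi_prime_part t\<bar> \<le> (\<Sum>n\<in>?S. \<bar>mangoldt n / sqrt (real n) * (t - ln (real n))\<bar>)"
        unfolding Psi_prime_part_sum by (rule sum_abs)
      also have "\<dots> \<le> (\<Sum>n\<in>?S. t * t)"
      proof (rule sum_mono)
        fix n assume n: "n \<in> ?S"
        have ln_le: "ln (real n) \<le> t" using n by (metis (mono_tags, lifting) exp_gt_zero ln_exp ln_le_cancel_iff mem_Collect_eq of_nat_0_less_iff order_less_le_trans zero_less_one)
        have ln0: "ln (real n) \<ge> 0" using n by simp
        have "mangoldt n \<le> t" using mangoldt_le[of n] n ln_le by simp
        moreover have "mangoldt n / sqrt (real n) \<le> mangoldt n" 
          using n mangoldt_nonneg[of n] by (simp add: divide_le_eq mult_le_cancel_left1)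
        ultimately have "mangoldt n / sqrt (real n) \<le> t" by linarith
        moreover have "mangoldt n / sqrt (real n) \<ge> 0" by (simp add: mangoldt_nonneg)
        ultimately show "\<bar>mangoldt n / sqrt (real n) * (t - ln (real n))\<bar> \<le> t * t"
          unfolding abs_mult using ln_le ln0 by (intro mult_mono) auto
      qed
      also have "\<dots> = real (card ?S) * (t * t)" by simp
      also have "\<dots> \<le> exp t * (exp t * exp t)"
      proof -
        have "t \<le> exp t" using exp_ge_add_one_self[of t] by linarith
        thus ?thesis using card t by (intro mult_mono) auto
      qed
      also have "\<dots> = ?E" by (simp add: exp_add[symmetric])
      finally show ?thesis by simp
    qed
    have e3: "\<bar>t / 2 * (Digamma (1 / 4) - ln pi)\<bar> \<le> \<bar>Digamma (1 / 4) - ln pi\<bar> * ?E"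
      unfolding abs_mult mult.commute[of "\<bar>t / 2\<bar>"] using tE t by (intro mult_left_mono) auto
    have e4: "\<bar>1 / 4 * Psi_gamma_part t\<bar> \<le> C * ?E"
    proof -
      have C: "C \<ge> 0" unfolding C_def using sums_le[OF _ sums_zero sums_quarter_squares] by simp
      have "Psi_gamma_part t \<le> C"
        unfolding C_def
      proof (rule sums_le[OF _ Psi_gamma_part_sums[OF t] sums_quarter_squares])
        show "1 / (real n + 1 / 4) ^ 2 * (1 - exp (- 2 * (real n + 1 / 4) * t)) \<le> 1 / (real n + 1 / 4) ^ 2" for n
          by (rule mult_left_le) simp_all
      qed
      moreover have "Psi_gamma_part t \<ge> 0"
      proof (rule sums_le[OF _ sums_zero Psi_gamma_part_sums[OF t]])
        show "0 \<le> 1 / (real n + 1 / 4) ^ 2 * (1 - exp (- 2 * (real n + 1 / 4) * t))" for n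
          using lerch_exp_le[OF t, of n] by (intro mult_nonneg_nonneg) (simp, linarith)
      qed
      moreover have "C * 1 \<le> C * ?E" using C E1 by (intro mult_left_mono) auto
      ultimately show ?thesis by simp
    qed
    have "\<bar>Psi t\<bar> \<le> 16 * ?E + 1 * ?E + \<bar>Digamma (1 / 4) - ln pi\<bar> * ?E + C * ?E"
      unfolding Psi_eq[OF t] using e1 e2 e3 e4 by linarith
    also have "\<dots> = K * ?E" by (simp add: K_def distrib_right)
    finally show ?thesis .
  qed
  thus ?thesis by blast
qed

lemma set_integral_transfer:
  fixes f g :: "real \<Rightarrow> complex"
  assumes "set_integrable lborel A f" "(LINT t:A|lborel. f t) = v" "\<And>t. t \<in> A \<Longrightarrow> g t = f t"
  shows "set_integrable lborel A g \<and> (LINT t:A|lborel. g t) = v"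
proof -
  have "indicator A t *\<^sub>R g t = indicator A t *\<^sub>R f t" for t using assms(3) by (auto simp: indicator_def)
  thus ?thesis using assms(1,2) by (simp only: set_integrable_def set_lebesgue_integral_def)
qed

text \<open>With s = 1/2 + w, the exponentials produce 1/s + 1/(s - 1), the prime part minus the
  series of Lambda, and the last two parts the digamma and ln pi terms, with Digamma(1/4) cancelling
  between them. Together they form w^(-2) times the formula of \<open>xi_log_deriv\<close>.\<close>

theorem Psi_Laplace:
  assumes w: "Re w > 1 / 2"
  shows "set_integrable lborel {0..} (\<lambda>t. of_real (Psi t) * exp (- w * of_real t)) \<and>
    (LINT t:{0..}|lborel. of_real (Psi t) * exp (- w * of_real t))
       = 1 / w ^ 2 * (deriv xi_entire (1 / 2 + w) / xi_entire (1 / 2 + w))"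
proof -
  have w0: "w \<noteq> 0" "Re w > 0" "w - 1 / 2 \<noteq> 0" "w + 1 / 2 \<noteq> 0" using w by (auto simp: complex_eq_iff)
  let ?I = "\<lambda>t. indicator {0..} t :: real"
  let ?e = "\<lambda>t. exp (- w * of_real t)"
  define s where "s = 1 / 2 + w"
  have s: "Re s > 1" using w by (simp add: s_def)

  define A where "A t = 4 * (exp (- (w - 1 / 2) * of_real t) + exp (- (w + 1 / 2) * of_real t) - 2 * ?e t)" for t :: real
  have A_ints: "set_integrable lborel {0..} (\<lambda>t. exp (- (w - 1 / 2) * of_real t))"
    "set_integrable lborel {0..} (\<lambda>t. exp (- (w + 1 / 2) * of_real t))"
    "set_integrable lborel {0..} (\<lambda>t. 2 * ?e t)"
    using exp_integral_atLeast(1)[of "w - 1 / 2" 0] exp_integral_atLeast(1)[of "w + 1 / 2" 0]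
      exp_integral_atLeast(1)[of w 0] w by (auto intro: set_integrable_mult_right)
  have A_int: "set_integrable lborel {0..} A"
    unfolding A_def by (intro set_integrable_mult_right set_integral_diff set_integral_add A_ints)
  have A_val: "(LINT t:{0..}|lborel. A t) = 4 * (1 / (w - 1 / 2) + 1 / (w + 1 / 2) - 2 * (1 / w))"
    unfolding A_def set_integral_mult_right set_integral_diff(2)[OF set_integral_add(1)[OF A_ints(1,2)] A_ints(3)]
      set_integral_add(2)[OF A_ints(1,2)]
    using exp_integral_atLeast(2)[of "w - 1 / 2" 0] exp_integral_atLeast(2)[of "w + 1 / 2" 0]
      exp_integral_atLeast(2)[of w 0] w by simp

  \<comment> \<open>The n-th prime term starts at t = ln(n+1), so its transform is (n+1)^(-w) / w^2;
    the coefficient 1/sqrt(n+1) shifts the exponent from w to s.\<close>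
  define f where "f n t = ?I t *\<^sub>R (of_real (mangoldt (Suc n) / sqrt (real (Suc n)) * max 0 (t - ln (real (Suc n)))) * ?e t)" for n t
  have f_eq: "f n t = of_real (mangoldt (Suc n) / sqrt (real (Suc n))) *
      (indicator {ln (real (Suc n))..} t *\<^sub>R (of_real (t - ln (real (Suc n))) * ?e t))" for n t
  proof -
    have l0: "ln (real (Suc n)) \<ge> 0" by simp
    show ?thesis
    proof (cases "ln (real (Suc n)) \<le> t")
      case True
      hence "t \<ge> 0" using l0 by linarith
      thus ?thesis using True by (simp add: f_def mult_ac del: of_nat_Suc)
    qed (simp add: f_def del: of_nat_Suc)
  qed
  have f_int: "integrable lborel (f n)" for n
    unfolding f_eq using linear_exp_integral_atLeast(1)[of w "ln (real (Suc n))"] w0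
    by (intro integrable_mult_right) (simp add: set_integrable_def del: of_nat_Suc)
  have f_val: "(LBINT t. f n t) = 1 / w ^ 2 * (mangoldt (Suc n) / of_nat (Suc n) powr s)" for n
  proof -
    have "of_nat (Suc n) powr s = of_real (sqrt (real (Suc n))) * exp (w * of_real (ln (real (Suc n))))"
    proof -
      have "of_nat (Suc n) powr s = exp (s * of_real (ln (real (Suc n))))"
        using of_real_powr_eq[of "real (Suc n)" s] by (simp del: of_nat_Suc)
      also have "\<dots> = exp (of_real (ln (real (Suc n)) / 2)) * exp (w * of_real (ln (real (Suc n))))"
        by (simp add: s_def distrib_right exp_add del: of_nat_Suc)
      also have "exp (complex_of_real (ln (real (Suc n)) / 2)) = of_real (sqrt (real (Suc n)))"
        unfolding exp_of_real by (simp add: ln_sqrt[symmetric] del: of_nat_Suc)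
      finally show ?thesis .
    qed
    moreover have "(LBINT t. f n t) = of_real (mangoldt (Suc n) / sqrt (real (Suc n))) * (exp (- w * of_real (ln (real (Suc n)))) / w ^ 2)"
      unfolding f_eq integral_mult_right_zero
      using linear_exp_integral_atLeast(2)[of w "ln (real (Suc n))"] w0
      by (simp add: set_lebesgue_integral_def del: of_nat_Suc)
    ultimately show ?thesis by (simp add: exp_minus divide_inverse del: of_nat_Suc)
  qed
  have sqrt_powr: "exp (- Re w * ln x) / sqrt x = x powr (- Re s)" if "x > 0" for x
  proof -
    have "- Re s = - Re w + - (1 / 2)" by (simp add: s_def)
    hence "x powr (- Re s) = x powr (- Re w + - (1 / 2))" by (simp only:)
    also have "\<dots> = x powr (- Re w) * (1 / sqrt x)"
      unfolding powr_add powr_minus_divide[of x "1 / 2"] using that by (simp add: powr_half_sqrt)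
    finally show ?thesis using that by (simp add: powr_def)
  qed
  have f_norm: "(LBINT t. norm (f n t)) = 1 / Re w ^ 2 * (norm (mangoldt (Suc n) :: complex) * real (Suc n) powr (- Re s))" for n
  proof -
    let ?l = "ln (real (Suc n))"
    have nf: "complex_of_real (norm (f n t)) = of_real (mangoldt (Suc n) / sqrt (real (Suc n))) *
      (indicator {?l..} t *\<^sub>R (of_real (t - ?l) * exp (- of_real (Re w) * of_real t)))" for t
    proof -
      have "norm (f n t) = mangoldt (Suc n) / sqrt (real (Suc n)) * (indicator {?l..} t * ((t - ?l) * exp (- Re w * t)))"
        unfolding f_eq norm_mult norm_scaleR norm_of_real norm_exp_eq_Re
        by (cases "t \<ge> ?l") (simp_all add: mangoldt_nonneg del: of_nat_Suc)
      thus ?thesis by (simp add: exp_of_real[symmetric] scaleR_conv_of_real del: of_nat_Suc)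
    qed
    have "complex_of_real (LBINT t. norm (f n t)) = (CLBINT t. of_real (norm (f n t)))" by simp
    also have "\<dots> = of_real (mangoldt (Suc n) / sqrt (real (Suc n))) * (exp (- of_real (Re w) * of_real ?l) / of_real (Re w) ^ 2)"
      unfolding nf integral_mult_right_zero
      using linear_exp_integral_atLeast(2)[of "of_real (Re w)" ?l] w0
      by (simp add: set_lebesgue_integral_def del: of_nat_Suc)
    also have "\<dots> = of_real (1 / Re w ^ 2 * (mangoldt (Suc n) * (exp (- Re w * ?l) / sqrt (real (Suc n)))))"
      by (simp add: exp_of_real[symmetric] del: of_nat_Suc of_real_mangoldt)
    finally have "(LBINT t. norm (f n t)) = 1 / Re w ^ 2 * (mangoldt (Suc n) * (exp (- Re w * ?l) / sqrt (real (Suc n))))"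
      by (simp only: of_real_eq_iff)
    moreover have "exp (- Re w * ?l) / sqrt (real (Suc n)) = real (Suc n) powr (- Re s)"
      by (rule sqrt_powr) simp
    ultimately show ?thesis by (simp only: norm_mangoldt)
  qed
  have f_summ_norm: "summable (\<lambda>n. LBINT t. norm (f n t))"
    unfolding f_norm by (intro summable_mult summable_mangoldt s)
  have f_sums: "(\<lambda>n. f n t) sums (?I t *\<^sub>R (of_real (Psi_prime_part t) * ?e t))" for t
    unfolding f_def by (intro sums_scaleR_right sums_mult2 sums_of_real Psi_prime_part_sums)
  have f_abs: "summable (\<lambda>n. norm (f n t))" for t
  proof -
    have "norm (f n t) = mangoldt (Suc n) / sqrt (real (Suc n)) * max 0 (t - ln (real (Suc n))) * (?I t * norm (?e t))" for n
      unfolding f_def norm_scaleR norm_mult norm_of_real by (simp add: mangoldt_nonneg mult_ac del: of_nat_Suc)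
    thus ?thesis using sums_summable[OF sums_mult2[OF Psi_prime_part_sums[of t], of "?I t * norm (?e t)"]] by (simp only:)
  qed
  have f_sum_eq: "(\<Sum>n. f n t) = ?I t *\<^sub>R (of_real (Psi_prime_part t) * ?e t)" for t
    by (rule sums_unique[OF f_sums, symmetric])
  have B_int: "set_integrable lborel {0..} (\<lambda>t. of_real (Psi_prime_part t) * ?e t)"
    using integrable_suminf[of lborel f, OF f_int _ f_summ_norm] f_abs unfolding f_sum_eq set_integrable_def by simp
  have B_val: "(LINT t:{0..}|lborel. of_real (Psi_prime_part t) * ?e t) = 1 / w ^ 2 * mangoldt_series s"
  proof -
    have "(LINT t:{0..}|lborel. of_real (Psi_prime_part t) * ?e t) = (\<Sum>n. LBINT t. f n t)"
      using integral_suminf[of lborel f, OF f_int _ f_summ_norm] f_abs unfolding f_sum_eq set_lebesgue_integral_def by simp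
    also have "\<dots> = 1 / w ^ 2 * mangoldt_series s"
      unfolding f_val mangoldt_series_def
    proof (rule suminf_mult)
      have "norm (mangoldt (Suc n) / of_nat (Suc n) powr s) = norm (mangoldt (Suc n) :: complex) * real (Suc n) powr (- Re s)" for n
        using norm_inverse_nat_powr[of n s] by (simp add: norm_mult norm_divide norm_inverse divide_inverse del: of_nat_Suc norm_mangoldt)
      thus "summable (\<lambda>n. mangoldt (Suc n) / of_nat (Suc n) powr s)"
        using summable_mangoldt[OF s] by (simp only: summable_norm_cancel)
    qed
    finally show ?thesis .
  qed

  have D_int: "set_integrable lborel {0..} (\<lambda>t. of_real ((Digamma (1 / 4) - ln pi) / 2) * (of_real t * ?e t))"
    using linear_exp_integral_atLeast(1)[of w 0] w0 by (intro set_integrable_mult_right) simp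
  have D_val: "(LINT t:{0..}|lborel. of_real ((Digamma (1 / 4) - ln pi) / 2) * (of_real t * ?e t))
      = of_real ((Digamma (1 / 4) - ln pi) / 2) * (1 / w ^ 2)"
    using linear_exp_integral_atLeast(2)[of w 0] w0 by simp

  define a where "a n = real n + 1 / 4" for n
  have a: "a n > 0" for n by (simp add: a_def)
  define c where "c n = 1 / 4 * (1 / a n ^ 2)" for n
  have c: "c n > 0" for n using a[of n] by (simp add: c_def)
  have c_summ: "summable c"
    unfolding c_def a_def by (intro summable_mult sums_summable[OF sums_quarter_squares])
  \<comment> \<open>The difference 1 - exp(-2 a n t) stays in one term, bounded by 1, so that
    termwise integration rests on the summability of c alone.\<close>
  define g where "g n t = ?I t *\<^sub>R (of_real (c n * (1 - exp (- 2 * a n * t))) * ?e t)" for n t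
  have g_eq: "g n t = of_real (c n) * (?I t *\<^sub>R ?e t - ?I t *\<^sub>R exp (- (w + of_real (2 * a n)) * of_real t))" for n t
  proof -
    have "of_real (exp (- 2 * a n * t)) * ?e t = exp (- (w + of_real (2 * a n)) * of_real t)"
      by (simp add: exp_of_real[symmetric] exp_add[symmetric] algebra_simps)
    thus ?thesis by (simp add: g_def algebra_simps)
  qed
  have Re_wa: "Re (w + of_real (2 * a n)) > 0" for n using a[of n] w0 by simp
  have g_int: "integrable lborel (g n)" for n
    unfolding g_eq by (intro integrable_mult_right Bochner_Integration.integrable_diff exp_integral_indicator(1) w0 Re_wa)
  have g_val: "(LBINT t. g n t) = of_real (c n) * (1 / w - 1 / (w + of_real (2 * a n)))" for n
    unfolding g_eq integral_mult_right_zero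
    by (subst Bochner_Integration.integral_diff) (simp_all only: exp_integral_indicator w0 Re_wa)
  have g_le: "norm (g n t) \<le> c n * (?I t * exp (- Re w * t))" for n t
  proof (cases "t \<ge> 0")
    case True
    have "\<bar>1 - exp (- 2 * a n * t)\<bar> \<le> 1"
      unfolding a_def by (intro abs_one_minus_le lerch_exp_le True) auto
    hence "\<bar>c n * (1 - exp (- 2 * a n * t))\<bar> \<le> c n" unfolding abs_mult using c[of n] by (simp add: mult_left_le)
    thus ?thesis unfolding g_def norm_scaleR norm_mult norm_of_real norm_exp_eq_Re
      using True by (simp add: mult_right_mono)
  qed (simp add: g_def)
  have g_summ_norm: "summable (\<lambda>n. LBINT t. norm (g n t))"
  proof (rule summable_comparison_test'[OF summable_mult2[OF c_summ, of "LBINT t. ?I t * exp (- Re w * t)"], of 0])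
    fix n :: nat
    have "(LBINT t. norm (g n t)) \<le> (LBINT t. c n * (?I t * exp (- Re w * t)))"
      using set_integrable_exp_real[OF w0(2), of 0] g_le
      by (intro integral_mono integrable_norm g_int integrable_mult_right) (auto simp: set_integrable_def)
    thus "norm (LBINT t. norm (g n t)) \<le> c n * (LBINT t. ?I t * exp (- Re w * t))" by simp
  qed
  have g_abs: "summable (\<lambda>n. norm (g n t))" for t
    by (rule summable_comparison_test'[OF summable_mult2[OF c_summ, of "?I t * exp (- Re w * t)"], of 0])
       (use g_le in auto)
  have g_sum_eq: "(\<Sum>n. g n t) = ?I t *\<^sub>R (of_real (1 / 4 * Psi_gamma_part t) * ?e t)" for t
  proof (cases "t \<ge> 0")
    case True
    have "(\<lambda>n. c n * (1 - exp (- 2 * a n * t))) sums (1 / 4 * Psi_gamma_part t)"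
      using sums_mult[OF Psi_gamma_part_sums[OF True], of "1 / 4"] by (simp only: c_def a_def mult.assoc)
    hence "(\<lambda>n. g n t) sums (?I t *\<^sub>R (of_real (1 / 4 * Psi_gamma_part t) * ?e t))"
      unfolding g_def by (intro sums_scaleR_right sums_mult2 sums_of_real)
    thus ?thesis by (rule sums_unique[symmetric])
  qed (simp add: g_def)
  have E_int: "set_integrable lborel {0..} (\<lambda>t. of_real (1 / 4 * Psi_gamma_part t) * ?e t)"
    using integrable_suminf[of lborel g, OF g_int _ g_summ_norm] g_abs unfolding g_sum_eq set_integrable_def by simp
  have E_val: "(LINT t:{0..}|lborel. of_real (1 / 4 * Psi_gamma_part t) * ?e t) = 1 / (2 * w ^ 2) * (Digamma (s / 2) - Digamma (1 / 4))"
  proof -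
    have "(LINT t:{0..}|lborel. of_real (1 / 4 * Psi_gamma_part t) * ?e t) = (\<Sum>n. LBINT t. g n t)"
      using integral_suminf[of lborel g, OF g_int _ g_summ_norm] g_abs unfolding g_sum_eq set_lebesgue_integral_def by simp
    also have "\<dots> = 1 / (2 * w ^ 2) * (Digamma (s / 2) - Digamma (1 / 4))"
    proof -
      have dig: "(\<lambda>n. inverse (of_nat (Suc n)) - inverse (z + of_nat n)) sums (Digamma z + euler_mascheroni)"
        if "z \<noteq> 0" for z :: complex
        using summable_sums[OF summable_Digamma[OF that]] by (simp add: Digamma_def)
      have "s / 2 \<noteq> 0" using s by auto
      from sums_mult[OF sums_diff[OF dig[OF this] dig[of "1 / 4"]], of "1 / (2 * w ^ 2)"]
      have "(\<lambda>n. 1 / (2 * w ^ 2) * (inverse (1 / 4 + of_nat n) - inverse (s / 2 + of_nat n))) sums (1 / (2 * w ^ 2) * (Digamma (s / 2) - Digamma (1 / 4)))"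
        by (simp add: algebra_simps)
      moreover have "1 / (2 * w ^ 2) * (inverse (1 / 4 + of_nat n) - inverse (s / 2 + of_nat n)) = (LBINT t. g n t)" for n
      proof -
        \<comment> \<open>Since s/2 + n = (n + 1/4) + w/2, the digamma difference and the transform
          of \<open>g n\<close> are two partial fraction forms of the same expression in \<alpha> =
          n + 1/4 and w.\<close>
        define \<alpha> :: complex where "\<alpha> = of_real (a n)"
        have nz: "\<alpha> \<noteq> 0" "w + 2 * \<alpha> \<noteq> 0"
          using a[of n] Re_wa[of n] by (auto simp: \<alpha>_def complex_eq_iff)
        have "1 / 4 + of_nat n = \<alpha>" "s / 2 + of_nat n = (w + 2 * \<alpha>) / 2"
          by (simp_all add: \<alpha>_def a_def s_def field_simps)
        moreover have "of_real (c n) = 1 / (4 * \<alpha> ^ 2)" by (simp add: c_def \<alpha>_def)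
        moreover have "1 / (2 * w ^ 2) * (inverse \<alpha> - inverse ((w + 2 * \<alpha>) / 2)) = 1 / (4 * \<alpha> ^ 2) * (1 / w - 1 / (w + 2 * \<alpha>))"
          using nz w0 by (simp add: divide_simps) (simp add: power2_eq_square algebra_simps)
        moreover have "of_real (2 * a n) = 2 * \<alpha>" by (simp add: \<alpha>_def)
        ultimately show ?thesis unfolding g_val by (simp only:)
      qed
      ultimately show ?thesis by (simp add: sums_iff)
    qed
    finally show ?thesis .
  qed

  have int: "set_integrable lborel {0..} (\<lambda>t. A t - of_real (Psi_prime_part t) * ?e t
      + of_real ((Digamma (1 / 4) - ln pi) / 2) * (of_real t * ?e t) + of_real (1 / 4 * Psi_gamma_part t) * ?e t)"
    by (intro set_integral_add(1) set_integral_diff(1) A_int B_int D_int E_int)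
  have "(LINT t:{0..}|lborel. A t - of_real (Psi_prime_part t) * ?e t
      + of_real ((Digamma (1 / 4) - ln pi) / 2) * (of_real t * ?e t) + of_real (1 / 4 * Psi_gamma_part t) * ?e t)
    = 4 * (1 / (w - 1 / 2) + 1 / (w + 1 / 2) - 2 * (1 / w)) - 1 / w ^ 2 * mangoldt_series s
      + of_real ((Digamma (1 / 4) - ln pi) / 2) * (1 / w ^ 2) + 1 / (2 * w ^ 2) * (Digamma (s / 2) - Digamma (1 / 4))"
    unfolding A_val[symmetric] B_val[symmetric] D_val[symmetric] E_val[symmetric]
    by (simp only: set_integral_add(2) set_integral_diff(2) set_integral_add(1) set_integral_diff(1) A_int B_int D_int E_int)
  also have "\<dots> = 1 / w ^ 2 * (1 / s + 1 / (s - 1) - of_real (ln pi) / 2 + Digamma (s / 2) / 2 - mangoldt_series s)"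
  proof -
    have "4 * (1 / (w - 1 / 2) + 1 / (w + 1 / 2) - 2 * (1 / w)) = 1 / w ^ 2 * (1 / s + 1 / (s - 1))"
    proof -
      have "s = w + 1 / 2" "s - 1 = w - 1 / 2" by (simp_all add: s_def)
      moreover have "4 * (1 / (w - 1 / 2) + 1 / (w + 1 / 2) - 2 * (1 / w)) = 1 / w ^ 2 * (1 / (w + 1 / 2) + 1 / (w - 1 / 2))"
      proof -
        have "2 * w - 1 \<noteq> 0" "2 * w + 1 \<noteq> 0" using w by (auto simp: complex_eq_iff)
        thus ?thesis using w0 by (simp add: divide_simps) (simp add: power2_eq_square algebra_simps)
      qed
      ultimately show ?thesis by simp
    qed
    moreover have "complex_of_real (Digamma (1 / 4)) = Digamma (1 / 4)"
      using Polygamma_of_real[of "1 / 4 :: real" 0, where ?'a = complex] by simp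
    ultimately show ?thesis
      by (simp only: of_real_divide of_real_diff) (simp add: algebra_simps diff_divide_distrib)
  qed
  also have "\<dots> = 1 / w ^ 2 * (deriv xi_entire s / xi_entire s)" unfolding xi_log_deriv[OF s] ..
  finally show ?thesis unfolding s_def
  proof (rule set_integral_transfer[OF int])
    fix t :: real assume "t \<in> {0..}"
    hence t: "t \<ge> 0" by simp
    have "A t = of_real (4 * (exp (t / 2) + exp (- t / 2) - 2)) * ?e t"
    proof -
      have "exp (- (w - 1 / 2) * of_real t) = of_real (exp (t / 2)) * ?e t"
        "exp (- (w + 1 / 2) * of_real t) = of_real (exp (- t / 2)) * ?e t"
        by (simp_all add: exp_of_real[symmetric] exp_add[symmetric] algebra_simps)
      thus ?thesis by (simp only: A_def) (simp add: algebra_simps)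
    qed
    thus "of_real (Psi t) * ?e t = A t - of_real (Psi_prime_part t) * ?e t
      + of_real ((Digamma (1 / 4) - ln pi) / 2) * (of_real t * ?e t) + of_real (1 / 4 * Psi_gamma_part t) * ?e t"
      unfolding Psi_eq[OF t] by (simp add: algebra_simps diff_divide_distrib)
  qed
qed

section \<open>The sum over the zeros\<close>

abbreviation (input) xi_zeros :: "complex set" where
  "xi_zeros \<equiv> {\<gamma>. xi_line \<gamma> = 0}"

text \<open>The factor with exponent 1/4 is the price paid in \<open>Psi_bound\<close> for inserting
  the zero-free region. As 0 is not a zero, the zeros stay at distance r from it, which allows
  comparing |\<gamma>| with 1 + |\<gamma>|; the total exponent is -2 + 1/4 = -7/4.\<close>

lemma summable_xi_zeros:
  "(\<lambda>\<gamma>. real (xi.mult \<gamma>) / norm \<gamma> ^ 2 * (norm \<gamma> + 3) powr (1/4)) summable_on xi_zeros"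
proof -
  have "continuous (at 0) xi_line"
    using holomorphic_on_imp_continuous_on[OF xi.holo] by (simp add: continuous_on_eq_continuous_at)
  from continuous_at_avoid[OF this xi.f0]
  obtain r where r: "r > 0" "\<And>y. dist 0 y < r \<Longrightarrow> xi_line y \<noteq> 0" by auto
  define D where "D = (1 + 1 / r) ^ 2 * 3 powr (1/4)"
  show ?thesis
  proof (rule summable_on_comparison_test)
    show "(\<lambda>\<gamma>. D * (real (xi.mult \<gamma>) * (1 + norm \<gamma>) powr (-7/4))) summable_on xi_zeros"
      by (intro summable_on_cmult_right xi.summable_zeros)
    fix \<gamma> assume \<gamma>: "\<gamma> \<in> xi_zeros"
    have n: "norm \<gamma> \<ge> r" using r(2)[of \<gamma>] \<gamma> by (cases "norm \<gamma> < r") auto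
    hence n0: "norm \<gamma> > 0" using r(1) by linarith
    have "1 + norm \<gamma> \<le> (1 + 1 / r) * norm \<gamma>" using n r(1) by (simp add: field_simps)
    hence "1 / norm \<gamma> \<le> (1 + 1 / r) / (1 + norm \<gamma>)"
    proof -
      have "(1 + norm \<gamma>) / norm \<gamma> \<le> 1 + 1 / r"
        using n0 \<open>1 + norm \<gamma> \<le> (1 + 1 / r) * norm \<gamma>\<close> by (subst pos_divide_le_eq) auto
      hence "1 / norm \<gamma> * (1 + norm \<gamma>) \<le> 1 + 1 / r" by simp
      moreover have "0 < 1 + norm \<gamma>" using n0 by linarith
      ultimately show ?thesis by (subst pos_le_divide_eq)
    qed
    hence "(1 / norm \<gamma>) ^ 2 \<le> ((1 + 1 / r) / (1 + norm \<gamma>)) ^ 2" by (intro power_mono) auto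
    hence "1 / norm \<gamma> ^ 2 \<le> (1 + 1 / r) ^ 2 / (1 + norm \<gamma>) ^ 2"
      by (simp only: power_divide power_one)
    moreover have "(norm \<gamma> + 3) powr (1/4) \<le> (3 * (1 + norm \<gamma>)) powr (1/4)"
      by (intro powr_mono2) auto
    hence "(norm \<gamma> + 3) powr (1/4) \<le> 3 powr (1/4) * (1 + norm \<gamma>) powr (1/4)"
      by (subst (asm) powr_mult) simp_all
    ultimately have "1 / norm \<gamma> ^ 2 * (norm \<gamma> + 3) powr (1/4)
        \<le> (1 + 1 / r) ^ 2 / (1 + norm \<gamma>) ^ 2 * (3 powr (1/4) * (1 + norm \<gamma>) powr (1/4))"
      by (intro mult_mono) auto
    also have "\<dots> = D * (1 + norm \<gamma>) powr (-7/4)"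
    proof -
      have "(1 + norm \<gamma>) powr (1/4) = (1 + norm \<gamma>) powr (2 + (-7/4))" by simp
      also have "\<dots> = (1 + norm \<gamma>) ^ 2 * (1 + norm \<gamma>) powr (-7/4)"
        unfolding powr_add by simp
      finally have e: "(1 + norm \<gamma>) powr (1/4) = (1 + norm \<gamma>) ^ 2 * (1 + norm \<gamma>) powr (-7/4)" .
      have "1 + norm \<gamma> \<noteq> 0" using n0 by linarith
      thus ?thesis unfolding e D_def by simp
    qed
    finally have "real (xi.mult \<gamma>) * (1 / norm \<gamma> ^ 2 * (norm \<gamma> + 3) powr (1/4))
        \<le> real (xi.mult \<gamma>) * (D * (1 + norm \<gamma>) powr (-7/4))" by (rule mult_left_mono) simp
    thus "real (xi.mult \<gamma>) / norm \<gamma> ^ 2 * (norm \<gamma> + 3) powr (1/4) \<le> D * (real (xi.mult \<gamma>) * (1 + norm \<gamma>) powr (-7/4))"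
      by (simp add: mult_ac)
  qed auto
qed

lemma summable_xi_zeros':
  "(\<lambda>\<gamma>. real (xi.mult \<gamma>) / norm \<gamma> ^ 2) summable_on xi_zeros"
proof (rule summable_on_comparison_test[OF summable_xi_zeros])
  fix \<gamma> :: complex
  have "(norm \<gamma> + 3) powr (1/4) \<ge> 1" by (intro ge_one_powr_ge_zero) auto
  from mult_left_mono[OF this, of "real (xi.mult \<gamma>) / norm \<gamma> ^ 2"]
  show "real (xi.mult \<gamma>) / norm \<gamma> ^ 2 \<le> real (xi.mult \<gamma>) / norm \<gamma> ^ 2 * (norm \<gamma> + 3) powr (1/4)" by simp
qed auto

definition zero_term :: "real \<Rightarrow> complex \<Rightarrow> complex" where
  "zero_term t \<gamma> = of_nat (xi.mult \<gamma>) * ((1 - exp (\<i> * \<gamma> * of_real t)) / \<gamma> ^ 2)"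

definition zero_sum :: "real \<Rightarrow> complex" where
  "zero_sum t = (\<Sum>\<^sub>\<infinity>\<gamma>\<in>xi_zeros. zero_term t \<gamma>)"

text \<open>Kept general in b: the value 1/2 gives convergence and the Laplace transform, while the
  final estimate uses the zero-free region with b depending on \<gamma>.\<close>

lemma zero_term_bound:
  assumes "t \<ge> 0" "\<bar>Im \<gamma>\<bar> \<le> b"
  shows "norm (zero_term t \<gamma>) \<le> 2 * exp (b * t) * (real (xi.mult \<gamma>) / norm \<gamma> ^ 2)"
proof -
  have b: "b \<ge> 0" using assms(2) by linarith
  have "norm (1 - exp (\<i> * \<gamma> * of_real t)) \<le> 1 + exp (- Im \<gamma> * t)"
    using norm_triangle_ineq4[of 1 "exp (\<i> * \<gamma> * of_real t)"] by simp
  also have "exp (- Im \<gamma> * t) \<le> exp (b * t)"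
    using assms by (simp only: exp_le_cancel_iff) (intro mult_right_mono, auto)
  also have "1 \<le> exp (b * t)" using b assms(1) by simp
  finally have "norm (1 - exp (\<i> * \<gamma> * of_real t)) \<le> 2 * exp (b * t)" by simp
  from mult_left_mono[OF this, of "real (xi.mult \<gamma>) / norm \<gamma> ^ 2"]
  show ?thesis unfolding zero_term_def norm_mult norm_divide norm_power norm_of_nat
    by (simp add: field_simps)
qed

lemma zero_term_bound_half:
  assumes "t \<ge> 0" "\<gamma> \<in> xi_zeros"
  shows "norm (zero_term t \<gamma>) \<le> 2 * exp (1 / 2 * t) * (real (xi.mult \<gamma>) / norm \<gamma> ^ 2)"
  using assms xi_line_zero_Im[of \<gamma>] by (intro zero_term_bound) auto

lemma zero_term_abs_summable:
  assumes "t \<ge> 0"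
  shows "(\<lambda>\<gamma>. norm (zero_term t \<gamma>)) summable_on xi_zeros"
  by (rule summable_on_comparison_test[OF summable_on_cmult_right[OF summable_xi_zeros'] zero_term_bound_half[OF assms]]) auto

lemma zero_sum_has_sum:
  assumes "t \<ge> 0"
  shows "(zero_term t has_sum zero_sum t) xi_zeros"
  unfolding zero_sum_def
  by (rule has_sum_infsum[OF abs_summable_summable[OF zero_term_abs_summable[OF assms]]])

text \<open>Links the unordered sum over the zeros to the limit over discs in which the partial
  fraction expansion is available.\<close>

lemma zeros_upto_at_top: "filterlim (\<lambda>n. xi.zeros_upto (real n)) (finite_subsets_at_top xi_zeros) sequentially"
  unfolding filterlim_finite_subsets_at_top
proof (intro allI impI)
  fix X assume X: "finite X \<and> X \<subseteq> xi_zeros"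
  have "\<forall>\<^sub>F n in sequentially. real n \<ge> Max (insert 0 (norm ` X))"
    by (rule eventually_compose_filterlim[OF eventually_ge_at_top filterlim_real_sequentially])
  thus "\<forall>\<^sub>F n in sequentially. finite (xi.zeros_upto (real n)) \<and> X \<subseteq> xi.zeros_upto (real n) \<and> xi.zeros_upto (real n) \<subseteq> xi_zeros"
  proof eventually_elim
    case (elim n)
    have "norm x \<le> real n" if "x \<in> X" for x using elim X that by auto
    thus ?case using X xi.finite_zeros_upto by (auto simp: xi.zeros_upto_def)
  qed
qed

lemma zero_sum_limit:
  assumes "t \<ge> 0"
  shows "(\<lambda>n. \<Sum>\<gamma>\<in>xi.zeros_upto (real n). zero_term t \<gamma>) \<longlonglongrightarrow> zero_sum t"
  using zero_sum_has_sum[OF assms] zeros_upto_at_top unfolding has_sum_def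
  by (rule filterlim_compose)

definition zero_const :: real where
  "zero_const = (\<Sum>\<^sub>\<infinity>\<gamma>\<in>xi_zeros. real (xi.mult \<gamma>) / norm \<gamma> ^ 2)"

lemma zero_partial_sum_bound:
  assumes "t \<ge> 0"
  shows "norm (\<Sum>\<gamma>\<in>xi.zeros_upto R. zero_term t \<gamma>) \<le> 2 * zero_const * exp (1 / 2 * t)"
proof -
  have sub: "xi.zeros_upto R \<subseteq> xi_zeros" by (auto simp: xi.zeros_upto_def)
  have "norm (\<Sum>\<gamma>\<in>xi.zeros_upto R. zero_term t \<gamma>) \<le> (\<Sum>\<gamma>\<in>xi.zeros_upto R. 2 * exp (1 / 2 * t) * (real (xi.mult \<gamma>) / norm \<gamma> ^ 2))"
    using sub by (intro sum_norm_le zero_term_bound_half assms) auto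
  also have "\<dots> = 2 * exp (1 / 2 * t) * (\<Sum>\<gamma>\<in>xi.zeros_upto R. real (xi.mult \<gamma>) / norm \<gamma> ^ 2)"
    by (simp add: sum_distrib_left)
  also have "\<dots> \<le> 2 * exp (1 / 2 * t) * zero_const"
    unfolding zero_const_def
    by (intro mult_left_mono finite_sum_le_infsum summable_xi_zeros' xi.finite_zeros_upto sub) auto
  finally show ?thesis by (simp add: mult_ac)
qed

lemma zero_sum_bound:
  assumes "t \<ge> 0"
  shows "norm (zero_sum t) \<le> 2 * zero_const * exp (1 / 2 * t)"
  by (rule tendsto_upperbound[OF tendsto_norm[OF zero_sum_limit[OF assms]] always_eventually])
     (use zero_partial_sum_bound[OF assms] in blast, simp)

lemma zero_sum_continuous: "continuous_on {0..} zero_sum"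
proof -
  have cont: "continuous_on {0..<T} zero_sum" for T
    unfolding zero_sum_def[abs_def]
  proof (rule uniform_limit_theorem[OF _ Weierstrass_m_test_general])
    show "\<forall>\<^sub>F X in finite_subsets_at_top xi_zeros. continuous_on {0..<T} (\<lambda>t. \<Sum>\<gamma>\<in>X. zero_term t \<gamma>)"
      unfolding zero_term_def divide_inverse by (intro always_eventually allI continuous_intros)
    show "(\<lambda>\<gamma>. 2 * exp (1 / 2 * T) * (real (xi.mult \<gamma>) / norm \<gamma> ^ 2)) summable_on xi_zeros"
      by (intro summable_on_cmult_right summable_xi_zeros')
    fix \<gamma> t assume \<gamma>: "\<gamma> \<in> xi_zeros" and t: "t \<in> {0..<T}"
    have "norm (zero_term t \<gamma>) \<le> 2 * exp (1 / 2 * t) * (real (xi.mult \<gamma>) / norm \<gamma> ^ 2)"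
      using \<gamma> t by (intro zero_term_bound_half) auto
    also have "\<dots> \<le> 2 * exp (1 / 2 * T) * (real (xi.mult \<gamma>) / norm \<gamma> ^ 2)"
      using t by (intro mult_right_mono) auto
    finally show "norm (zero_term t \<gamma>) \<le> 2 * exp (1 / 2 * T) * (real (xi.mult \<gamma>) / norm \<gamma> ^ 2)" .
  qed simp
  show ?thesis by (rule continuous_on_atLeast[OF cont])
qed

text \<open>The transform (1/k - 1/(k - i \<gamma>)) / \<gamma>^2 is rearranged so that 1/k^2 comes
  out. What remains is a partial fraction of xi'/xi and a term i/\<gamma>, which cancels in sums
  over symmetric discs.\<close>

lemma zero_term_Laplace:
  fixes \<gamma> :: complex
  assumes \<gamma>: "\<gamma> \<in> xi_zeros" and k: "k \<ge> (1::real)"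
  shows "integrable lborel (\<lambda>t. indicator {0..} t *\<^sub>R (zero_term t \<gamma> * exp (- of_real k * of_real t)))"
    and "(LBINT t. indicator {0..} t *\<^sub>R (zero_term t \<gamma> * exp (- of_real k * of_real t)))
      = 1 / of_real k ^ 2 * (xi.mult \<gamma> / (of_real k - \<i> * \<gamma>) - \<i> * (xi.mult \<gamma> / \<gamma>))"
proof -
  have Im: "\<bar>Im \<gamma>\<bar> \<le> 1 / 2" using xi_line_zero_Im \<gamma> by auto
  have \<gamma>0: "\<gamma> \<noteq> 0" using \<gamma> xi.f0 by auto
  have v: "Re (of_real k - \<i> * \<gamma>) > 0" "Re (of_real k :: complex) > 0" using Im k by auto
  have nz: "of_real k - \<i> * \<gamma> \<noteq> 0" "of_real k \<noteq> (0::complex)"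
    using v by (metis less_irrefl zero_complex.simps(1))+
  define c where "c = of_nat (xi.mult \<gamma>) / \<gamma> ^ 2"
  have eq: "indicator {0..} t *\<^sub>R (zero_term t \<gamma> * exp (- of_real k * of_real t)) =
     c * (indicator {0..} t *\<^sub>R exp (- of_real k * of_real t) - indicator {0..} t *\<^sub>R exp (- (of_real k - \<i> * \<gamma>) * of_real t))" for t
  proof -
    have "exp (\<i> * \<gamma> * of_real t) * exp (- of_real k * of_real t) = exp (- (of_real k - \<i> * \<gamma>) * of_real t)"
      by (simp add: exp_add[symmetric] algebra_simps)
    moreover have "zero_term t \<gamma> * exp (- of_real k * of_real t)
        = c * (exp (- of_real k * of_real t) - exp (\<i> * \<gamma> * of_real t) * exp (- of_real k * of_real t))"
      by (simp add: zero_term_def c_def algebra_simps diff_divide_distrib)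
    ultimately have main: "zero_term t \<gamma> * exp (- of_real k * of_real t)
        = c * (exp (- of_real k * of_real t) - exp (- (of_real k - \<i> * \<gamma>) * of_real t))" by (simp only:)
    show ?thesis unfolding main by (cases "t \<ge> 0") simp_all
  qed
  show "integrable lborel (\<lambda>t. indicator {0..} t *\<^sub>R (zero_term t \<gamma> * exp (- of_real k * of_real t)))"
    unfolding eq by (intro integrable_mult_right Bochner_Integration.integrable_diff exp_integral_indicator(1) v)
  have "(LBINT t. indicator {0..} t *\<^sub>R (zero_term t \<gamma> * exp (- of_real k * of_real t)))
      = c * (1 / of_real k - 1 / (of_real k - \<i> * \<gamma>))"
    unfolding eq integral_mult_right_zero
    by (subst Bochner_Integration.integral_diff) (simp_all only: exp_integral_indicator v)
  also have "\<dots> = 1 / of_real k ^ 2 * (xi.mult \<gamma> / (of_real k - \<i> * \<gamma>) - \<i> * (xi.mult \<gamma> / \<gamma>))"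
  proof -
    have "1 / \<gamma> ^ 2 * (1 / K - 1 / (K - \<i> * \<gamma>)) = 1 / K ^ 2 * (1 / (K - \<i> * \<gamma>) - \<i> * (1 / \<gamma>))"
      if "K \<noteq> 0" "K - \<i> * \<gamma> \<noteq> 0" for K
    proof -
      have "1 / K - 1 / (K - \<i> * \<gamma>) = - \<i> * \<gamma> / (K * (K - \<i> * \<gamma>))"
        using that by (simp add: diff_frac_eq)
      moreover have "1 / (K - \<i> * \<gamma>) - \<i> * (1 / \<gamma>) = - \<i> * K / (\<gamma> * (K - \<i> * \<gamma>))"
      proof -
        have "1 / (K - \<i> * \<gamma>) - \<i> / \<gamma> = (\<gamma> - \<i> * (K - \<i> * \<gamma>)) / ((K - \<i> * \<gamma>) * \<gamma>)"
          using that \<gamma>0 by (simp add: diff_frac_eq)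
        also have "\<gamma> - \<i> * (K - \<i> * \<gamma>) = - \<i> * K" by (simp add: algebra_simps flip: mult.assoc)
        finally show ?thesis by (simp add: mult.commute)
      qed
      ultimately show ?thesis using that \<gamma>0 by (simp add: power2_eq_square)
    qed
    from this[OF nz(2,1)] show ?thesis
      by (simp add: c_def right_diff_distrib divide_inverse mult_ac)
  qed
  finally show "(LBINT t. indicator {0..} t *\<^sub>R (zero_term t \<gamma> * exp (- of_real k * of_real t)))
      = 1 / of_real k ^ 2 * (xi.mult \<gamma> / (of_real k - \<i> * \<gamma>) - \<i> * (xi.mult \<gamma> / \<gamma>))" .
qed

text \<open>Dominated convergence over the disc sums, whose common majorant exp(t/2) comes from |Im
  \<gamma>| <= 1/2. Only after summation over a disc do the terms i/\<gamma> drop out and the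
  partial fractions of xi'/xi appear.\<close>

lemma zero_sum_Laplace:
  assumes k: "k \<ge> (1::real)"
  shows "set_integrable lborel {0..} (\<lambda>t. zero_sum t * exp (- of_real k * of_real t))"
    and "(LINT t:{0..}|lborel. zero_sum t * exp (- of_real k * of_real t))
      = 1 / of_real k ^ 2 * (deriv xi_entire (1 / 2 + of_real k) / xi_entire (1 / 2 + of_real k))"
proof -
  let ?h = "\<lambda>t. indicator {0..} t *\<^sub>R (zero_sum t * exp (- of_real k * of_real t)) :: complex"
  let ?hn = "\<lambda>n t. \<Sum>\<gamma>\<in>xi.zeros_upto (real n). indicator {0..} t *\<^sub>R (zero_term t \<gamma> * exp (- of_real k * of_real t))"
  let ?w = "\<lambda>t. 2 * zero_const * (indicator {0..} t * exp (- (k - 1 / 2) * t)) :: real"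
  have mem: "\<gamma> \<in> xi_zeros" if "\<gamma> \<in> xi.zeros_upto R" for \<gamma> R using that by (simp add: xi.zeros_upto_def)
  have hn_int: "integrable lborel (?hn n)" for n
    by (intro Bochner_Integration.integrable_sum zero_term_Laplace(1) k) (rule mem)
  have hn_eq: "?hn n t = indicator {0..} t *\<^sub>R ((\<Sum>\<gamma>\<in>xi.zeros_upto (real n). zero_term t \<gamma>) * exp (- of_real k * of_real t))" for n t
    by (simp add: scaleR_sum_right sum_distrib_right)
  have lim: "(\<lambda>n. ?hn n t) \<longlonglongrightarrow> ?h t" for t
  proof (cases "t \<ge> 0")
    case True
    show ?thesis unfolding hn_eq by (intro tendsto_intros zero_sum_limit True)
  qed simp
  have w_int: "integrable lborel ?w"
    using set_integrable_exp_real[of "k - 1 / 2" 0] k by (auto simp: set_integrable_def intro!: integrable_mult_right)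
  have bound: "norm (?hn n t) \<le> ?w t" for n t
  proof (cases "t \<ge> 0")
    case True
    have "norm (?hn n t) = norm (\<Sum>\<gamma>\<in>xi.zeros_upto (real n). zero_term t \<gamma>) * exp (- k * t)"
      unfolding hn_eq using True by (simp add: norm_mult)
    also have "\<dots> \<le> 2 * zero_const * exp (1 / 2 * t) * exp (- k * t)"
      by (intro mult_right_mono zero_partial_sum_bound True) auto
    also have "\<dots> = 2 * zero_const * exp (- (k - 1 / 2) * t)"
      by (simp add: exp_add[symmetric] algebra_simps)
    finally show ?thesis using True by simp
  qed simp
  have h_meas: "?h \<in> borel_measurable lborel"
    by (rule borel_measurable_LIMSEQ_metric[OF _ lim]) (use hn_int in auto)
  note dom = h_meas borel_measurable_integrable[OF hn_int] w_int AE_I2[OF lim] AE_I2[OF bound]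
  have conv: "(\<lambda>n. LBINT t. ?hn n t) \<longlonglongrightarrow> (LBINT t. ?h t)"
    by (rule integral_dominated_convergence[OF dom])
  have h_int: "integrable lborel ?h"
    by (rule integrable_dominated_convergence[OF dom])
  show "set_integrable lborel {0..} (\<lambda>t. zero_sum t * exp (- of_real k * of_real t))"
    using h_int by (simp add: set_integrable_def)
  have val: "(LBINT t. ?hn n t) = 1 / of_real k ^ 2 * (\<Sum>\<gamma>\<in>xi.zeros_upto (real n). xi.mult \<gamma> / (1 / 2 + of_real k - (1 / 2 - \<i> * \<gamma>)))" for n
  proof -
    have "(LBINT t. ?hn n t) = (\<Sum>\<gamma>\<in>xi.zeros_upto (real n). 1 / of_real k ^ 2 * (xi.mult \<gamma> / (of_real k - \<i> * \<gamma>) - \<i> * (xi.mult \<gamma> / \<gamma>)))"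
    proof -
      have "(LBINT t. ?hn n t) = (\<Sum>\<gamma>\<in>xi.zeros_upto (real n). LBINT t. indicator {0..} t *\<^sub>R (zero_term t \<gamma> * exp (- of_real k * of_real t)))"
        by (rule Bochner_Integration.integral_sum) (rule zero_term_Laplace(1)[OF mem k])
      also have "\<dots> = (\<Sum>\<gamma>\<in>xi.zeros_upto (real n). 1 / of_real k ^ 2 * (xi.mult \<gamma> / (of_real k - \<i> * \<gamma>) - \<i> * (xi.mult \<gamma> / \<gamma>)))"
        by (rule sum.cong[OF refl]) (rule zero_term_Laplace(2)[OF mem k])
      finally show ?thesis .
    qed
    also have "\<dots> = 1 / of_real k ^ 2 * ((\<Sum>\<gamma>\<in>xi.zeros_upto (real n). xi.mult \<gamma> / (of_real k - \<i> * \<gamma>)) - \<i> * (\<Sum>\<gamma>\<in>xi.zeros_upto (real n). xi.mult \<gamma> / \<gamma>))"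
      by (simp only: sum_distrib_left[symmetric] sum_subtractf)
    also have "(\<Sum>\<gamma>\<in>xi.zeros_upto (real n). xi.mult \<gamma> / \<gamma>) = 0" by (rule xi.sum_zeros_odd)
    \<comment> \<open>The reflection \<gamma> -> -\<gamma> changes k - i \<gamma> into k + i
      \<gamma> = s - (1/2 - i \<gamma>) with s = 1/2 + k.\<close>
    also have "(\<Sum>\<gamma>\<in>xi.zeros_upto (real n). xi.mult \<gamma> / (of_real k - \<i> * \<gamma>))
        = (\<Sum>\<gamma>\<in>uminus ` xi.zeros_upto (real n). xi.mult \<gamma> / (of_real k - \<i> * \<gamma>))"
      by (simp only: xi.zeros_upto_uminus)
    also have "\<dots> = (\<Sum>\<gamma>\<in>xi.zeros_upto (real n). xi.mult \<gamma> / (1 / 2 + of_real k - (1 / 2 - \<i> * \<gamma>)))"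
      by (subst sum.reindex) (auto simp: inj_on_def)
    finally show ?thesis by simp
  qed
  have "xi_entire (1 / 2 + of_real k) \<noteq> 0" using k by (intro xi_entire_nonzero) simp
  from tendsto_mult_left[OF xi_log_deriv_limit[OF this], of "1 / of_real k ^ 2"]
  have "(\<lambda>n. LBINT t. ?hn n t) \<longlonglongrightarrow> 1 / of_real k ^ 2 * (deriv xi_entire (1 / 2 + of_real k) / xi_entire (1 / 2 + of_real k))"
    unfolding val .
  from LIMSEQ_unique[OF conv this]
  show "(LINT t:{0..}|lborel. zero_sum t * exp (- of_real k * of_real t))
      = 1 / of_real k ^ 2 * (deriv xi_entire (1 / 2 + of_real k) / xi_entire (1 / 2 + of_real k))"
    by (simp add: set_lebesgue_integral_def)
qed

text \<open>The transforms agree at every integer k >= 4, just above the exponent 3 of the crude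
  bound. Uniqueness is applied to the real and the imaginary part of the difference, so reality of
  the sum over the zeros is obtained along the way.\<close>

theorem zero_sum_eq_Psi:
  assumes t: "t \<ge> 0"
  shows "zero_sum t = of_real (Psi t)"
proof -
  obtain K where K: "\<And>t. t \<ge> 0 \<Longrightarrow> \<bar>Psi t\<bar> \<le> K * exp (3 * t)" using Psi_crude_bound by blast
  have zc: "zero_const \<ge> 0" unfolding zero_const_def by (intro infsum_nonneg) auto
  define h where "h t = of_real (Psi t) - zero_sum t" for t
  have h_cont: "continuous_on {0..} h" unfolding h_def by (intro continuous_intros Psi_continuous zero_sum_continuous)
  have h_bound: "norm (h t) \<le> (K + 2 * zero_const) * exp (3 * t)" if "t \<ge> 0" for t
  proof -
    have "norm (zero_sum t) \<le> 2 * zero_const * exp (1 / 2 * t)" by (rule zero_sum_bound[OF that])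
    also have "\<dots> \<le> 2 * zero_const * exp (3 * t)" using zc that by (intro mult_left_mono) auto
    finally show ?thesis
      unfolding h_def using norm_triangle_ineq4[of "of_real (Psi t)" "zero_sum t"] K[OF that]
      by (simp add: distrib_right)
  qed
  have h_Laplace: "set_integrable lborel {0..} (\<lambda>t. h t * of_real (exp (- real k * t)))"
    "(LINT t:{0..}|lborel. h t * of_real (exp (- real k * t))) = 0" if k: "k \<ge> 4" for k :: nat
  proof -
    have e: "complex_of_real (exp (- real k * t)) = exp (- of_real (real k) * of_real t)" for t
      by (simp add: exp_of_real[symmetric])
    have P: "set_integrable lborel {0..} (\<lambda>t. complex_of_real (Psi t) * exp (- of_real (real k) * of_real t))"
      "(LINT t:{0..}|lborel. complex_of_real (Psi t) * exp (- of_real (real k) * of_real t))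
       = 1 / of_real (real k) ^ 2 * (deriv xi_entire (1 / 2 + of_real (real k)) / xi_entire (1 / 2 + of_real (real k)))"
      using Psi_Laplace[of "of_real (real k)"] k by (simp_all del: of_real_of_nat_eq)
    have k1: "real k \<ge> 1" using k by simp
    note Z = zero_sum_Laplace[OF k1]
    show "set_integrable lborel {0..} (\<lambda>t. h t * of_real (exp (- real k * t)))"
      unfolding e h_def left_diff_distrib by (rule set_integral_diff(1)[OF P(1) Z(1)])
    show "(LINT t:{0..}|lborel. h t * of_real (exp (- real k * t))) = 0"
      unfolding e h_def left_diff_distrib set_integral_diff(2)[OF P(1) Z(1)] P(2) Z(2) by simp
  qed
  have part: "p (h t) = 0" if p: "bounded_linear p" "\<And>z. \<bar>p z\<bar> \<le> norm z" for p :: "complex \<Rightarrow> real"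
  proof (rule Laplace_unique_real[of "\<lambda>t. p (h t)" _ 3 4, OF _ _ _ _ t])
    show "continuous_on {0..} (\<lambda>t. p (h t))"
      by (intro linear_continuous_on_compose[OF h_cont] bounded_linear.linear p)
    show "\<bar>p (h t)\<bar> \<le> (K + 2 * zero_const) * exp (3 * t)" if "t \<ge> 0" for t
      using p(2)[of "h t"] h_bound[OF that] by linarith
    fix k :: nat assume k: "k \<ge> 4"
    have "(LBINT t. p (indicator {0..} t *\<^sub>R (h t * of_real (exp (- real k * t)))))
      = p (LBINT t. indicator {0..} t *\<^sub>R (h t * of_real (exp (- real k * t))))"
      using h_Laplace(1)[OF k] by (intro integral_bounded_linear p) (simp add: set_integrable_def)
    moreover have "p (indicator {0..} t *\<^sub>R (h t * of_real (exp (- real k * t)))) = indicator {0..} t *\<^sub>R (p (h t) * exp (- real k * t))" for t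
    proof -
      have "indicator {0..} t *\<^sub>R (h t * of_real (exp (- real k * t))) = (indicator {0..} t * exp (- real k * t)) *\<^sub>R h t"
        by (simp add: scaleR_conv_of_real mult_ac)
      thus ?thesis by (simp only: linear_scale[OF bounded_linear.linear[OF p(1)]]) simp
    qed
    ultimately show "(LINT t:{0..}|lborel. p (h t) * exp (- real k * t)) = 0"
      using h_Laplace(2)[OF k] linear_0[OF bounded_linear.linear[OF p(1)]]
      by (simp only: set_lebesgue_integral_def)
  qed simp
  have "Re (h t) = 0" "Im (h t) = 0"
    using part[OF bounded_linear_Re abs_Re_le_cmod] part[OF bounded_linear_Im abs_Im_le_cmod] by auto
  thus ?thesis by (simp add: h_def complex_eq_iff)
qed

text \<open>At a zero the multiplicity is positive, so the truncation by \<open>nat\<close> in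
  \<open>xi.mult\<close> loses nothing.\<close>

lemma zorder_mult: "\<gamma> \<in> xi_zeros \<Longrightarrow> of_int (zorder xi_line \<gamma>) = (of_nat (xi.mult \<gamma>) :: complex)"
proof -
  assume "\<gamma> \<in> xi_zeros"
  hence "xi.mult \<gamma> > 0" by (intro xi.mult_pos) simp
  hence "int (xi.mult \<gamma>) = zorder xi_line \<gamma>" unfolding xi.mult_def by simp
  thus ?thesis by (metis of_int_of_nat_eq)
qed

lemma Psi_has_sum_exp:
  assumes "t \<ge> 0"
  shows "((\<lambda>\<gamma>. of_int (zorder xi_line \<gamma>) * ((1 - exp (\<i> * \<gamma> * of_real t)) / \<gamma> ^ 2)) has_sum of_real (Psi t)) xi_zeros"
proof -
  have "zero_term t \<gamma> = of_int (zorder xi_line \<gamma>) * ((1 - exp (\<i> * \<gamma> * of_real t)) / \<gamma> ^ 2)"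
    if "\<gamma> \<in> xi_zeros" for \<gamma> by (simp only: zero_term_def zorder_mult[OF that])
  from has_sum_cong[OF this] have "(zero_term t has_sum of_real (Psi t)) xi_zeros \<longleftrightarrow>
    ((\<lambda>\<gamma>. of_int (zorder xi_line \<gamma>) * ((1 - exp (\<i> * \<gamma> * of_real t)) / \<gamma> ^ 2)) has_sum of_real (Psi t)) xi_zeros" .
  thus ?thesis using zero_sum_has_sum[OF assms] unfolding zero_sum_eq_Psi[OF assms] by (rule iffD1)
qed

text \<open>The exponential sum is averaged with its reindexing by \<gamma> -> -\<gamma>, which
  preserves zeros and multiplicities.\<close>

lemma Psi_has_sum_cos:
  assumes "t \<ge> 0"
  shows "((\<lambda>\<gamma>. of_int (zorder xi_line \<gamma>) * ((1 - cos (\<gamma> * of_real t)) / \<gamma> ^ 2)) has_sum of_real (Psi t)) xi_zeros"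
proof -
  have S: "(zero_term t has_sum of_real (Psi t)) xi_zeros"
    using zero_sum_has_sum[OF assms] unfolding zero_sum_eq_Psi[OF assms] .
  have "bij_betw uminus xi_zeros xi_zeros"
    by (rule bij_betwI[of _ _ _ uminus]) (auto simp: xi.ev)
  from has_sum_reindex_bij_betw[OF this, of "zero_term t"] S
  have S': "((\<lambda>\<gamma>. zero_term t (- \<gamma>)) has_sum of_real (Psi t)) xi_zeros" by simp
  from has_sum_cmult_right[OF has_sum_add[OF S S'], of "1 / 2"]
  have "((\<lambda>\<gamma>. 1 / 2 * (zero_term t \<gamma> + zero_term t (- \<gamma>))) has_sum of_real (Psi t)) xi_zeros"
    by simp
  thus ?thesis
  proof (rule has_sum_cong[THEN iffD1, rotated])
    fix \<gamma> assume \<gamma>: "\<gamma> \<in> xi_zeros"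
    have "1 - cos (\<gamma> * of_real t) = ((1 - exp (\<i> * \<gamma> * of_real t)) + (1 - exp (- (\<i> * \<gamma> * of_real t)))) / 2"
      by (simp add: cos_exp_eq mult.assoc field_simps)
    moreover have "1 / 2 * (m * (a / g) + m * (b / g)) = m * (((a + b) / 2) / g)" for m a b g :: complex
      by (simp add: add_divide_distrib distrib_left)
    moreover have "\<i> * - \<gamma> * of_real t = - (\<i> * \<gamma> * of_real t)" by simp
    ultimately show "1 / 2 * (zero_term t \<gamma> + zero_term t (- \<gamma>)) = of_int (zorder xi_line \<gamma>) * ((1 - cos (\<gamma> * of_real t)) / \<gamma> ^ 2)"
      unfolding zorder_mult[OF \<gamma>] zero_term_def by (simp only: xi.mult_uminus power2_minus)
  qed
qed

theorem Psi_bound: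
  "\<exists>c>0. \<exists>M>0. \<forall>t::real. t \<ge> 0 \<longrightarrow> \<bar>Psi t\<bar> \<le> M * exp (t / 2 - c * sqrt t)"
proof -
  obtain c where c: "c > 0" "\<And>\<gamma>. xi_line \<gamma> = 0 \<Longrightarrow> \<bar>Im \<gamma>\<bar> \<le> 1 / 2 - c / ln (norm \<gamma> + 3)"
    using zero_free_region by blast
  define W where "W \<gamma> = real (xi.mult \<gamma>) / norm \<gamma> ^ 2 * (norm \<gamma> + 3) powr (1/4)" for \<gamma> :: complex
  have W: "W summable_on xi_zeros" unfolding W_def by (rule summable_xi_zeros)
  \<comment> \<open>Adding 1 makes M positive without knowing that xi has any zero.\<close>
  define M where "M = 2 * (\<Sum>\<^sub>\<infinity>\<gamma>\<in>xi_zeros. W \<gamma>) + 1"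
  have M: "M > 0" unfolding M_def using infsum_nonneg[of xi_zeros W] by (simp add: W_def add_nonneg_pos)
  have "\<bar>Psi t\<bar> \<le> M * exp (t / 2 - sqrt c * sqrt t)" if t: "t \<ge> 0" for t
  proof -
    define E where "E = exp (t / 2 - sqrt c * sqrt t)"
    have tm: "norm (zero_term t \<gamma>) \<le> 2 * E * W \<gamma>" if \<gamma>: "\<gamma> \<in> xi_zeros" for \<gamma>
    proof -
      define L where "L = ln (norm \<gamma> + 3)"
      have L: "L > 0" unfolding L_def by (intro ln_gt_zero) (smt (verit) norm_ge_zero)
      \<comment> \<open>The inequality of means x <= x^2/L + L/4 for x = sqrt(c t). It trades the
        gain c t/L, which depends on \<gamma>, for the uniform gain sqrt(c t) at the cost of
        exp(L/4) = (|\<gamma>| + 3)^(1/4).\<close>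
      have "sqrt c * sqrt t \<le> c * t / L + L / 4"
      proof -
        define x where "x = sqrt c * sqrt t"
        have x: "x * x = c * t" using c(1) t by (simp add: x_def algebra_simps)
        have "0 \<le> (x - L / 2) ^ 2 / L" using L by simp
        also have "\<dots> = c * t / L + L / 4 - x"
          using L by (simp add: x[symmetric] power2_eq_square field_simps)
        finally show ?thesis by (simp add: x_def)
      qed
      hence "(1 / 2 - c / L) * t \<le> (t / 2 - sqrt c * sqrt t) + 1 / 4 * L" by (simp add: algebra_simps)
      hence "exp ((1 / 2 - c / L) * t) \<le> exp ((t / 2 - sqrt c * sqrt t) + 1 / 4 * L)" by simp
      also have "\<dots> = E * (norm \<gamma> + 3) powr (1/4)"
      proof -
        have "norm \<gamma> + 3 \<noteq> 0" by (smt (verit) norm_ge_zero)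
        thus ?thesis unfolding exp_add by (simp add: E_def L_def powr_def)
      qed
      finally have e: "exp ((1 / 2 - c / L) * t) \<le> E * (norm \<gamma> + 3) powr (1/4)" .
      have "norm (zero_term t \<gamma>) \<le> 2 * exp ((1 / 2 - c / L) * t) * (real (xi.mult \<gamma>) / norm \<gamma> ^ 2)"
        using c(2)[of \<gamma>] \<gamma> t by (intro zero_term_bound) (auto simp: L_def)
      also have "\<dots> \<le> 2 * (E * (norm \<gamma> + 3) powr (1/4)) * (real (xi.mult \<gamma>) / norm \<gamma> ^ 2)"
        by (intro mult_right_mono mult_left_mono e) auto
      finally show ?thesis by (simp add: W_def mult_ac)
    qed
    have "\<bar>Psi t\<bar> = norm (zero_sum t)" by (simp add: zero_sum_eq_Psi[OF t])
    also have "\<dots> \<le> (\<Sum>\<^sub>\<infinity>\<gamma>\<in>xi_zeros. 2 * E * W \<gamma>)"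
      by (rule norm_infsum_le[OF zero_sum_has_sum[OF t] has_sum_infsum[OF summable_on_cmult_right[OF W]] tm])
    also have "\<dots> = 2 * E * (\<Sum>\<^sub>\<infinity>\<gamma>\<in>xi_zeros. W \<gamma>)" by (rule infsum_cmult_right[OF W])
    also have "\<dots> \<le> M * E" by (simp add: M_def E_def algebra_simps)
    finally show ?thesis by (simp add: E_def)
  qed
  thus ?thesis using M c(1) by (intro exI[of _ "sqrt c"] exI[of _ M] conjI) auto
qed

theorem theorem1p1:
  shows "(\<forall>z::complex. Im z > 1 / 2 \<longrightarrow>
            set_integrable lborel {0..} (\<lambda>t::real. of_real (Psi t) * exp (\<i> * z * of_real t)) \<and>
            (LINT t:{0..}|lborel. of_real (Psi t) * exp (\<i> * z * of_real t))
              = - (1 / z ^ 2) * (deriv xi (1 / 2 - \<i> * z) / xi (1 / 2 - \<i> * z)))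
       \<and> (\<forall>t::real. t \<ge> 0 \<longrightarrow>
            ((\<lambda>\<gamma>. of_int (zorder xi_line \<gamma>) * ((1 - cos (\<gamma> * of_real t)) / \<gamma> ^ 2))
               has_sum complex_of_real (Psi t)) {\<gamma>. xi_line \<gamma> = 0} \<and>
            ((\<lambda>\<gamma>. of_int (zorder xi_line \<gamma>) * ((1 - exp (\<i> * \<gamma> * of_real t)) / \<gamma> ^ 2))
               has_sum complex_of_real (Psi t)) {\<gamma>. xi_line \<gamma> = 0})
       \<and> (\<exists>c>0. \<exists>M>0. \<forall>t::real. t \<ge> 0 \<longrightarrow> \<bar>Psi t\<bar> \<le> M * exp (t / 2 - c * sqrt t))"
proof -
  have "set_integrable lborel {0..} (\<lambda>t::real. of_real (Psi t) * exp (\<i> * z * of_real t)) \<and>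
      (LINT t:{0..}|lborel. of_real (Psi t) * exp (\<i> * z * of_real t))
        = - (1 / z ^ 2) * (deriv xi (1 / 2 - \<i> * z) / xi (1 / 2 - \<i> * z))" if z: "Im z > 1 / 2" for z
  proof -
    \<comment> \<open>The Laplace variable is w = -i z, for which w^2 = -z^2; this is the origin of
      the minus sign.\<close>
    have w: "Re (- \<i> * z) > 1 / 2" using z by simp
    have e1: "- (- \<i> * z) = \<i> * z" by simp
    have e2: "1 / 2 + - \<i> * z = 1 / 2 - \<i> * z" by simp
    have "(- \<i> * z) ^ 2 = (- \<i>) ^ 2 * z ^ 2" by (rule power_mult_distrib)
    hence e3: "1 / (- \<i> * z) ^ 2 = - (1 / z ^ 2)" by simp
    show ?thesis using Psi_Laplace[OF w] unfolding e1 e2 e3 xi_eq .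
  qed
  thus ?thesis using Psi_has_sum_cos Psi_has_sum_exp Psi_bound by blast
qed

end
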